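(* Let $0<p<\infty$, $0<q,r\le\infty$ and $\beta\in\mathbb{R}$. Then, for $f\in\mathrm T^{p,q,r}_\beta$, $$\|f\|_{\mathrm T^{p,q,r}_\beta}\simeq\bigg\|\Big(\sum_{Q\in\square}\mathbf 1_Q(\cdot)\,|Q|^{-\frac{\beta q}{d}}\,\|f\|^q_{L^r(\bar Q,\frac{\mathrm{d}y\,\mathrm{d}s}{s^{d+1}})}\Big)^{\frac1q}\bigg\|_{L^p(\mathbb{R}^d)}$$ with implicit constants depending only on $d,p,q,r,\beta$.
   Context: The symbol ⨍ denotes the mean-value integral and $B(x,t)$ the open ball in $\mathbb{R}^d$. For $0<p<\infty$, $0<q,r\le\infty$, $\beta\in\mathbb{R}$, $\mathrm T^{p,q,r}_\beta$ is the set of all measurable functions $f$ on $\mathbb{R}^{d+1}_+=(0,\infty)\times\mathbb{R}^d$ with $$\|f\|_{\mathrm T^{p,q,r}_\beta}=\bigg\|\bigg(\int_0^\infty\bigg(⨍_{t/2}^t⨍_{B(\cdot,t)}|s^{-\beta}f(s,y)|^r\,\mathrm{d}y\,\mathrm{d}s\bigg)^{q/r}\frac{\mathrm{d}t}{t}\bigg)^{1/q}\bigg\|_{L^p(\mathbb{R}^d)}<\infty,$$ with the usual replacement of an integral by an essential supremum if $q$ or $r$ is infinite. $\square_k=\{2^kx+[0,2^k)^d:x\in\mathbb{Z}^d\}$ and $\square=\bigcup_{k\in\mathbb{Z}}\square_k$ is the family of all dyadic cubes; $\ell(Q)$ is the side length and $|Q|$ the Lebesgue measure of $Q$. $\bar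 Q=(\frac{\ell(Q)}{2},\ell(Q)]\times Q$ is the Whitney box associated to $Q$ (not the closure). If $q=\infty$, the $\ell^q$-expression is replaced by $\sup_{Q\in\square}\mathbf 1_Q(\cdot)|Q|^{-\beta/d}\|f\|_{L^r(\bar Q,\mathrm{d}y\,\mathrm{d}s/s^{d+1})}$. *)

theory Defs
  imports "HOL-Analysis.Analysis" "HOL-Probability.Essential_Supremum"
begin

text \<open>Real powers on \<open>[0,\<infinity>]\<close>; only used for positive exponents, where \<open>0\<close> and \<open>\<infinity>\<close> are fixed.\<close>

definition enn_powr :: "ennreal \<Rightarrow> real \<Rightarrow> ennreal" where
  "enn_powr x a = (if x = \<infinity> then \<infinity> else ennreal (enn2real x powr a))"

text \<open>The exponent ranges over \<open>(0,\<infinity>]\<close>, represented in \<^typ>\<open>ennreal\<close>.\<close>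

definition Lp_qnorm :: "'a measure \<Rightarrow> ennreal \<Rightarrow> ('a \<Rightarrow> ennreal) \<Rightarrow> ennreal" where
  "Lp_qnorm M r g =
     (if r = \<infinity> then esssup M g
      else enn_powr (\<integral>\<^sup>+ x. enn_powr (g x) (enn2real r) \<partial>M) (1 / enn2real r))"

definition mean_nn_integral :: "'a::euclidean_space set \<Rightarrow> ('a \<Rightarrow> ennreal) \<Rightarrow> ennreal" where
  "mean_nn_integral A g = (\<integral>\<^sup>+ x \<in> A. g x \<partial>lebesgue) / emeasure lebesgue A"

definition upper_half_space :: "(real \<times> (real ^ 'n)) set" where
  "upper_half_space = {0<..} \<times> UNIV"

definition whitney_mean :: "ennreal \<Rightarrow> (real \<times> (real ^ 'n) \<Rightarrow> ennreal) \<Rightarrow> real \<Rightarrow> real ^ 'n \<Rightarrow> ennreal"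
  where
  "whitney_mean r g t x =
     (if r = \<infinity> then esssup (lebesgue_on ({t/2..t} \<times> ball x t)) g
      else enn_powr
        (mean_nn_integral {t/2..t} (\<lambda>s.
           mean_nn_integral (ball x t) (\<lambda>y. enn_powr (g (s, y)) (enn2real r))))
        (1 / enn2real r))"

definition dt_over_t :: "real measure" where
  "dt_over_t = density (lebesgue_on {0<..}) (\<lambda>t. ennreal (1 / t))"

text \<open>Since \<^const>\<open>whitney_mean\<close> already contains the outer power \<open>1/r\<close>, the power \<open>q/r\<close> of the
  unnormalised mean is here the \<open>q\<close>-th power inside the \<open>L\<^sup>q(dt/t)\<close> quasi-norm; for \<open>q = \<infinity>\<close> that
  quasi-norm is the essential supremum over \<open>t > 0\<close>.\<close>

definition T_norm :: "real \<Rightarrow> ennreal \<Rightarrow> ennreal \<Rightarrow> real \<Rightarrow> (real \<times> (real ^ 'n) \<Rightarrow> complex) \<Rightarrow> ennreal"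
  where
  "T_norm p q r \<beta> f =
     Lp_qnorm lebesgue (ennreal p) (\<lambda>x.
       Lp_qnorm dt_over_t q (\<lambda>t.
         whitney_mean r (\<lambda>(s, y). ennreal (norm ((s powr (-\<beta>)) *\<^sub>R f (s, y)))) t x))"

definition T_space :: "real \<Rightarrow> ennreal \<Rightarrow> ennreal \<Rightarrow> real \<Rightarrow> (real \<times> (real ^ 'n) \<Rightarrow> complex) set" where
  "T_space p q r \<beta> =
     {f. f \<in> borel_measurable (lebesgue_on upper_half_space) \<and> T_norm p q r \<beta> f < \<infinity>}"

definition dyadic_cubes_at :: "int \<Rightarrow> (real ^ 'n) set set" where
  "dyadic_cubes_at k =
     {(\<lambda>z. (2 powi k) *\<^sub>R x + z) ` {z. \<forall>i. 0 \<le> z $ i \<and> z $ i < 2 powi k} | x. \<forall>i. x $ i \<in> \<int>}"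

definition dyadic_cubes :: "(real ^ 'n) set set" where
  "dyadic_cubes = (\<Union>k. dyadic_cubes_at k)"

definition side_length :: "(real ^ 'n) set \<Rightarrow> real" where
  "side_length Q = (THE l. \<exists>k. Q \<in> dyadic_cubes_at k \<and> l = 2 powi k)"

definition whitney_box :: "(real ^ 'n) set \<Rightarrow> (real \<times> (real ^ 'n)) set" where
  "whitney_box Q = {side_length Q / 2<..side_length Q} \<times> Q"

definition whitney_box_measure :: "(real ^ 'n) set \<Rightarrow> (real \<times> (real ^ 'n)) measure" where
  "whitney_box_measure Q =
     density (lebesgue_on (whitney_box Q)) (\<lambda>(s, y). ennreal (1 / s ^ (CARD('n) + 1)))"

definition dyadic_norm ::
  "real \<Rightarrow> ennreal \<Rightarrow> ennreal \<Rightarrow> real \<Rightarrow> (real \<times> (real ^ 'n) \<Rightarrow> complex) \<Rightarrow> ennreal" where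
  "dyadic_norm p q r \<beta> f =
     Lp_qnorm lebesgue (ennreal p) (\<lambda>x.
       if q = \<infinity> then
         (SUP Q\<in>dyadic_cubes. indicator Q x *
            ennreal (measure lebesgue Q powr (-\<beta> / CARD('n))) *
            Lp_qnorm (whitney_box_measure Q) r (\<lambda>w. ennreal (norm (f w))))
       else
         enn_powr
           (\<Sum>\<^sub>\<infinity>Q\<in>dyadic_cubes. indicator Q x *
              ennreal (measure lebesgue Q powr (-(\<beta> * enn2real q) / CARD('n))) *
              enn_powr (Lp_qnorm (whitney_box_measure Q) r (\<lambda>w. ennreal (norm (f w))))
                (enn2real q))
           (1 / enn2real q))"

lemma side_length_dyadic_cube:
  fixes Q :: "(real ^ 'n) set"
  assumes "Q \<in> dyadic_cubes_at k"
  shows "side_length Q = 2 powi k"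
proof -
  have diff_less: "\<bar>u $ i - v $ i\<bar> < 2 powi m"
    if asm: "Q \<in> dyadic_cubes_at m" "u \<in> Q" "v \<in> Q" for m u v and i :: 'n
  proof -
    obtain x where Q: "Q = (\<lambda>z. (2 powi m) *\<^sub>R x + z) ` {z. \<forall>i. 0 \<le> z $ i \<and> z $ i < 2 powi m}"
      using asm(1) unfolding dyadic_cubes_at_def by blast
    obtain z w where u: "u = (2 powi m) *\<^sub>R x + z" and v: "v = (2 powi m) *\<^sub>R x + w"
      and z: "\<forall>i. 0 \<le> z $ i \<and> z $ i < 2 powi m" and w: "\<forall>i. 0 \<le> w $ i \<and> w $ i < 2 powi m"
      using asm(2,3) unfolding Q by blast
    have "\<bar>z $ i - w $ i\<bar> < 2 powi m"
      using z[rule_format, of i] w[rule_format, of i] by linarith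
    then show ?thesis by (simp add: u v)
  qed
  have diff_attained: "\<exists>u\<in>Q. \<exists>v\<in>Q. \<forall>i. u $ i - v $ i = a"
    if asm: "Q \<in> dyadic_cubes_at m" "0 \<le> a" "a < 2 powi m" for m a
  proof -
    obtain x where Q: "Q = (\<lambda>z. (2 powi m) *\<^sub>R x + z) ` {z. \<forall>i. 0 \<le> z $ i \<and> z $ i < 2 powi m}"
      using asm(1) unfolding dyadic_cubes_at_def by blast
    define u v where "u = (2 powi m) *\<^sub>R x + (\<chi> i. a)" and "v = (2 powi m) *\<^sub>R x + 0"
    have "u \<in> Q" unfolding Q u_def by (rule image_eqI[OF refl]) (use asm in simp)
    moreover have "v \<in> Q" unfolding Q v_def by (rule image_eqI[OF refl]) simp
    moreover have "\<forall>i. u $ i - v $ i = a" by (simp add: u_def v_def)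
    ultimately show ?thesis by blast
  qed
  have le: "(2::real) powi m \<le> 2 powi j"
    if asm: "Q \<in> dyadic_cubes_at m" "Q \<in> dyadic_cubes_at j" for m j
  proof (rule ccontr)
    assume "\<not> ?thesis"
    then have "(2::real) powi j < 2 powi m" by simp
    then obtain u v where uv: "u \<in> Q" "v \<in> Q" "\<forall>i. u $ i - v $ i = 2 powi j"
      using diff_attained[OF asm(1), of "2 powi j"] by auto
    show False
      using diff_less[OF asm(2) uv(1,2), of undefined] uv(3) by simp
  qed
  show ?thesis
    unfolding side_length_def
  proof (rule the_equality)
    show "\<exists>k'. Q \<in> dyadic_cubes_at k' \<and> (2::real) powi k = 2 powi k'"
      using assms by blast
  next
    fix l :: real
    assume "\<exists>k. Q \<in> dyadic_cubes_at k \<and> l = 2 powi k"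
    then obtain j where "Q \<in> dyadic_cubes_at j" "l = 2 powi j" by blast
    then show "l = 2 powi k"
      using le[OF assms, of j] le[of j, OF _ assms] by (simp add: antisym)
  qed
qed

end

theory Submission
  imports Defs
begin

text \<open>The \<open>k\<close>-th dyadic coefficient at \<open>x\<close> and the Whitney mean at \<open>(t, x)\<close> with \<open>t\<close> comparable to
  \<open>2\<^sup>k\<close> are normalised local \<open>L\<^sup>r\<close> quasi-norms of \<open>f\<close> over comparable regions, each of which is
  covered by boundedly many translates of (pieces of) the other kind. So each side of the equivalence is
  dominated by finitely many quantities built from sequences \<open>a\<^sub>k(x + 2\<^sup>k n)\<close> in place of \<open>a\<^sub>k(x)\<close>,
  where \<open>a\<^sub>k\<close> is constant on the dyadic cubes of side \<open>2\<^sup>k\<close> and \<open>n\<close> is an integer vector, and the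
  point is to remove the translations. For \<open>q = \<infinity>\<close> this is possible because the level sets are
  unions of dyadic cubes, of which only the maximal, disjoint ones matter. For \<open>q < \<infinity>\<close> one may take
  \<open>q = 1\<close>; then telescoping the \<open>p\<close>-th power of the sum from coarse to fine cubes reduces the claim
  to the case \<open>q = \<infinity>\<close> applied to the partial sums.\<close>

section \<open>Powers and distribution functions\<close>

text \<open>The obstacle is that the translation by 2^k n depends on k. The integral of a single
  term is translation invariant, but the sum over k inside the p-th power is not a translate of the
  original sum, and for small p or q neither a triangle inequality nor duality is at hand.
  Nestedness of dyadic cubes is the substitute for a vector-valued maximal inequality: a tail of the
  sum over levels at least k is constant on cubes of level k, so it can be moved as a whole along
  with its finest term. With s = p/q the sign of s - 1 decides whether the tails of the original or
  of the translated sum are telescoped. There is also a geometric obstacle: a ball of radius t about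
  x need not contain a cube of side t containing x, and the heights (L/2, L] fit into [t/2, t] only
  for t = L. Hence the auxiliary regions with smaller bases, and their halves. Constants are moved
  only out of integrals over x of dyadic expressions, which are Borel; the integral of the Whitney
  functional over x enters only through monotonicity.\<close>

lemma enn_powr_zero [simp]: "enn_powr 0 a = 0"
  by (simp add: enn_powr_def)

lemma enn_powr_top [simp]: "enn_powr top a = top"
  by (simp add: enn_powr_def)

lemma enn_powr_ennreal: "0 \<le> x \<Longrightarrow> enn_powr (ennreal x) a = ennreal (x powr a)"
  by (simp add: enn_powr_def)

lemma enn_powr_one [simp]: "enn_powr x 1 = x"
  by (cases x) (simp_all add: enn_powr_ennreal)

lemma enn_powr_mono: "0 \<le> a \<Longrightarrow> x \<le> y \<Longrightarrow> enn_powr x a \<le> enn_powr y a"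
  by (cases x; cases y) (auto simp: enn_powr_ennreal powr_mono2 top_unique intro!: ennreal_leI)

lemma enn_powr_enn_powr: "enn_powr (enn_powr x a) b = enn_powr x (a * b)"
  by (cases x) (simp_all add: enn_powr_ennreal powr_powr)

lemma enn_powr_inverse [simp]:
  assumes "0 < a"
  shows "enn_powr (enn_powr x a) (1 / a) = x" "enn_powr (enn_powr x (1 / a)) a = x"
  using assms by (simp_all add: enn_powr_enn_powr)

text \<open>Positivity of a makes the convention 0 * \<infinity> = 0 compatible with powers.\<close>

lemma enn_powr_mult:
  assumes "0 < a"
  shows "enn_powr (x * y) a = enn_powr x a * enn_powr y a"
proof -
  have *: "enn_powr (top * ennreal u) a = enn_powr top a * enn_powr (ennreal u) a" if "u \<ge> 0" for u
    using that assms by (cases "u = 0") (auto simp: ennreal_top_mult enn_powr_ennreal)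
  show ?thesis
    by (cases x; cases y)
       (use assms * in \<open>auto simp: enn_powr_ennreal powr_mult mult.commute
          simp flip: ennreal_mult\<close>)
qed

text \<open>For a > 0 the power is an order isomorphism of the extended half-line with inverse power
  1/a, so it preserves arbitrary suprema, including that of the empty set.\<close>

lemma enn_powr_SUP:
  assumes "0 < a"
  shows "enn_powr (SUP i\<in>I. f i) a = (SUP i\<in>I. enn_powr (f i) a)"
proof (rule antisym)
  show "(SUP i\<in>I. enn_powr (f i) a) \<le> enn_powr (SUP i\<in>I. f i) a"
    using assms by (intro SUP_least enn_powr_mono SUP_upper) auto
  have "(SUP i\<in>I. f i) \<le> enn_powr (SUP i\<in>I. enn_powr (f i) a) (1 / a)"
  proof (rule SUP_least)
    fix i assume "i \<in> I"
    then have "enn_powr (f i) a \<le> (SUP i\<in>I. enn_powr (f i) a)"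
      by (rule SUP_upper)
    then have "enn_powr (enn_powr (f i) a) (1 / a) \<le> enn_powr (SUP i\<in>I. enn_powr (f i) a) (1 / a)"
      using assms by (intro enn_powr_mono) auto
    then show "f i \<le> \<dots>"
      using assms by simp
  qed
  then have "enn_powr (SUP i\<in>I. f i) a \<le> enn_powr (enn_powr (SUP i\<in>I. enn_powr (f i) a) (1 / a)) a"
    using assms by (intro enn_powr_mono) auto
  then show "enn_powr (SUP i\<in>I. f i) a \<le> (SUP i\<in>I. enn_powr (f i) a)"
    using assms by simp
qed

lemma borel_measurable_enn_powr [measurable (raw)]:
  assumes [measurable]: "f \<in> borel_measurable M"
  shows "(\<lambda>x. enn_powr (f x) a) \<in> borel_measurable M"
  unfolding enn_powr_def by measurable

text \<open>Layer-cake formula: by Tonelli each integral equals the integral over t \<ge> 0 of the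
  measure of the superlevel set at t, and these measures are compared for every t.\<close>

lemma nn_integral_le_distribution:
  fixes f g :: "'a \<Rightarrow> ennreal"
  assumes "sigma_finite_measure M"
    and [measurable]: "f \<in> borel_measurable M" "g \<in> borel_measurable M"
    and le: "\<And>t::real. 0 \<le> t \<Longrightarrow>
      emeasure M {x\<in>space M. ennreal t < f x} \<le> C * emeasure M {x\<in>space M. ennreal t < g x}"
  shows "(\<integral>\<^sup>+x. f x \<partial>M) \<le> C * (\<integral>\<^sup>+x. g x \<partial>M)"
proof -
  interpret M: sigma_finite_measure M by fact
  interpret P: pair_sigma_finite "lborel :: real measure" M
    by (simp add: pair_sigma_finite_def sigma_finite_lborel assms(1))
  have eq: "(\<integral>\<^sup>+x. h x \<partial>M) =
      (\<integral>\<^sup>+t. indicator {0..} t * emeasure M {x\<in>space M. ennreal t < h x} \<partial>lborel)"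
    if [measurable]: "h \<in> borel_measurable M" for h :: "'a \<Rightarrow> ennreal"
  proof -
    have level: "h x = (\<integral>\<^sup>+t. indicator {0..} t * indicator {t. ennreal t < h x} t \<partial>lborel)" for x
    proof (cases "h x")
      case (real u)
      have "(\<integral>\<^sup>+t. indicator {0..} t * indicator {t. ennreal t < h x} t \<partial>lborel)
          = (\<integral>\<^sup>+t. indicator {0..<u} t \<partial>lborel)"
        using real by (intro nn_integral_cong) (auto simp: indicator_def ennreal_less_iff)
      then show ?thesis using real by simp
    next
      case top
      have "(\<integral>\<^sup>+t. indicator {0..} t * indicator {t. ennreal t < h x} t \<partial>lborel)
          = (\<integral>\<^sup>+t. indicator {0..} t \<partial>(lborel :: real measure))"
        using top by (intro nn_integral_cong) (auto simp: indicator_def)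
      also have "\<dots> = \<infinity>"
      proof -
        have "of_nat n \<le> emeasure lborel {0::real..}" for n :: nat
          using emeasure_mono[of "{0..real n}" "{0::real..}" lborel]
          by (simp add: ennreal_of_nat_eq_real_of_nat)
        then have "emeasure lborel {0::real..} = top"
          by (metis ennreal_Ex_less_of_nat less_top not_le)
        then show ?thesis by simp
      qed
      finally show ?thesis using top by simp
    qed
    have [measurable]: "Measurable.pred (lborel \<Otimes>\<^sub>M M) (\<lambda>(t, x). ennreal t < h x)"
      by measurable
    have "(\<integral>\<^sup>+x. h x \<partial>M) =
        (\<integral>\<^sup>+x. \<integral>\<^sup>+t. indicator {0..} t * indicator {t. ennreal t < h x} t \<partial>lborel \<partial>M)"
      by (rule nn_integral_cong) (rule level)
    also have "\<dots> = (\<integral>\<^sup>+t. \<integral>\<^sup>+x. indicator {0..} t * indicator {t. ennreal t < h x} t \<partial>M \<partial>lborel)"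
      by (rule P.Fubini') (simp add: indicator_def, measurable)
    also have "\<dots> = (\<integral>\<^sup>+t. indicator {0..} t * emeasure M {x\<in>space M. ennreal t < h x} \<partial>lborel)"
    proof (rule nn_integral_cong)
      fix t :: real
      have "(\<integral>\<^sup>+x. indicator {0..} t * indicator {t. ennreal t < h x} t \<partial>M) =
          (\<integral>\<^sup>+x. indicator {0..} t * indicator {x\<in>space M. ennreal t < h x} x \<partial>M)"
        by (intro nn_integral_cong) (auto simp: indicator_def)
      then show "(\<integral>\<^sup>+x. indicator {0..} t * indicator {t. ennreal t < h x} t \<partial>M) =
          indicator {0..} t * emeasure M {x\<in>space M. ennreal t < h x}"
        by (simp add: nn_integral_cmult)
    qed
    finally show ?thesis .
  qed
  have [measurable]: "(\<lambda>t. emeasure M {x\<in>space M. ennreal t < g x}) \<in> borel_measurable (lborel::real measure)"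
    by measurable
  have "(\<integral>\<^sup>+x. f x \<partial>M) \<le>
      (\<integral>\<^sup>+t. C * (indicator {0..} t * emeasure M {x\<in>space M. ennreal t < g x}) \<partial>lborel)"
    unfolding eq[OF assms(2)]
    by (intro nn_integral_mono) (auto simp: indicator_def le)
  also have "\<dots> = C * (\<integral>\<^sup>+x. g x \<partial>M)"
    unfolding eq[OF assms(3)] by (intro nn_integral_cmult) measurable
  finally show ?thesis .
qed

section \<open>Dyadic cubes and the maximal case\<close>

text \<open>The dyadic cube of side \<open>2 powi k\<close> containing x is coded by its integer
  corner, so that lying in a common cube becomes equality of indices in a countable type.\<close>

definition dy_index :: "int \<Rightarrow> real ^ 'n \<Rightarrow> int ^ 'n" where
  "dy_index k x = (\<chi> i. \<lfloor>x $ i / 2 powi k\<rfloor>)"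

text \<open>The displacement is measured in side lengths, so for fixed k this permutes the cubes of
  level k.\<close>

definition dy_shift :: "int \<Rightarrow> int ^ 'n \<Rightarrow> real ^ 'n \<Rightarrow> real ^ 'n" where
  "dy_shift k n x = x + 2 powi k *\<^sub>R (\<chi> i. real_of_int (n $ i))"

definition level_const :: "int \<Rightarrow> (real ^ 'n \<Rightarrow> 'b) \<Rightarrow> bool" where
  "level_const k f \<longleftrightarrow> (\<forall>x y. dy_index k x = dy_index k y \<longrightarrow> f x = f y)"

lemma level_constD: "level_const k f \<Longrightarrow> dy_index k x = dy_index k y \<Longrightarrow> f x = f y"
  unfolding level_const_def by blast

lemma dy_index_shift [simp]: "dy_index k (dy_shift k n x) = dy_index k x + n"
  by (simp add: dy_index_def dy_shift_def vec_eq_iff add_divide_distrib)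

lemma dy_shift_shift: "dy_shift k n (dy_shift k m x) = dy_shift k (n + m) x"
  by (simp add: dy_shift_def vec_eq_iff algebra_simps)

lemma dy_shift_zero [simp]: "dy_shift k 0 x = x"
  by (simp add: dy_shift_def vec_eq_iff)

text \<open>Nestedness of dyadic cubes: the index at level j is the index at level k divided, with
  rounding down, by \<open>2 ^ nat (j - k)\<close>.\<close>

lemma dy_index_coarser:
  assumes "k \<le> j" "dy_index k x = dy_index k y"
  shows "dy_index j x = dy_index j y"
proof -
  have *: "\<lfloor>a / 2 powi j\<rfloor> = \<lfloor>a / 2 powi k\<rfloor> div 2 ^ nat (j - k)" for a :: real
  proof -
    have "a / 2 powi j = (a / 2 powi k) / real_of_int (2 ^ nat (j - k))"
      using assms(1) power_int_add[of "2::real" k "j - k"]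
      by (simp add: power_int_def[of _ "j - k"])
    then show ?thesis
      by (metis floor_divide_real_eq_div zero_le_power zero_le_numeral)
  qed
  show ?thesis
    using assms(2) by (simp add: dy_index_def vec_eq_iff *)
qed

lemma dy_index_close:
  assumes "\<And>i. \<bar>x $ i - y $ i\<bar> \<le> real_of_int m * 2 powi k"
  shows "\<bar>(dy_index k x - dy_index k y) $ i\<bar> \<le> m"
proof -
  define a b where "a = x $ i / 2 powi k" and "b = y $ i / 2 powi k"
  have "\<bar>a - b\<bar> = \<bar>x $ i - y $ i\<bar> / 2 powi k"
    by (simp add: a_def b_def flip: diff_divide_distrib)
  then have "\<bar>a - b\<bar> \<le> real_of_int m"
    using assms[of i] by (simp add: divide_le_eq)
  then have "\<lfloor>a\<rfloor> \<le> \<lfloor>b + real_of_int m\<rfloor>" "\<lfloor>b\<rfloor> \<le> \<lfloor>a + real_of_int m\<rfloor>"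
    by (intro floor_mono; linarith)+
  then show ?thesis
    by (simp add: dy_index_def abs_le_iff flip: a_def b_def)
qed

lemma level_const_mono: "k \<le> j \<Longrightarrow> level_const j f \<Longrightarrow> level_const k f"
  unfolding level_const_def using dy_index_coarser by blast

lemma level_const_shift: "level_const k f \<Longrightarrow> level_const k (\<lambda>x. f (dy_shift k n x))"
  unfolding level_const_def by simp

lemma level_const_comp: "level_const k f \<Longrightarrow> level_const k (\<lambda>x. g (f x))"
  unfolding level_const_def by (intro allI impI arg_cong[of _ _ g]) blast

lemma level_const_sum:
  "(\<And>i. i \<in> I \<Longrightarrow> level_const k (f i)) \<Longrightarrow> level_const k (\<lambda>x. \<Sum>i\<in>I. f i x)"
  unfolding level_const_def by (intro allI impI sum.cong refl) blast

section \<open>Measurability and translation invariance on a fixed level\<close>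

lemma measurable_dy_index [measurable]: "dy_index k \<in> borel \<rightarrow>\<^sub>M count_space UNIV"
proof (subst measurable_count_space_eq_countable)
  show "countable (UNIV :: (int ^ 'n) set)" by simp
  have "{x :: real ^ 'n. dy_index k x = a} \<in> sets borel" for a
  proof -
    have "{x :: real ^ 'n. dy_index k x = a} = {x\<in>space borel. \<forall>i. \<lfloor>x $ i / 2 powi k\<rfloor> = a $ i}"
      by (auto simp: dy_index_def vec_eq_iff)
    also have "\<dots> \<in> sets borel" by measurable
    finally show ?thesis .
  qed
  then show "(dy_index k :: real ^ 'n \<Rightarrow> int ^ 'n) \<in> space borel \<rightarrow> UNIV \<and>
      (\<forall>a\<in>UNIV. dy_index k -` {a} \<inter> space borel \<in> sets (borel :: (real ^ 'n) measure))"
    by (auto simp: vimage_def)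
qed

text \<open>Such a function factors through \<open>dy_index k\<close>, whose target is countable and
  discrete. This makes all dyadic expressions Borel regardless of how their values arise, for
  instance from local quasi-norms.\<close>

lemma level_const_measurable:
  fixes f :: "real ^ 'n \<Rightarrow> 'b"
  assumes "level_const k f" "space N = UNIV"
  shows "f \<in> measurable borel N"
proof -
  have "f = (\<lambda>z. f (SOME x. dy_index k x = z)) \<circ> dy_index k"
  proof
    fix x :: "real ^ 'n"
    have "dy_index k (SOME y. dy_index k y = dy_index k x) = dy_index k x"
      by (rule someI[of "\<lambda>y. dy_index k y = dy_index k x" x]) simp
    then show "f x = ((\<lambda>z. f (SOME x. dy_index k x = z)) \<circ> dy_index k) x"
      using level_constD[OF assms(1)] by (metis comp_apply)
  qed
  also have "\<dots> \<in> measurable borel N"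
    by (rule measurable_comp[OF measurable_dy_index]) (simp add: assms(2))
  finally show ?thesis .
qed

lemma dy_shift_measurable [measurable]: "dy_shift k n \<in> borel \<rightarrow>\<^sub>M borel"
  unfolding dy_shift_def by measurable

lemma nn_integral_dy_shift:
  assumes [measurable]: "f \<in> borel_measurable borel"
  shows "(\<integral>\<^sup>+x. f (dy_shift k n x) \<partial>lborel) = (\<integral>\<^sup>+x. f x \<partial>lborel)"
proof -
  define c where "c = (2::real) powi k *\<^sub>R (\<chi> i. real_of_int (n $ i))"
  have "(\<integral>\<^sup>+x. f x \<partial>lborel) = (\<integral>\<^sup>+x. f x \<partial>(distr lborel borel ((+) c)))"
    by (simp add: lborel_distr_plus)
  also have "\<dots> = (\<integral>\<^sup>+x. f (c + x) \<partial>lborel)"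
    by (subst nn_integral_distr) auto
  finally show ?thesis
    by (simp add: dy_shift_def c_def add.commute)
qed

lemma emeasure_dy_shift:
  assumes [measurable]: "Measurable.pred borel P"
  shows "emeasure lborel {x. P (dy_shift k n x)} = emeasure lborel {x. P x}"
proof -
  have *: "{x. P x} \<in> sets lborel" "{x. P (dy_shift k n x)} \<in> sets lborel"
    using assms measurable_compose[OF dy_shift_measurable assms] by (auto simp: pred_def)
  show ?thesis
    using nn_integral_dy_shift[of "indicator {x. P x}" k n] *
    by (simp add: indicator_def[abs_def] flip: nn_integral_indicator)
qed

lemma finite_int_vec_box: "finite {m :: int ^ 'n. \<forall>i. \<bar>m $ i\<bar> \<le> N}"
proof (rule finite_subset)
  show "{m :: int ^ 'n. \<forall>i. \<bar>m $ i\<bar> \<le> N} \<subseteq> vec_lambda ` (PiE UNIV (\<lambda>_. {-N..N}))"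
  proof
    fix m :: "int ^ 'n" assume "m \<in> {m. \<forall>i. \<bar>m $ i\<bar> \<le> N}"
    then have "vec_nth m \<in> PiE UNIV (\<lambda>_. {-N..N})"
      by (force simp: abs_le_iff)
    then show "m \<in> vec_lambda ` (PiE UNIV (\<lambda>_. {-N..N}))"
      by (rule rev_image_eqI) (simp add: vec_lambda_eta)
  qed
  show "finite (vec_lambda ` (PiE (UNIV :: 'n set) (\<lambda>_. {-N..N})))"
    by (intro finite_imageI finite_PiE) auto
qed

text \<open>Only the coarsest cubes of each union matter: they are disjoint, and the translate of a cube
  by \<open>n\<close> side lengths lies in boundedly many translates of any coarser cube containing it.\<close>

lemma emeasure_Union_shift_le:
  fixes P :: "int \<Rightarrow> real ^ 'n \<Rightarrow> bool"
  assumes "finite I" and P: "\<And>k. level_const k (P k)" and n: "\<And>i. \<bar>n $ i\<bar> \<le> N"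
  shows "emeasure lborel {x. \<exists>k\<in>I. P k (dy_shift k n x)} \<le>
    of_nat (card {m :: int ^ 'n. \<forall>i. \<bar>m $ i\<bar> \<le> N}) * emeasure lborel {x. \<exists>k\<in>I. P k x}"
proof -
  define S where "S = {m :: int ^ 'n. \<forall>i. \<bar>m $ i\<bar> \<le> N}"
  \<comment> \<open>\<open>V k\<close> selects k as the coarsest level in I at which P holds at x.
    The \<open>P j\<close> with j > k are constant on cubes of level k, hence so is
    \<open>V k\<close>.\<close>
  define V where "V k x \<longleftrightarrow> P k x \<and> (\<forall>j\<in>I. k < j \<longrightarrow> \<not> P j x)" for k x
  have V: "level_const k (V k)" for k
    using P level_const_mono[OF _ P] unfolding V_def level_const_def by (metis less_imp_le)
  have [measurable]: "Measurable.pred borel (V k)" for k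
    by (rule level_const_measurable[OF V]) simp
  have [measurable]: "Measurable.pred borel (\<lambda>x. V k (dy_shift k n x))" for k n
    by measurable
  have fin: "finite S"
    unfolding S_def by (rule finite_int_vec_box)
  have cov: "{x. \<exists>k\<in>I. P k (dy_shift k n x)} \<subseteq> (\<Union>m\<in>S. \<Union>k\<in>I. {x. V k (dy_shift k m x)})"
  proof clarify
    fix x k assume k: "k \<in> I" "P k (dy_shift k n x)"
    define y where "y = dy_shift k n x"
    \<comment> \<open>Passing from k to the coarsest admissible level at y costs nothing: x and y
      differ by at most N side lengths of level k, hence of level K, so their indices at level K
      differ by at most N.\<close>
    define K where "K = Max {j\<in>I. P j y}"
    have ne: "k \<in> {j\<in>I. P j y}" "finite {j\<in>I. P j y}"
      using k \<open>finite I\<close> by (auto simp: y_def)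
    have K: "K \<in> I" "P K y" "k \<le> K"
      using Max_in[OF ne(2)] Max_ge[OF ne(2,1)] ne(1) by (auto simp: K_def)
    have "V K y"
      using K Max_ge[OF ne(2)] by (auto simp: V_def K_def[symmetric])
         (meson leD)
    define m where "m = dy_index K y - dy_index K x"
    have "dy_index K (dy_shift K m x) = dy_index K y"
      by (simp add: m_def)
    then have "V K (dy_shift K m x)"
      using V \<open>V K y\<close> level_constD by metis
    moreover have "m \<in> S"
    proof -
      have "\<bar>y $ i - x $ i\<bar> \<le> real_of_int N * 2 powi K" for i
      proof -
        have "\<bar>y $ i - x $ i\<bar> = \<bar>real_of_int (n $ i)\<bar> * 2 powi k"
          by (simp add: y_def dy_shift_def abs_mult)
        also have "\<dots> \<le> real_of_int N * 2 powi K"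
          using n[of i] K(3) by (intro mult_mono power_int_increasing) (linarith | simp)+
        finally show ?thesis .
      qed
      then show ?thesis
        unfolding S_def m_def using dy_index_close by blast
    qed
    ultimately show "x \<in> (\<Union>m\<in>S. \<Union>k\<in>I. {x. V k (dy_shift k m x)})"
      using K(1) by blast
  qed
  have meas: "{x. V k (dy_shift k m x)} \<in> sets lborel" "{x. V k x} \<in> sets lborel" for k m
    using \<open>Measurable.pred borel (V k)\<close> \<open>Measurable.pred borel (\<lambda>x. V k (dy_shift k m x))\<close>
    by (auto simp: pred_def)
  have disj: "disjoint_family_on (\<lambda>k. {x. V k x}) I"
    unfolding disjoint_family_on_def V_def by (auto elim: linorder_neqE)
  have eq: "(\<Union>k\<in>I. {x. V k x}) = {x. \<exists>k\<in>I. P k x}"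
  proof (intro subset_antisym subsetI)
    fix x assume "x \<in> {x. \<exists>k\<in>I. P k x}"
    then obtain k where k: "k \<in> {j\<in>I. P j x}" by auto
    have f: "finite {j\<in>I. P j x}" using \<open>finite I\<close> by auto
    have "Max {j\<in>I. P j x} \<in> {j\<in>I. P j x}" using Max_in[OF f] k by blast
    moreover have "V (Max {j\<in>I. P j x}) x"
      using calculation Max_ge[OF f] by (auto simp: V_def dest: leD)
    ultimately show "x \<in> (\<Union>k\<in>I. {x. V k x})" by blast
  qed (auto simp: V_def)
  have "emeasure lborel {x. \<exists>k\<in>I. P k (dy_shift k n x)} \<le>
      emeasure lborel (\<Union>m\<in>S. \<Union>k\<in>I. {x. V k (dy_shift k m x)})"
    using cov meas \<open>finite I\<close> fin by (intro emeasure_mono sets.finite_UN) auto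
  also have "\<dots> \<le> (\<Sum>m\<in>S. emeasure lborel (\<Union>k\<in>I. {x. V k (dy_shift k m x)}))"
    using meas \<open>finite I\<close> fin by (intro emeasure_subadditive_finite) auto
  also have "\<dots> \<le> (\<Sum>m\<in>S. \<Sum>k\<in>I. emeasure lborel {x. V k (dy_shift k m x)})"
    using meas \<open>finite I\<close> by (intro sum_mono emeasure_subadditive_finite) auto
  also have "\<dots> = (\<Sum>m\<in>S. \<Sum>k\<in>I. emeasure lborel {x. V k x})"
    by (intro sum.cong refl emeasure_dy_shift) measurable
  also have "\<dots> = of_nat (card S) * (\<Sum>k\<in>I. emeasure lborel {x. V k x})"
    by simp
  also have "(\<Sum>k\<in>I. emeasure lborel {x. V k x}) = emeasure lborel (\<Union>k\<in>I. {x. V k x})"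
    using meas disj \<open>finite I\<close> by (intro sum_emeasure) auto
  finally show ?thesis
    by (simp add: eq S_def)
qed

text \<open>The superlevel set of a supremum is the union of the superlevel sets, and those of
  \<open>h k\<close> are unions of cubes of level k; so \<open>emeasure_Union_shift_le\<close> is a
  comparison of distribution functions.\<close>

lemma nn_integral_SUP_shift_le:
  fixes h :: "int \<Rightarrow> real ^ 'n \<Rightarrow> ennreal"
  assumes "finite I" and h: "\<And>k. level_const k (h k)" and n: "\<And>i. \<bar>n $ i\<bar> \<le> N"
  shows "(\<integral>\<^sup>+x. (SUP k\<in>I. h k (dy_shift k n x)) \<partial>lborel) \<le>
    of_nat (card {m :: int ^ 'n. \<forall>i. \<bar>m $ i\<bar> \<le> N}) * (\<integral>\<^sup>+x. (SUP k\<in>I. h k x) \<partial>lborel)"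
proof (rule nn_integral_le_distribution)
  have [measurable]: "h k \<in> borel_measurable borel" for k
    by (rule level_const_measurable[OF h]) simp
  have I: "countable I" using \<open>finite I\<close> by (rule countable_finite)
  show "(\<lambda>x. SUP k\<in>I. h k (dy_shift k n x)) \<in> borel_measurable lborel"
    using I by measurable
  show "(\<lambda>x. SUP k\<in>I. h k x) \<in> borel_measurable lborel"
    using I by measurable
next
  fix t :: real
  show "emeasure lborel {x \<in> space lborel. ennreal t < (SUP k\<in>I. h k (dy_shift k n x))} \<le>
      of_nat (card {m :: int ^ 'n. \<forall>i. \<bar>m $ i\<bar> \<le> N}) *
      emeasure lborel {x \<in> space lborel. ennreal t < (SUP k\<in>I. h k x)}"
    using emeasure_Union_shift_le[OF assms(1) _ n, of "\<lambda>k x. ennreal t < h k x"]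
    by (simp add: less_SUP_iff level_const_comp[OF h])
qed (rule sigma_finite_lborel)

section \<open>Sums over translated cubes\<close>

text \<open>Mean value theorem for the s-th power: its derivative increases for s \<ge> 1 and
  decreases for s \<le> 1, so the value at the right endpoint u bounds it from the appropriate
  side.\<close>

lemma powr_diff_bounds:
  fixes u v s :: real
  assumes "0 \<le> v" "v \<le> u" "0 < s"
  shows "1 \<le> s \<Longrightarrow> u powr s - v powr s \<le> s * u powr (s - 1) * (u - v)"
    and "s \<le> 1 \<Longrightarrow> s * u powr (s - 1) * (u - v) \<le> u powr s - v powr s"
proof -
  have "(1 \<le> s \<longrightarrow> u powr s - v powr s \<le> s * u powr (s - 1) * (u - v)) \<and>
        (s \<le> 1 \<longrightarrow> s * u powr (s - 1) * (u - v) \<le> u powr s - v powr s)"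
  \<comment> \<open>The derivative may be singular at 0; for v = 0 the difference is simply u^s =
    u^(s-1) u.\<close>
  proof (cases "v = 0 \<or> u = v")
    case True
    have "u powr s = u powr (s - 1) * u"
      using assms powr_mult_base[of u "s - 1"] by (simp add: mult.commute)
    moreover have "0 \<le> u powr (s - 1) * u" using assms by simp
    ultimately show ?thesis
      using True assms mult_right_mono[of 1 s "u powr (s - 1) * u"]
        mult_right_mono[of s 1 "u powr (s - 1) * u"]
      by (auto simp: mult.assoc)
  next
    case False
    then have "0 < v" "v < u" using assms by auto
    have "\<exists>z. v < z \<and> z < u \<and> u powr s - v powr s = (u - v) * (s * z powr (s - 1))"
      using \<open>0 < v\<close> \<open>v < u\<close>
      by (intro MVT2) (auto intro!: derivative_eq_intros simp: field_simps powr_diff)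
    then obtain z where z: "v < z" "z < u" "u powr s - v powr s = s * z powr (s - 1) * (u - v)"
      by (auto simp: mult_ac)
    have "z powr (s - 1) \<le> u powr (s - 1)" if "1 \<le> s"
      using that z \<open>0 < v\<close> by (intro powr_mono2) auto
    moreover have "u powr (s - 1) \<le> z powr (s - 1)" if "s \<le> 1"
      using that z \<open>0 < v\<close> by (intro powr_mono2') auto
    ultimately show ?thesis
      unfolding z(3) using assms by (auto intro!: mult_right_mono mult_left_mono)
  qed
  then show "1 \<le> s \<Longrightarrow> u powr s - v powr s \<le> s * u powr (s - 1) * (u - v)"
    and "s \<le> 1 \<Longrightarrow> s * u powr (s - 1) * (u - v) \<le> u powr s - v powr s"
    by auto
qed

text \<open>Discrete form of F^s being the integral of s F^(s-1) dF. The weight of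
  \<open>a k\<close> is a power of the partial sum that already includes \<open>a k\<close>, that
  is, of the right endpoint in \<open>powr_diff_bounds\<close>.\<close>

lemma sum_powr_bounds:
  fixes a :: "int \<Rightarrow> real"
  assumes "finite I" "\<And>k. 0 \<le> a k" "0 < s"
  shows "1 \<le> s \<Longrightarrow>
      (\<Sum>k\<in>I. a k) powr s \<le> s * (\<Sum>k\<in>I. a k * (\<Sum>j\<in>{j\<in>I. k \<le> j}. a j) powr (s - 1))"
    and "s \<le> 1 \<Longrightarrow>
      s * (\<Sum>k\<in>I. a k * (\<Sum>j\<in>{j\<in>I. k \<le> j}. a j) powr (s - 1)) \<le> (\<Sum>k\<in>I. a k) powr s"
proof -
  let ?T = "\<lambda>I. \<Sum>k\<in>I. a k * (\<Sum>j\<in>{j\<in>I. k \<le> j}. a j) powr (s - 1)"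
  have "(1 \<le> s \<longrightarrow> (\<Sum>k\<in>I. a k) powr s \<le> s * ?T I) \<and>
        (s \<le> 1 \<longrightarrow> s * ?T I \<le> (\<Sum>k\<in>I. a k) powr s)"
    using assms(1)
  \<comment> \<open>Each step inserts a level b finer than all others, so the tails at the earlier
    levels do not change and the tail at b is the whole sum.\<close>
  proof (induction I rule: finite_linorder_min_induct)
    case empty
    then show ?case by simp
  next
    case (insert b A)
    have "b \<notin> A" using insert by auto
    have "{j \<in> insert b A. k \<le> j} = {j \<in> A. k \<le> j}" if "k \<in> A" for k
      using that insert by force
    moreover have "{j \<in> insert b A. b \<le> j} = insert b A"
      using insert by force
    ultimately have T: "?T (insert b A) = a b * (\<Sum>k\<in>insert b A. a k) powr (s - 1) + ?T A"
      using insert \<open>b \<notin> A\<close> by (simp cong: sum.cong)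
    have "0 \<le> (\<Sum>k\<in>A. a k)" "(\<Sum>k\<in>A. a k) \<le> (\<Sum>k\<in>insert b A. a k)"
      using insert \<open>b \<notin> A\<close> assms by (auto intro: sum_nonneg)
    note powr_diff_bounds[OF this \<open>0 < s\<close>]
    moreover have "(\<Sum>k\<in>insert b A. a k) - (\<Sum>k\<in>A. a k) = a b"
      using insert \<open>b \<notin> A\<close> by simp
    ultimately show ?case
      using insert.IH unfolding T by (auto simp: distrib_left mult_ac)
  qed
  then show "1 \<le> s \<Longrightarrow> (\<Sum>k\<in>I. a k) powr s \<le> s * ?T I"
    and "s \<le> 1 \<Longrightarrow> s * ?T I \<le> (\<Sum>k\<in>I. a k) powr s" by auto
qed

lemma card_int_vec_box_pos: "0 \<le> N \<Longrightarrow> 1 \<le> card {m :: int ^ 'n. \<forall>i. \<bar>m $ i\<bar> \<le> N}"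
proof -
  assume "0 \<le> N"
  then have "0 \<in> {m :: int ^ 'n. \<forall>i. \<bar>m $ i\<bar> \<le> N}" by simp
  then have "{m :: int ^ 'n. \<forall>i. \<bar>m $ i\<bar> \<le> N} \<noteq> {}" by blast
  then show ?thesis
    using finite_int_vec_box[where 'n='n] by (simp add: Suc_le_eq card_gt_0_iff)
qed

text \<open>For \<open>s \<le> 1\<close> one weights the translated sum by the maximal function \<open>H\<close> of the partial
  sums over coarser cubes: telescoping \<open>F\<^sup>s\<close> bounds the integral of \<open>F' H\<^sup>s\<^sup>-\<^sup>1\<close>.\<close>

lemma nn_integral_sum_shift_le_small:
  fixes b :: "int \<Rightarrow> real ^ 'n \<Rightarrow> real"
  assumes "finite I" and b: "\<And>k. level_const k (b k)" and b0: "\<And>k x. 0 \<le> b k x"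
    and s: "0 < s" "s \<le> 1" and n: "\<And>i. \<bar>n $ i\<bar> \<le> N"
  shows "(\<integral>\<^sup>+x. ennreal ((\<Sum>k\<in>I. b k (dy_shift k n x)) powr s) \<partial>lborel) \<le>
    ennreal (real (card {m :: int ^ 'n. \<forall>i. \<bar>m $ i\<bar> \<le> N}) + 1 / s) *
    (\<integral>\<^sup>+x. ennreal ((\<Sum>k\<in>I. b k x) powr s) \<partial>lborel)"
proof (cases "I = {}")
  case True
  then show ?thesis using s by simp
next
  case False
  define c where "c = real (card {m :: int ^ 'n. \<forall>i. \<bar>m $ i\<bar> \<le> N})"
  \<comment> \<open>The tail \<open>G k\<close> is constant on cubes of level k, so the maximal case
    applies to the whole tail translated by the displacement of level k.\<close>
  define G where "G k x = (\<Sum>j\<in>{j\<in>I. k \<le> j}. b j x)" for k x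
  define h where "h k x = G k (dy_shift k n x)" for k x
  define H where "H x = Max ((\<lambda>k. h k x) ` I)" for x
  define F where "F x = (\<Sum>k\<in>I. b k x)" for x
  define F' where "F' x = (\<Sum>k\<in>I. b k (dy_shift k n x))" for x
  have [measurable]: "b k \<in> borel_measurable borel" for k
    by (rule level_const_measurable[OF b]) simp
  have G: "level_const k (G k)" for k
    unfolding G_def[abs_def] using level_const_mono[OF _ b] by (intro level_const_sum) auto
  have [measurable]: "G k \<in> borel_measurable borel" "h k \<in> borel_measurable borel" for k
    unfolding h_def[abs_def] G_def[abs_def] by measurable
  have [measurable]: "H \<in> borel_measurable borel" "F \<in> borel_measurable borel"
    "F' \<in> borel_measurable borel"
    unfolding H_def[abs_def] F_def[abs_def] F'_def[abs_def]
    using \<open>finite I\<close> by (measurable; simp)+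
  have G0: "0 \<le> G k x" for k x
    unfolding G_def using b0 by (intro sum_nonneg) auto
  have h_le: "h k x \<le> H x" if "k \<in> I" for k x
    unfolding H_def using that \<open>finite I\<close> by (intro Max_ge) auto
  have H_ex: "\<exists>k\<in>I. H x = h k x" for x
  proof -
    have "H x \<in> (\<lambda>k. h k x) ` I"
      unfolding H_def using False \<open>finite I\<close> by (intro Max_in) auto
    then show ?thesis by blast
  qed
  have b_le: "b k (dy_shift k n x) \<le> h k x" if "k \<in> I" for k x
    unfolding h_def G_def using that \<open>finite I\<close> b0 by (intro member_le_sum) auto
  have h0: "0 \<le> h k x" for k x unfolding h_def by (rule G0)
  have H0: "0 \<le> H x" for x using H_ex[of x] h0 by metis
  have F'0: "0 \<le> F' x" for x unfolding F'_def using b0 by (intro sum_nonneg) auto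
  have Gs: "ennreal (G k x powr s) \<le> ennreal (F x powr s)" if "k \<in> I" for k x
    unfolding F_def G_def using s b0 \<open>finite I\<close>
    by (intro ennreal_leI powr_mono2 sum_mono2 sum_nonneg) auto
  have "(\<integral>\<^sup>+x. ennreal (H x powr s) \<partial>lborel) \<le>
      (\<integral>\<^sup>+x. (SUP k\<in>I. ennreal (G k (dy_shift k n x) powr s)) \<partial>lborel)"
  proof (rule nn_integral_mono)
    fix x obtain k where "k \<in> I" "H x = h k x" using H_ex by blast
    then show "ennreal (H x powr s) \<le> (SUP k\<in>I. ennreal (G k (dy_shift k n x) powr s))"
      unfolding h_def by (intro SUP_upper2[of k]) auto
  qed
  also have "\<dots> \<le> of_nat (card {m :: int ^ 'n. \<forall>i. \<bar>m $ i\<bar> \<le> N}) *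
      (\<integral>\<^sup>+x. (SUP k\<in>I. ennreal (G k x powr s)) \<partial>lborel)"
    using \<open>finite I\<close> by (intro nn_integral_SUP_shift_le n level_const_comp[OF G]) auto
  also have "\<dots> \<le> of_nat (card {m :: int ^ 'n. \<forall>i. \<bar>m $ i\<bar> \<le> N}) *
      (\<integral>\<^sup>+x. ennreal (F x powr s) \<partial>lborel)"
    by (intro mult_left_mono nn_integral_mono SUP_least Gs) auto
  finally have H_int: "(\<integral>\<^sup>+x. ennreal (H x powr s) \<partial>lborel) \<le>
      ennreal c * (\<integral>\<^sup>+x. ennreal (F x powr s) \<partial>lborel)"
    by (simp add: c_def ennreal_of_nat_eq_real_of_nat)
  \<comment> \<open>As s - 1 \<le> 0, the k-th summand grows when H is replaced by the smaller
    \<open>h k\<close>. It then depends only on the point translated at level k, so the translations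
    are removed term by term and \<open>sum_powr_bounds\<close> handles what remains.\<close>
  have "ennreal s * (\<integral>\<^sup>+x. ennreal (F' x * H x powr (s - 1)) \<partial>lborel) \<le>
      ennreal s * (\<integral>\<^sup>+x. (\<Sum>k\<in>I. ennreal (b k (dy_shift k n x) * h k x powr (s - 1))) \<partial>lborel)"
  proof (intro mult_left_mono nn_integral_mono)
    fix x
    have "F' x * H x powr (s - 1) = (\<Sum>k\<in>I. b k (dy_shift k n x) * H x powr (s - 1))"
      by (simp add: F'_def sum_distrib_right)
    also have "\<dots> \<le> (\<Sum>k\<in>I. b k (dy_shift k n x) * h k x powr (s - 1))"
    proof (rule sum_mono)
      fix k assume k: "k \<in> I"
      show "b k (dy_shift k n x) * H x powr (s - 1) \<le> b k (dy_shift k n x) * h k x powr (s - 1)"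
      \<comment> \<open>Non-positive powers of 0 are 0 by convention, so antitonicity of the power
        fails there; but then the factor in front vanishes as well.\<close>
      proof (cases "h k x = 0")
        case True
        then have "b k (dy_shift k n x) = 0" using b_le[OF k, of x] b0 by (simp add: antisym)
        then show ?thesis by simp
      next
        case False
        then show ?thesis
          using h0[of k x] s h_le[OF k, of x] b0 by (intro mult_left_mono powr_mono2') auto
      qed
    qed
    finally show "ennreal (F' x * H x powr (s - 1)) \<le>
        (\<Sum>k\<in>I. ennreal (b k (dy_shift k n x) * h k x powr (s - 1)))"
      using b0 by (subst sum_ennreal) (auto intro: ennreal_leI)
  qed simp
  also have "(\<integral>\<^sup>+x. (\<Sum>k\<in>I. ennreal (b k (dy_shift k n x) * h k x powr (s - 1))) \<partial>lborel) =
      (\<Sum>k\<in>I. \<integral>\<^sup>+x. ennreal (b k (dy_shift k n x) * h k x powr (s - 1)) \<partial>lborel)"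
    by (rule nn_integral_sum) measurable
  also have "\<dots> = (\<Sum>k\<in>I. \<integral>\<^sup>+x. ennreal (b k x * G k x powr (s - 1)) \<partial>lborel)"
    unfolding h_def by (intro sum.cong refl nn_integral_dy_shift) measurable
  also have "\<dots> = (\<integral>\<^sup>+x. (\<Sum>k\<in>I. ennreal (b k x * G k x powr (s - 1))) \<partial>lborel)"
    by (rule nn_integral_sum[symmetric]) measurable
  also have "ennreal s * \<dots> = (\<integral>\<^sup>+x. ennreal s * (\<Sum>k\<in>I. ennreal (b k x * G k x powr (s - 1))) \<partial>lborel)"
    by (rule nn_integral_cmult[symmetric]) measurable
  also have "\<dots> \<le> (\<integral>\<^sup>+x. ennreal (F x powr s) \<partial>lborel)"
  proof (rule nn_integral_mono)
    fix x
    have "ennreal s * (\<Sum>k\<in>I. ennreal (b k x * G k x powr (s - 1))) =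
        ennreal (s * (\<Sum>k\<in>I. b k x * G k x powr (s - 1)))"
    proof -
      have "(\<Sum>k\<in>I. ennreal (b k x * G k x powr (s - 1))) =
          ennreal (\<Sum>k\<in>I. b k x * G k x powr (s - 1))"
        using b0 by (intro sum_ennreal) simp
      then show ?thesis using s by (simp add: ennreal_mult')
    qed
    then show "ennreal s * (\<Sum>k\<in>I. ennreal (b k x * G k x powr (s - 1))) \<le> ennreal (F x powr s)"
      using sum_powr_bounds(2)[of I "\<lambda>k. b k x" s] \<open>finite I\<close> b0 s
      by (auto simp: F_def G_def intro: ennreal_leI)
  qed
  finally have "ennreal (1 / s) * (ennreal s * (\<integral>\<^sup>+x. ennreal (F' x * H x powr (s - 1)) \<partial>lborel)) \<le>
      ennreal (1 / s) * (\<integral>\<^sup>+x. ennreal (F x powr s) \<partial>lborel)"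
    by (intro mult_left_mono) auto
  then have FH_int: "(\<integral>\<^sup>+x. ennreal (F' x * H x powr (s - 1)) \<partial>lborel) \<le>
      ennreal (1 / s) * (\<integral>\<^sup>+x. ennreal (F x powr s) \<partial>lborel)"
    using s by (simp add: mult.assoc[symmetric] ennreal_mult[symmetric])
  \<comment> \<open>Where F' is at most H the first term suffices. Elsewhere F'^(s-1) \<le> H^(s-1)
    because s \<le> 1, which gives the second. The two terms contribute c and 1/s to the
    constant.\<close>
  have pt: "F' x powr s \<le> H x powr s + F' x * H x powr (s - 1)" for x
  proof (cases "F' x \<le> H x")
    case True
    then have "F' x powr s \<le> H x powr s"
      using s F'0 by (intro powr_mono2) auto
    moreover have "0 \<le> F' x * H x powr (s - 1)"
      using F'0[of x] by simp
    ultimately show ?thesis by linarith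
  next
    case False
    have "H x \<noteq> 0"
    proof
      assume "H x = 0"
      then have "b k (dy_shift k n x) = 0" if "k \<in> I" for k
        using b_le[OF that, of x] h_le[OF that, of x] b0[of k "dy_shift k n x"] by linarith
      then have "F' x = 0" by (simp add: F'_def)
      with False \<open>H x = 0\<close> show False by simp
    qed
    then have "0 < H x" using H0[of x] by simp
    have "F' x powr s = F' x * F' x powr (s - 1)"
      using powr_mult_base[of "F' x" "s - 1"] F'0 by simp
    also have "\<dots> \<le> F' x * H x powr (s - 1)"
      using False \<open>0 < H x\<close> s by (intro mult_left_mono powr_mono2') auto
    finally show ?thesis by (simp add: add_increasing)
  qed
  have "(\<integral>\<^sup>+x. ennreal (F' x powr s) \<partial>lborel) \<le>
      (\<integral>\<^sup>+x. ennreal (H x powr s) + ennreal (F' x * H x powr (s - 1)) \<partial>lborel)"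
    using pt F'0 by (intro nn_integral_mono) (auto simp flip: ennreal_plus intro!: ennreal_leI)
  also have "\<dots> = (\<integral>\<^sup>+x. ennreal (H x powr s) \<partial>lborel) + (\<integral>\<^sup>+x. ennreal (F' x * H x powr (s - 1)) \<partial>lborel)"
    by (rule nn_integral_add) measurable
  also have "\<dots> \<le> ennreal c * (\<integral>\<^sup>+x. ennreal (F x powr s) \<partial>lborel) +
      ennreal (1 / s) * (\<integral>\<^sup>+x. ennreal (F x powr s) \<partial>lborel)"
    by (intro add_mono H_int FH_int)
  also have "\<dots> = ennreal (c + 1 / s) * (\<integral>\<^sup>+x. ennreal (F x powr s) \<partial>lborel)"
    using s by (simp add: c_def ennreal_plus distrib_right)
  finally show ?thesis
    by (simp add: F'_def F_def c_def)
qed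

text \<open>For \<open>s \<ge> 1\<close> telescoping the translated sum instead bounds the integral of \<open>F'\<^sup>s\<close> by that
  of \<open>F H\<^sup>s\<^sup>-\<^sup>1\<close>, where the integral of \<open>H\<^sup>s\<close> is controlled by that of \<open>F'\<^sup>s\<close>, which can then be absorbed
  since it is finite.\<close>

lemma nn_integral_sum_shift_le_large:
  fixes b :: "int \<Rightarrow> real ^ 'n \<Rightarrow> real"
  assumes "finite I" and b: "\<And>k. level_const k (b k)" and b0: "\<And>k x. 0 \<le> b k x"
    and s: "1 \<le> s" and n: "\<And>i. \<bar>n $ i\<bar> \<le> N"
  defines "c \<equiv> real (card {m :: int ^ 'n. \<forall>i. \<bar>m $ i\<bar> \<le> N})"
  shows "(\<integral>\<^sup>+x. ennreal ((\<Sum>k\<in>I. b k (dy_shift k n x)) powr s) \<partial>lborel) \<le>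
    ennreal (2 * s * (2 * s * c) powr (s - 1)) *
    (\<integral>\<^sup>+x. ennreal ((\<Sum>k\<in>I. b k x) powr s) \<partial>lborel)"
proof (cases "I = {} \<or> (\<integral>\<^sup>+x. ennreal ((\<Sum>k\<in>I. b k x) powr s) \<partial>lborel) = top")
  case True
  \<comment> \<open>An infinite right-hand side settles the claim only if the constant is nonzero,
    as 0 * \<infinity> = 0.\<close>
  have "c \<ge> 1"
    using n[of undefined] card_int_vec_box_pos[of N, where 'n='n] by (simp add: c_def)
  then have "0 < 2 * s * (2 * s * c) powr (s - 1)" using s by simp
  with True show ?thesis using s by (auto simp: ennreal_mult_top)
next
  case False
  then have "I \<noteq> {}" and fin: "(\<integral>\<^sup>+x. ennreal ((\<Sum>k\<in>I. b k x) powr s) \<partial>lborel) < top"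
    by (auto simp: less_top)
  have c: "c \<ge> 1"
    using n[of undefined] card_int_vec_box_pos[of N, where 'n='n] by (simp add: c_def)
  \<comment> \<open>The tails now come from the translated sum, each level with its own
    displacement, and h moves them back by that of level k. Telescoping F' thus leaves integrals of
    \<open>b k x * h k x powr (s - 1)\<close>, in which \<open>b k\<close> is no longer
    translated.\<close>
  define G where "G k x = (\<Sum>j\<in>{j\<in>I. k \<le> j}. b j (dy_shift j n x))" for k x
  define h where "h k x = G k (dy_shift k (- n) x)" for k x
  define H where "H x = Max ((\<lambda>k. h k x) ` I)" for x
  define F where "F x = (\<Sum>k\<in>I. b k x)" for x
  define F' where "F' x = (\<Sum>k\<in>I. b k (dy_shift k n x))" for x
  define X where "X = (\<integral>\<^sup>+x. ennreal (F' x powr s) \<partial>lborel)"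
  define Y where "Y = (\<integral>\<^sup>+x. ennreal (F x powr s) \<partial>lborel)"
  have [measurable]: "b k \<in> borel_measurable borel" for k
    by (rule level_const_measurable[OF b]) simp
  have G: "level_const k (G k)" for k
    unfolding G_def[abs_def] using level_const_mono[OF _ level_const_shift[OF b]]
    by (intro level_const_sum) auto
  have [measurable]: "G k \<in> borel_measurable borel" "h k \<in> borel_measurable borel" for k
    unfolding h_def[abs_def] G_def[abs_def] by measurable
  have [measurable]: "H \<in> borel_measurable borel" "F \<in> borel_measurable borel"
    "F' \<in> borel_measurable borel"
    unfolding H_def[abs_def] F_def[abs_def] F'_def[abs_def]
    using \<open>finite I\<close> by (measurable; simp)+
  have G0: "0 \<le> G k x" for k x
    unfolding G_def using b0 by (intro sum_nonneg) auto
  have h_le: "h k x \<le> H x" if "k \<in> I" for k x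
    unfolding H_def using that \<open>finite I\<close> by (intro Max_ge) auto
  have H_ex: "\<exists>k\<in>I. H x = h k x" for x
  proof -
    have "H x \<in> (\<lambda>k. h k x) ` I"
      unfolding H_def using \<open>I \<noteq> {}\<close> \<open>finite I\<close> by (intro Max_in) auto
    then show ?thesis by blast
  qed
  have h0: "0 \<le> h k x" for k x unfolding h_def by (rule G0)
  have H0: "0 \<le> H x" for x using H_ex[of x] h0 by metis
  have F0: "0 \<le> F x" for x unfolding F_def using b0 by (intro sum_nonneg) auto
  have Gs: "ennreal (G k x powr s) \<le> ennreal (F' x powr s)" if "k \<in> I" for k x
    unfolding F'_def G_def using s b0 \<open>finite I\<close>
    by (intro ennreal_leI powr_mono2 sum_mono2 sum_nonneg) auto
  have "(\<integral>\<^sup>+x. ennreal (H x powr s) \<partial>lborel) \<le>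
      (\<integral>\<^sup>+x. (SUP k\<in>I. ennreal (G k (dy_shift k (- n) x) powr s)) \<partial>lborel)"
  proof (rule nn_integral_mono)
    fix x obtain k where "k \<in> I" "H x = h k x" using H_ex by blast
    then show "ennreal (H x powr s) \<le> (SUP k\<in>I. ennreal (G k (dy_shift k (- n) x) powr s))"
      unfolding h_def by (intro SUP_upper2[of k]) auto
  qed
  also have "\<dots> \<le> of_nat (card {m :: int ^ 'n. \<forall>i. \<bar>m $ i\<bar> \<le> N}) *
      (\<integral>\<^sup>+x. (SUP k\<in>I. ennreal (G k x powr s)) \<partial>lborel)"
    using \<open>finite I\<close> n by (intro nn_integral_SUP_shift_le level_const_comp[OF G]) auto
  also have "\<dots> \<le> of_nat (card {m :: int ^ 'n. \<forall>i. \<bar>m $ i\<bar> \<le> N}) * X"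
    unfolding X_def by (intro mult_left_mono nn_integral_mono SUP_least Gs) auto
  finally have H_int: "(\<integral>\<^sup>+x. ennreal (H x powr s) \<partial>lborel) \<le> ennreal c * X"
    by (simp add: c_def ennreal_of_nat_eq_real_of_nat)

  \<comment> \<open>Only finiteness matters, so a bound depending on I is good enough: the power of
    the sum is at most \<open>card I powr s\<close> times the sum of the powers, whose integrals are
    translation invariant one at a time.\<close>
  have "X < top"
  proof -
    have sum_le: "F' x powr s \<le> real (card I) powr s * (\<Sum>k\<in>I. b k (dy_shift k n x) powr s)" for x
    proof -
      define m where "m = Max ((\<lambda>k. b k (dy_shift k n x)) ` I)"
      have m: "b k (dy_shift k n x) \<le> m" if "k \<in> I" for k
        unfolding m_def using that \<open>finite I\<close> by (intro Max_ge) auto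
      have "m \<in> (\<lambda>k. b k (dy_shift k n x)) ` I"
        unfolding m_def using \<open>I \<noteq> {}\<close> \<open>finite I\<close> by (intro Max_in) auto
      then obtain k where k: "k \<in> I" "m = b k (dy_shift k n x)" by blast
      have "F' x \<le> real (card I) * m"
        unfolding F'_def using sum_bounded_above[of I, OF m] by simp
      then have "F' x powr s \<le> (real (card I) * m) powr s"
        using s b0 unfolding F'_def by (intro powr_mono2 sum_nonneg) auto
      also have "\<dots> = real (card I) powr s * m powr s"
        using k b0 by (simp add: powr_mult)
      also have "\<dots> \<le> real (card I) powr s * (\<Sum>k\<in>I. b k (dy_shift k n x) powr s)"
        unfolding k(2) using k(1) \<open>finite I\<close>
        by (intro mult_left_mono member_le_sum[of k I "\<lambda>k. b k (dy_shift k n x) powr s"]) auto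
      finally show ?thesis .
    qed
    have "X \<le> (\<integral>\<^sup>+x. ennreal (real (card I) powr s) *
        (\<Sum>k\<in>I. ennreal (b k (dy_shift k n x) powr s)) \<partial>lborel)"
      unfolding X_def using sum_le
      by (intro nn_integral_mono) (simp add: ennreal_mult'[symmetric] ennreal_leI)
    also have "\<dots> = ennreal (real (card I) powr s) *
        (\<Sum>k\<in>I. \<integral>\<^sup>+x. ennreal (b k (dy_shift k n x) powr s) \<partial>lborel)"
      by (subst nn_integral_cmult, measurable, subst nn_integral_sum, measurable)
    also have "\<dots> = ennreal (real (card I) powr s) *
        (\<Sum>k\<in>I. \<integral>\<^sup>+x. ennreal (b k x powr s) \<partial>lborel)"
      by (intro arg_cong2[where f="(*)"] refl sum.cong nn_integral_dy_shift) measurable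
    also have "\<dots> \<le> ennreal (real (card I) powr s) * (\<Sum>k\<in>I. Y)"
      unfolding Y_def F_def using s b0 \<open>finite I\<close>
      by (intro mult_left_mono sum_mono nn_integral_mono ennreal_leI powr_mono2 member_le_sum) auto
    also have "\<dots> < top"
      using fin unfolding Y_def F_def
      by (simp add: ennreal_mult_less_top ennreal_of_nat_eq_real_of_nat)
    finally show ?thesis .
  qed

  have "X \<le> (\<integral>\<^sup>+x. ennreal s * (\<Sum>k\<in>I. ennreal (b k (dy_shift k n x) * G k x powr (s - 1))) \<partial>lborel)"
    unfolding X_def
  proof (rule nn_integral_mono)
    fix x
    have "(\<Sum>k\<in>I. ennreal (b k (dy_shift k n x) * G k x powr (s - 1))) =
          ennreal (\<Sum>k\<in>I. b k (dy_shift k n x) * G k x powr (s - 1))"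
      using b0 by (intro sum_ennreal) simp
    then have "ennreal s * (\<Sum>k\<in>I. ennreal (b k (dy_shift k n x) * G k x powr (s - 1))) =
        ennreal (s * (\<Sum>k\<in>I. b k (dy_shift k n x) * G k x powr (s - 1)))"
      using s by (simp add: ennreal_mult')
    then show "ennreal (F' x powr s) \<le>
        ennreal s * (\<Sum>k\<in>I. ennreal (b k (dy_shift k n x) * G k x powr (s - 1)))"
      using sum_powr_bounds(1)[of I "\<lambda>k. b k (dy_shift k n x)" s] \<open>finite I\<close> b0 s
      by (auto simp: F'_def G_def intro: ennreal_leI)
  qed
  also have "\<dots> = ennreal s *
      (\<Sum>k\<in>I. \<integral>\<^sup>+x. ennreal (b k (dy_shift k n x) * G k x powr (s - 1)) \<partial>lborel)"
    by (subst nn_integral_cmult, measurable, subst nn_integral_sum, measurable)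
  also have "(\<Sum>k\<in>I. \<integral>\<^sup>+x. ennreal (b k (dy_shift k n x) * G k x powr (s - 1)) \<partial>lborel) =
      (\<Sum>k\<in>I. \<integral>\<^sup>+x. ennreal (b k x * h k x powr (s - 1)) \<partial>lborel)"
  proof (rule sum.cong[OF refl])
    fix k
    show "(\<integral>\<^sup>+x. ennreal (b k (dy_shift k n x) * G k x powr (s - 1)) \<partial>lborel) =
        (\<integral>\<^sup>+x. ennreal (b k x * h k x powr (s - 1)) \<partial>lborel)"
      using nn_integral_dy_shift[of "\<lambda>x. ennreal (b k x * h k x powr (s - 1))" k n]
      by (simp add: h_def dy_shift_shift)
  qed
  also have "\<dots> = (\<integral>\<^sup>+x. (\<Sum>k\<in>I. ennreal (b k x * h k x powr (s - 1))) \<partial>lborel)"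
    by (rule nn_integral_sum[symmetric]) measurable
  also have "(\<integral>\<^sup>+x. (\<Sum>k\<in>I. ennreal (b k x * h k x powr (s - 1))) \<partial>lborel) \<le> (\<integral>\<^sup>+x. ennreal ((2 * s * c) powr (s - 1)) * ennreal (F x powr s) +
      ennreal (1 / (2 * s * c)) * ennreal (H x powr s) \<partial>lborel)"
  proof (rule nn_integral_mono)
    fix x
    \<comment> \<open>With this e the part containing H contributes at most s e c X = X/2 by
      \<open>H_int\<close>, which can be absorbed into X.\<close>
    define e where "e = 1 / (2 * s * c)"
    have e: "0 < e" "(2 * s * c) powr (s - 1) = (1 / e) powr (s - 1)"
      using c s by (auto simp: e_def)
    have "(\<Sum>k\<in>I. b k x * h k x powr (s - 1)) \<le> F x * H x powr (s - 1)"
      unfolding F_def sum_distrib_right using b0 h0 h_le s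
      by (intro sum_mono mult_left_mono powr_mono2) auto
    \<comment> \<open>Young's inequality, by comparing F with e H.\<close>
    also have "\<dots> \<le> (1 / e) powr (s - 1) * F x powr s + e * H x powr s"
    proof (cases "F x \<le> e * H x")
      case True
      have "F x * H x powr (s - 1) \<le> e * H x * H x powr (s - 1)"
        using True by (intro mult_right_mono) auto
      also have "\<dots> = e * H x powr s"
        using powr_mult_base[of "H x" "s - 1"] H0[of x] by simp
      finally show ?thesis
        using e by (simp add: add_increasing)
    next
      case False
      have "F x * H x powr (s - 1) \<le> F x * (F x / e) powr (s - 1)"
        using False H0[of x] F0[of x] e s
        by (intro mult_left_mono powr_mono2) (auto simp: field_simps)
      also have "(F x / e) powr (s - 1) = (1 / e) powr (s - 1) * F x powr (s - 1)"
        using powr_mult[of "1 / e" "F x" "s - 1"] F0[of x] e by simp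
      also have "F x * \<dots> = (1 / e) powr (s - 1) * F x powr s"
        using powr_mult_base[of "F x" "s - 1"] F0[of x] by (simp add: mult_ac)
      finally show ?thesis
        using e by (simp add: add_increasing2)
    qed
    finally have "ennreal (\<Sum>k\<in>I. b k x * h k x powr (s - 1)) \<le>
        ennreal ((1 / e) powr (s - 1) * F x powr s + e * H x powr s)"
      by (rule ennreal_leI)
    also have "ennreal (\<Sum>k\<in>I. b k x * h k x powr (s - 1)) = (\<Sum>k\<in>I. ennreal (b k x * h k x powr (s - 1)))"
      using b0 by (intro sum_ennreal[symmetric]) simp
    also have "ennreal ((1 / e) powr (s - 1) * F x powr s + e * H x powr s) =
        ennreal ((1 / e) powr (s - 1)) * ennreal (F x powr s) + ennreal e * ennreal (H x powr s)"
      using e by (simp add: ennreal_plus ennreal_mult')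
    finally show "(\<Sum>k\<in>I. ennreal (b k x * h k x powr (s - 1))) \<le>
        ennreal ((2 * s * c) powr (s - 1)) * ennreal (F x powr s) +
        ennreal (1 / (2 * s * c)) * ennreal (H x powr s)"
      unfolding e(2) by (simp add: e_def)
  qed
  also have "(\<integral>\<^sup>+x. ennreal ((2 * s * c) powr (s - 1)) * ennreal (F x powr s) +
      ennreal (1 / (2 * s * c)) * ennreal (H x powr s) \<partial>lborel) = ennreal ((2 * s * c) powr (s - 1)) * Y +
      ennreal (1 / (2 * s * c)) * (\<integral>\<^sup>+x. ennreal (H x powr s) \<partial>lborel)"
    unfolding Y_def by (simp add: nn_integral_add nn_integral_cmult)
  also have "\<dots> \<le> ennreal ((2 * s * c) powr (s - 1)) * Y + ennreal (1 / (2 * s * c)) * (ennreal c * X)"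
    by (intro add_mono mult_left_mono H_int) auto
  finally have XY: "X \<le> ennreal s * (ennreal ((2 * s * c) powr (s - 1)) * Y +
      ennreal (1 / (2 * s * c)) * (ennreal c * X))"
    by (simp add: mult_left_mono)
  obtain x where x: "X = ennreal x" "0 \<le> x" using \<open>X < top\<close> by (cases X) auto
  obtain y where y: "Y = ennreal y" "0 \<le> y" using fin by (cases Y) (auto simp: Y_def F_def)
  have "x \<le> s * ((2 * s * c) powr (s - 1) * y + (1 / (2 * s * c)) * (c * x))"
    using XY x y s c by (simp add: ennreal_mult'[symmetric] ennreal_plus[symmetric] del: ennreal_plus)
  also have "\<dots> = s * (2 * s * c) powr (s - 1) * y + x / 2"
    using s c by (simp add: field_simps)
  finally have "x \<le> 2 * s * (2 * s * c) powr (s - 1) * y"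
    by simp
  then show ?thesis
    using x y s unfolding X_def Y_def F_def F'_def
    by (simp add: ennreal_mult'[symmetric] ennreal_leI)
qed

section \<open>Mixed quasi-norms of dyadic sequences\<close>

definition lq :: "ennreal \<Rightarrow> (int \<Rightarrow> ennreal) \<Rightarrow> ennreal" where
  "lq q a = (if q = \<infinity> then (SUP k. a k)
     else enn_powr (\<integral>\<^sup>+k. enn_powr (a k) (enn2real q) \<partial>count_space UNIV) (1 / enn2real q))"

lemma enn2real_pos: "0 < q \<Longrightarrow> q \<noteq> \<infinity> \<Longrightarrow> 0 < enn2real q"
  by (simp add: enn2real_positive_iff less_top)

text \<open>The translation estimates hold for finite sets of levels with constants independent of
  the set; they pass to the limit along these symmetric intervals.\<close>

lemma nn_integral_count_space_int:
  "(\<integral>\<^sup>+k. a k \<partial>count_space UNIV) = (SUP N::nat. \<Sum>k\<in>{- int N..int N}. a k)"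
proof -
  have "a k = (SUP N::nat. a k * indicator {- int N..int N} k)" for k
  proof (rule antisym)
    show "a k \<le> (SUP N::nat. a k * indicator {- int N..int N} k)"
      by (rule SUP_upper2[of "nat \<bar>k\<bar>"]) (auto simp: indicator_def)
  qed (auto intro!: SUP_least simp: indicator_def)
  then have "(\<integral>\<^sup>+k. a k \<partial>count_space UNIV) =
      (\<integral>\<^sup>+k. (SUP N::nat. a k * indicator {- int N..int N} k) \<partial>count_space UNIV)"
    by (intro nn_integral_cong) blast
  also have "\<dots> = (SUP N::nat. \<integral>\<^sup>+k. a k * indicator {- int N..int N} k \<partial>count_space UNIV)"
    by (rule nn_integral_monotone_convergence_SUP)
       (auto simp: incseq_def le_fun_def indicator_def)
  also have "\<dots> = (SUP N::nat. \<Sum>k\<in>{- int N..int N}. a k)"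
    by (simp add: nn_integral_count_space_indicator[symmetric] nn_integral_count_space_finite)
  finally show ?thesis .
qed

lemma lq_mono:
  assumes "0 < q" "\<And>k. a k \<le> b k"
  shows "lq q a \<le> lq q b"
  unfolding lq_def using assms
  by (auto intro!: SUP_mono enn_powr_mono nn_integral_mono)

lemma lq_cmult:
  assumes "0 < q"
  shows "lq q (\<lambda>k. c * a k) = c * lq q a"
proof (cases "q = \<infinity>")
  case True
  then show ?thesis by (simp add: lq_def SUP_mult_left_ennreal)
next
  case False
  then have "0 < enn2real q" using assms by (simp add: enn2real_pos)
  then show ?thesis
    using False by (simp add: lq_def enn_powr_mult nn_integral_cmult)
qed

lemma lq_reindex: "lq q (\<lambda>k. a (k - i)) = lq q a"
proof -
  have bij: "bij (\<lambda>k::int. k - i)"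
    by (rule bij_betw_byWitness[where f' = "\<lambda>k. k + i"]) auto
  have "(SUP k. a (k - i)) = (SUP k. a k)"
  proof (rule antisym)
    show "(SUP k. a k) \<le> (SUP k. a (k - i))"
      by (rule SUP_least, rule_tac i="k + i" in SUP_upper2) auto
  qed (auto intro: SUP_least SUP_upper)
  moreover have "(\<integral>\<^sup>+k. enn_powr (a (k - i)) (enn2real q) \<partial>count_space UNIV) =
      (\<integral>\<^sup>+k. enn_powr (a k) (enn2real q) \<partial>count_space UNIV)"
    by (rule nn_integral_bij_count_space[OF bij])
  ultimately show ?thesis by (simp add: lq_def)
qed

text \<open>A power of a finite supremum is at most the sum of the powers. For q = \<infinity> the
  term \<open>1 / enn2real q\<close> is 1/0 = 0, so for nonempty S the constant is 1; later
  constants rely on the same convention.\<close>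

lemma lq_SUP_le:
  assumes "0 < q" "finite S"
  shows "lq q (\<lambda>k. SUP i\<in>S. a i k) \<le>
    ennreal (real (card S) powr (1 / enn2real q)) * (SUP i\<in>S. lq q (a i))"
proof (cases "S = {} \<or> q = \<infinity>")
  case True
  then show ?thesis
  proof
    assume "q = \<infinity>"
    then show ?thesis
      using assms SUP_commute[of "\<lambda>k i. a i k" S UNIV]
      by (cases "S = {}") (auto simp: lq_def card_gt_0_iff bot_ennreal)
  qed (use assms in \<open>auto simp: lq_def bot_ennreal\<close>)
next
  case False
  define e where "e = enn2real q"
  have e: "0 < e" using assms False by (simp add: enn2real_pos e_def)
  have "(\<integral>\<^sup>+k. enn_powr (SUP i\<in>S. a i k) e \<partial>count_space UNIV) \<le>
      (\<integral>\<^sup>+k. (\<Sum>i\<in>S. enn_powr (a i k) e) \<partial>count_space UNIV)"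
    using assms by (intro nn_integral_mono) (auto simp: enn_powr_SUP[OF e] intro!: SUP_least member_le_sum)
  also have "\<dots> = (\<Sum>i\<in>S. \<integral>\<^sup>+k. enn_powr (a i k) e \<partial>count_space UNIV)"
    by (rule nn_integral_sum) simp
  also have "\<dots> \<le> of_nat (card S) * (SUP i\<in>S. \<integral>\<^sup>+k. enn_powr (a i k) e \<partial>count_space UNIV)"
    by (intro sum_bounded_above SUP_upper)
  finally have "lq q (\<lambda>k. SUP i\<in>S. a i k) \<le>
      enn_powr (of_nat (card S) * (SUP i\<in>S. \<integral>\<^sup>+k. enn_powr (a i k) e \<partial>count_space UNIV)) (1 / e)"
    using False e by (auto simp: lq_def e_def intro!: enn_powr_mono)
  also have "\<dots> = ennreal (real (card S) powr (1 / enn2real q)) * (SUP i\<in>S. lq q (a i))"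
    using False e
    by (simp add: lq_def e_def enn_powr_mult enn_powr_SUP enn_powr_ennreal ennreal_of_nat_eq_real_of_nat)
  finally show ?thesis .
qed

lemma borel_measurable_lq:
  assumes "0 < q" and [measurable]: "\<And>k. (\<lambda>x. b k x) \<in> borel_measurable M"
  shows "(\<lambda>x. lq q (\<lambda>k. b k x)) \<in> borel_measurable M"
  unfolding lq_def nn_integral_count_space_int by (cases "q = \<infinity>"; simp; measurable)

text \<open>The two real-valued estimates extend to values in [0, \<infinity>] because a finite
  right-hand side forces every \<open>h k\<close> with k in I to be finite almost everywhere. The
  constant precedes I and h so that infinite families can be reached by monotone limits.\<close>

lemma ennreal_sum_shift_finite:
  assumes "0 < s"
  shows "\<exists>C>0. \<forall>(I :: int set) (h :: int \<Rightarrow> real ^ 'n \<Rightarrow> ennreal).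
    finite I \<longrightarrow> (\<forall>k. level_const k (h k)) \<longrightarrow>
    (\<integral>\<^sup>+x. enn_powr (\<Sum>k\<in>I. h k (dy_shift k n x)) s \<partial>lborel) \<le>
    ennreal C * (\<integral>\<^sup>+x. enn_powr (\<Sum>k\<in>I. h k x) s \<partial>lborel)"
proof -
  define N where "N = Max (range (\<lambda>i. \<bar>n $ i\<bar>))"
  have n: "\<bar>n $ i\<bar> \<le> N" for i
    unfolding N_def by (intro Max_ge) auto
  define c where "c = real (card {m :: int ^ 'n. \<forall>i. \<bar>m $ i\<bar> \<le> N})"
  have "c \<ge> 1"
    using n[of undefined] card_int_vec_box_pos[of N, where 'n='n] by (simp add: c_def)
  define C where "C = (if s \<le> 1 then c + 1 / s else 2 * s * (2 * s * c) powr (s - 1))"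
  have "C > 0"
    using \<open>c \<ge> 1\<close> \<open>0 < s\<close> by (auto simp: C_def add_pos_pos)
  have real: "(\<integral>\<^sup>+x. ennreal ((\<Sum>k\<in>I. b k (dy_shift k n x)) powr s) \<partial>lborel) \<le>
    ennreal C * (\<integral>\<^sup>+x. ennreal ((\<Sum>k\<in>I. b k x) powr s) \<partial>lborel)"
    if "finite I" "\<And>k. level_const k (b k)" "\<And>k x. 0 \<le> b k x" for I and b :: "int \<Rightarrow> real ^ 'n \<Rightarrow> real"
    using nn_integral_sum_shift_le_small[OF that \<open>0 < s\<close> _ n]
      nn_integral_sum_shift_le_large[OF that _ n, of s]
    by (auto simp: C_def c_def)
  show ?thesis
  proof (intro exI[of _ C] conjI allI impI \<open>C > 0\<close>)
    fix I :: "int set" and h :: "int \<Rightarrow> real ^ 'n \<Rightarrow> ennreal"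
    assume I: "finite I" and h: "\<forall>k. level_const k (h k)"
    have [measurable]: "h k \<in> borel_measurable borel" for k
      by (rule level_const_measurable) (use h in auto)
    show "(\<integral>\<^sup>+x. enn_powr (\<Sum>k\<in>I. h k (dy_shift k n x)) s \<partial>lborel) \<le>
      ennreal C * (\<integral>\<^sup>+x. enn_powr (\<Sum>k\<in>I. h k x) s \<partial>lborel)"
    proof (cases "(\<integral>\<^sup>+x. enn_powr (\<Sum>k\<in>I. h k x) s \<partial>lborel) = top")
      case True
      then show ?thesis using \<open>C > 0\<close> by (simp add: ennreal_mult_top)
    next
      case False
      have "AE x in lborel. enn_powr (\<Sum>k\<in>I. h k x) s \<noteq> \<infinity>"
        by (rule nn_integral_PInf_AE) (use False in auto)
      then have AE1: "AE x in lborel. \<forall>k\<in>I. h k x \<noteq> top"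
      proof eventually_elim
        fix x assume *: "enn_powr (\<Sum>k\<in>I. h k x) s \<noteq> \<infinity>"
        show "\<forall>k\<in>I. h k x \<noteq> top"
        proof (rule ccontr)
          assume "\<not> ?thesis"
          then have "(\<Sum>k\<in>I. h k x) = top" using I by auto
          with * show False by simp
        qed
      qed
      \<comment> \<open>The exceptional set is treated level by level, since every level has its own
        translation.\<close>
      have AE2: "AE x in lborel. \<forall>k\<in>I. h k (dy_shift k n x) \<noteq> top"
      proof (subst AE_ball_countable, use I in \<open>simp add: countable_finite\<close>, intro ballI)
        fix k assume "k \<in> I"
        have P: "Measurable.pred borel (\<lambda>x. h k x = top)" by measurable
        have "AE x in lborel. \<not> (h k x = top)"
          using AE1 by eventually_elim (use \<open>k \<in> I\<close> in auto)
        then have "emeasure lborel {x. h k x = top} = 0"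
          by (subst (asm) AE_iff_measurable[OF _ refl]) auto
        then have "emeasure lborel {x. h k (dy_shift k n x) = top} = 0"
          using emeasure_dy_shift[OF P] by simp
        then show "AE x in lborel. h k (dy_shift k n x) \<noteq> top"
          by (subst AE_iff_measurable[OF _ refl]) auto
      qed
      define b where "b k x = enn2real (h k x)" for k x
      have eq: "enn_powr (\<Sum>k\<in>I. u k) s = ennreal ((\<Sum>k\<in>I. enn2real (u k)) powr s)"
        if "\<forall>k\<in>I. u k \<noteq> top" for u
      proof -
        have "(\<Sum>k\<in>I. u k) = (\<Sum>k\<in>I. ennreal (enn2real (u k)))"
          using that by (intro sum.cong) (auto simp: less_top)
        also have "\<dots> = ennreal (\<Sum>k\<in>I. enn2real (u k))"
          by (intro sum_ennreal) auto
        finally show ?thesis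
          by (simp add: enn_powr_ennreal sum_nonneg)
      qed
      have AE2': "AE x in lborel. enn_powr (\<Sum>k\<in>I. h k (dy_shift k n x)) s =
          ennreal ((\<Sum>k\<in>I. b k (dy_shift k n x)) powr s)"
        using AE2 unfolding b_def by eventually_elim (rule eq)
      have AE1': "AE x in lborel. enn_powr (\<Sum>k\<in>I. h k x) s = ennreal ((\<Sum>k\<in>I. b k x) powr s)"
        using AE1 unfolding b_def by eventually_elim (rule eq)
      have "(\<integral>\<^sup>+x. enn_powr (\<Sum>k\<in>I. h k (dy_shift k n x)) s \<partial>lborel) =
          (\<integral>\<^sup>+x. ennreal ((\<Sum>k\<in>I. b k (dy_shift k n x)) powr s) \<partial>lborel)"
        by (rule nn_integral_cong_AE[OF AE2'])
      also have "\<dots> \<le> ennreal C * (\<integral>\<^sup>+x. ennreal ((\<Sum>k\<in>I. b k x) powr s) \<partial>lborel)"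
        unfolding b_def by (rule real[OF I]) (rule level_const_comp, rule spec[OF h], rule enn2real_nonneg)
      also have "(\<integral>\<^sup>+x. ennreal ((\<Sum>k\<in>I. b k x) powr s) \<partial>lborel) =
          (\<integral>\<^sup>+x. enn_powr (\<Sum>k\<in>I. h k x) s \<partial>lborel)"
        by (rule nn_integral_cong_AE[OF AE1', symmetric])
      finally show ?thesis .
    qed
  qed
qed

text \<open>Monotone convergence over finite sets of levels. For finite q the p-th power of the
  \<open>lq\<close> quasi-norm is the power p/q of the sum of q-th powers, so the finite estimate is
  applied to the q-th powers with s = p/q.\<close>

lemma nn_integral_lq_shift_le:
  assumes "0 < p" "0 < q"
  shows "\<exists>C>0. \<forall>b :: int \<Rightarrow> real ^ 'n \<Rightarrow> ennreal. (\<forall>k. level_const k (b k)) \<longrightarrow>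
    (\<integral>\<^sup>+x. enn_powr (lq q (\<lambda>k. b k (dy_shift k n x))) p \<partial>lborel) \<le>
    ennreal C * (\<integral>\<^sup>+x. enn_powr (lq q (\<lambda>k. b k x)) p \<partial>lborel)"
proof -
  \<comment> \<open>\<open>T N\<close> stands for the truncation of
    \<open>enn_powr (lq q a) p\<close> to levels of modulus at most N; the passage to the limit is
    common to both ranges of q.\<close>
  have key: "(\<integral>\<^sup>+x. enn_powr (lq q (\<lambda>k. b k (dy_shift k n x))) p \<partial>lborel) \<le>
      ennreal C * (\<integral>\<^sup>+x. enn_powr (lq q (\<lambda>k. b k x)) p \<partial>lborel)"
    if b: "\<forall>k. level_const k (b k)"
      and T: "\<And>a. enn_powr (lq q a) p = (SUP N::nat. T N a)"
      and mono: "\<And>a. incseq (\<lambda>N. T N a)"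
      and meas: "\<And>N (c :: int \<Rightarrow> real ^ 'n \<Rightarrow> ennreal). (\<And>k. c k \<in> borel_measurable borel) \<Longrightarrow>
        (\<lambda>x. T N (\<lambda>k. c k x)) \<in> borel_measurable borel"
      and le: "\<And>N. (\<integral>\<^sup>+x. T N (\<lambda>k. b k (dy_shift k n x)) \<partial>lborel) \<le>
        ennreal C * (\<integral>\<^sup>+x. T N (\<lambda>k. b k x) \<partial>lborel)"
    for b :: "int \<Rightarrow> real ^ 'n \<Rightarrow> ennreal" and T :: "nat \<Rightarrow> (int \<Rightarrow> ennreal) \<Rightarrow> ennreal" and C
  proof -
    have [measurable]: "b k \<in> borel_measurable borel" for k
      by (rule level_const_measurable) (use b in auto)
    have "(\<integral>\<^sup>+x. enn_powr (lq q (\<lambda>k. b k (dy_shift k n x))) p \<partial>lborel) =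
        (SUP N::nat. \<integral>\<^sup>+x. T N (\<lambda>k. b k (dy_shift k n x)) \<partial>lborel)"
      unfolding T by (intro nn_integral_monotone_convergence_SUP)
        (use mono meas[of "\<lambda>k x. b k (dy_shift k n x)"] in \<open>auto simp: incseq_def le_fun_def\<close>)
    also have "\<dots> \<le> ennreal C * (\<integral>\<^sup>+x. enn_powr (lq q (\<lambda>k. b k x)) p \<partial>lborel)"
    proof (rule SUP_least)
      fix N
      note le[of N]
      also have "ennreal C * (\<integral>\<^sup>+x. T N (\<lambda>k. b k x) \<partial>lborel) \<le>
          ennreal C * (\<integral>\<^sup>+x. enn_powr (lq q (\<lambda>k. b k x)) p \<partial>lborel)"
        unfolding T by (intro mult_left_mono nn_integral_mono SUP_upper) auto
      finally show "(\<integral>\<^sup>+x. T N (\<lambda>k. b k (dy_shift k n x)) \<partial>lborel) \<le>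
          ennreal C * (\<integral>\<^sup>+x. enn_powr (lq q (\<lambda>k. b k x)) p \<partial>lborel)" .
    qed
    finally show ?thesis .
  qed
  have sub: "{- int M..int M} \<subseteq> {- int N..int N}" if "M \<le> N" for M N
    using that by auto
  show ?thesis
  proof (cases "q = \<infinity>")
    case True
    define N where "N = Max (range (\<lambda>i. \<bar>n $ i\<bar>))"
    have n: "\<bar>n $ i\<bar> \<le> N" for i
      unfolding N_def by (intro Max_ge) auto
    define C where "C = real (card {m :: int ^ 'n. \<forall>i. \<bar>m $ i\<bar> \<le> N})"
    have "0 \<le> N" using n[of undefined] by linarith
    then have "C > 0"
      using card_int_vec_box_pos[of N, where 'n='n] by (simp add: C_def)
    have T: "enn_powr (lq q a) p = (SUP N::nat. SUP k\<in>{- int N..int N}. enn_powr (a k) p)" for a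
    proof -
      have "(SUP k. enn_powr (a k) p) = (SUP N::nat. SUP k\<in>{- int N..int N}. enn_powr (a k) p)"
      proof (rule antisym)
        show "(SUP k. enn_powr (a k) p) \<le> (SUP N::nat. SUP k\<in>{- int N..int N}. enn_powr (a k) p)"
        proof (rule SUP_least)
          fix k
          show "enn_powr (a k) p \<le> (SUP N::nat. SUP k\<in>{- int N..int N}. enn_powr (a k) p)"
            by (rule SUP_upper2[of "nat \<bar>k\<bar>"], simp, rule SUP_upper2[of k]) auto
        qed
      qed (auto intro!: SUP_least SUP_upper)
      then show ?thesis using True assms by (simp add: lq_def enn_powr_SUP)
    qed
    show ?thesis
    proof (intro exI[of _ C] conjI allI impI \<open>C > 0\<close>)
      fix b :: "int \<Rightarrow> real ^ 'n \<Rightarrow> ennreal" assume b: "\<forall>k. level_const k (b k)"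
      show "(\<integral>\<^sup>+x. enn_powr (lq q (\<lambda>k. b k (dy_shift k n x))) p \<partial>lborel) \<le>
          ennreal C * (\<integral>\<^sup>+x. enn_powr (lq q (\<lambda>k. b k x)) p \<partial>lborel)"
      proof (rule key[OF b T])
        show "incseq (\<lambda>N. SUP k\<in>{- int N..int N}. enn_powr (a k) p)" for a
          by (intro incseq_SucI SUP_subset_mono) auto
        show "(\<lambda>x. SUP k\<in>{- int N..int N}. enn_powr (c k x) p) \<in> borel_measurable borel"
          if [measurable]: "\<And>k. c k \<in> borel_measurable borel" for N and c :: "int \<Rightarrow> real ^ 'n \<Rightarrow> ennreal"
          by measurable
        show "(\<integral>\<^sup>+x. (SUP k\<in>{- int N..int N}. enn_powr (b k (dy_shift k n x)) p) \<partial>lborel) \<le>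
            ennreal C * (\<integral>\<^sup>+x. (SUP k\<in>{- int N..int N}. enn_powr (b k x) p) \<partial>lborel)" for N
          unfolding C_def ennreal_of_nat_eq_real_of_nat[symmetric]
          by (rule nn_integral_SUP_shift_le[OF finite_atLeastAtMost_int level_const_comp n])
             (rule spec[OF b])
      qed
    qed
  next
    case False
    define e where "e = enn2real q"
    have e: "0 < e" using assms False by (simp add: enn2real_pos e_def)
    obtain C where "C > 0" and C: "\<And>(I :: int set) (h :: int \<Rightarrow> real ^ 'n \<Rightarrow> ennreal).
        finite I \<Longrightarrow> \<forall>k. level_const k (h k) \<Longrightarrow>
        (\<integral>\<^sup>+x. enn_powr (\<Sum>k\<in>I. h k (dy_shift k n x)) (p / e) \<partial>lborel) \<le>
        ennreal C * (\<integral>\<^sup>+x. enn_powr (\<Sum>k\<in>I. h k x) (p / e) \<partial>lborel)"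
      using ennreal_sum_shift_finite[of "p / e" n] assms e by auto
    have T: "enn_powr (lq q a) p = (SUP N::nat. enn_powr (\<Sum>k\<in>{- int N..int N}. enn_powr (a k) e) (p / e))" for a
      using False assms e
      by (simp add: lq_def e_def[symmetric] enn_powr_enn_powr nn_integral_count_space_int enn_powr_SUP)
    show ?thesis
    proof (intro exI[of _ C] conjI allI impI \<open>C > 0\<close>)
      fix b :: "int \<Rightarrow> real ^ 'n \<Rightarrow> ennreal" assume b: "\<forall>k. level_const k (b k)"
      show "(\<integral>\<^sup>+x. enn_powr (lq q (\<lambda>k. b k (dy_shift k n x))) p \<partial>lborel) \<le>
          ennreal C * (\<integral>\<^sup>+x. enn_powr (lq q (\<lambda>k. b k x)) p \<partial>lborel)"
      proof (rule key[OF b T])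
        show "incseq (\<lambda>N. enn_powr (\<Sum>k\<in>{- int N..int N}. enn_powr (a k) e) (p / e))" for a
          using assms e by (intro incseq_SucI enn_powr_mono sum_mono2) auto
        show "(\<lambda>x. enn_powr (\<Sum>k\<in>{- int N..int N}. enn_powr (c k x) e) (p / e)) \<in> borel_measurable borel"
          if [measurable]: "\<And>k. c k \<in> borel_measurable borel" for N and c :: "int \<Rightarrow> real ^ 'n \<Rightarrow> ennreal"
          by measurable
        show "(\<integral>\<^sup>+x. enn_powr (\<Sum>k\<in>{- int N..int N}. enn_powr (b k (dy_shift k n x)) e) (p / e) \<partial>lborel) \<le>
            ennreal C * (\<integral>\<^sup>+x. enn_powr (\<Sum>k\<in>{- int N..int N}. enn_powr (b k x) e) (p / e) \<partial>lborel)" for N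
          by (rule C[OF finite_atLeastAtMost_int]) (rule allI, rule level_const_comp, rule spec[OF b])
      qed
    qed
  qed
qed

text \<open>This is the form in which the geometric comparisons enter: u is any family, only its
  majorant is dyadic, and the neighbouring cubes may lie on other levels. The change of level is
  undone by \<open>lq_reindex\<close>, the translations by
  \<open>nn_integral_lq_shift_le\<close>.\<close>

lemma nn_integral_lq_dominated:
  fixes S :: "(int \<times> (int ^ 'n)) set"
  assumes "0 < p" "0 < q" "finite S" "0 \<le> c"
  shows "\<exists>C>0. \<forall>(b :: int \<Rightarrow> real ^ 'n \<Rightarrow> ennreal) u. (\<forall>k. level_const k (b k)) \<longrightarrow>
    (\<forall>k x. u k x \<le> ennreal c * (SUP (i, m)\<in>S. b (k - i) (dy_shift (k - i) m x))) \<longrightarrow>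
    (\<integral>\<^sup>+x. enn_powr (lq q (\<lambda>k. u k x)) p \<partial>lborel) \<le>
    ennreal C * (\<integral>\<^sup>+x. enn_powr (lq q (\<lambda>k. b k x)) p \<partial>lborel)"
proof -
  have "\<forall>m. \<exists>C>0. \<forall>b :: int \<Rightarrow> real ^ 'n \<Rightarrow> ennreal. (\<forall>k. level_const k (b k)) \<longrightarrow>
    (\<integral>\<^sup>+x. enn_powr (lq q (\<lambda>k. b k (dy_shift k m x))) p \<partial>lborel) \<le>
    ennreal C * (\<integral>\<^sup>+x. enn_powr (lq q (\<lambda>k. b k x)) p \<partial>lborel)"
    by (intro allI nn_integral_lq_shift_le assms)
  from choice[OF this] obtain A where A: "\<And>m. A m > (0::real)" and
    le: "\<And>m (b :: int \<Rightarrow> real ^ 'n \<Rightarrow> ennreal). \<forall>k. level_const k (b k) \<Longrightarrow>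
    (\<integral>\<^sup>+x. enn_powr (lq q (\<lambda>k. b k (dy_shift k m x))) p \<partial>lborel) \<le>
    ennreal (A m) * (\<integral>\<^sup>+x. enn_powr (lq q (\<lambda>k. b k x)) p \<partial>lborel)"
    by blast
  define K where "K = c * real (card S) powr (1 / enn2real q)"
  \<comment> \<open>The summand 1 keeps C positive even if K is 0 or S is empty.\<close>
  define C where "C = K powr p * (\<Sum>(i, m)\<in>S. A m) + 1"
  have "0 \<le> K" using assms by (simp add: K_def)
  have sum0: "0 \<le> (\<Sum>(i, m)\<in>S. A m)"
    using A by (intro sum_nonneg) (auto simp: less_imp_le)
  have "C > 0"
    using sum0 by (simp add: C_def add_nonneg_pos)
  show ?thesis
  proof (intro exI[of _ C] conjI allI impI \<open>C > 0\<close>)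
    fix b u :: "int \<Rightarrow> real ^ 'n \<Rightarrow> ennreal"
    assume b: "\<forall>k. level_const k (b k)"
      and u: "\<forall>k x. u k x \<le> ennreal c * (SUP (i, m)\<in>S. b (k - i) (dy_shift (k - i) m x))"
    have [measurable]: "b k \<in> borel_measurable borel" for k
      by (rule level_const_measurable) (use b in auto)
    let ?L = "\<lambda>m x. lq q (\<lambda>k. b k (dy_shift k m x))"
    have [measurable]: "(\<lambda>x. ?L m x) \<in> borel_measurable borel" for m
      using assms by (intro borel_measurable_lq) auto
    have pt: "enn_powr (lq q (\<lambda>k. u k x)) p \<le> ennreal (K powr p) * (\<Sum>(i, m)\<in>S. enn_powr (?L m x) p)" for x
    proof -
      have "lq q (\<lambda>k. u k x) \<le> lq q (\<lambda>k. ennreal c * (SUP (i, m)\<in>S. b (k - i) (dy_shift (k - i) m x)))"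
        using u assms by (intro lq_mono) auto
      also have "\<dots> = ennreal c * lq q (\<lambda>k. SUP z\<in>S. case z of (i, m) \<Rightarrow> b (k - i) (dy_shift (k - i) m x))"
        by (rule lq_cmult[OF assms(2)])
      also have "\<dots> \<le> ennreal c * (ennreal (real (card S) powr (1 / enn2real q)) *
          (SUP z\<in>S. lq q (\<lambda>k. case z of (i, m) \<Rightarrow> b (k - i) (dy_shift (k - i) m x))))"
        by (intro mult_left_mono lq_SUP_le assms) auto
      also have "(\<lambda>z. lq q (\<lambda>k. case z of (i, m) \<Rightarrow> b (k - i) (dy_shift (k - i) m x))) =
          (\<lambda>(i, m). ?L m x)"
      proof
        fix z
        show "lq q (\<lambda>k. case z of (i, m) \<Rightarrow> b (k - i) (dy_shift (k - i) m x)) = (case z of (i, m) \<Rightarrow> ?L m x)"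
          using lq_reindex[of q "\<lambda>k. b k (dy_shift k (snd z) x)" "fst z"] by (cases z) simp
      qed
      finally have "lq q (\<lambda>k. u k x) \<le> ennreal K * (SUP (i, m)\<in>S. ?L m x)"
        using assms by (simp add: K_def ennreal_mult' mult.assoc)
      then have "enn_powr (lq q (\<lambda>k. u k x)) p \<le> enn_powr (ennreal K * (SUP (i, m)\<in>S. ?L m x)) p"
        using assms by (intro enn_powr_mono) auto
      also have "\<dots> = ennreal (K powr p) * (SUP z\<in>S. enn_powr (case z of (i, m) \<Rightarrow> ?L m x) p)"
        using assms \<open>0 \<le> K\<close> by (simp add: enn_powr_mult enn_powr_SUP enn_powr_ennreal)
      also have "\<dots> \<le> ennreal (K powr p) * (\<Sum>z\<in>S. enn_powr (case z of (i, m) \<Rightarrow> ?L m x) p)"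
        using assms by (intro mult_left_mono SUP_least member_le_sum) auto
      also have "(\<lambda>z. enn_powr (case z of (i, m) \<Rightarrow> ?L m x) p) = (\<lambda>(i, m). enn_powr (?L m x) p)"
        by auto
      finally show ?thesis .
    qed
    let ?I = "\<integral>\<^sup>+x. enn_powr (lq q (\<lambda>k. b k x)) p \<partial>lborel"
    have "(\<integral>\<^sup>+x. enn_powr (lq q (\<lambda>k. u k x)) p \<partial>lborel) \<le>
        (\<integral>\<^sup>+x. ennreal (K powr p) * (\<Sum>z\<in>S. enn_powr (?L (snd z) x) p) \<partial>lborel)"
      using pt by (intro nn_integral_mono) (simp add: case_prod_unfold)
    also have "\<dots> = ennreal (K powr p) * (\<Sum>z\<in>S. \<integral>\<^sup>+x. enn_powr (?L (snd z) x) p \<partial>lborel)"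
      by (subst nn_integral_cmult, measurable, subst nn_integral_sum, measurable)
    also have "\<dots> \<le> ennreal (K powr p) * (\<Sum>z\<in>S. ennreal (A (snd z)) * ?I)"
      by (intro mult_left_mono sum_mono le b) auto
    also have "\<dots> = ennreal (K powr p * (\<Sum>(i, m)\<in>S. A m)) * ?I"
      using A sum0 by (simp add: sum_distrib_right[symmetric] sum_ennreal less_imp_le ennreal_mult'
          mult.assoc case_prod_unfold)
    also have "\<dots> \<le> ennreal C * ?I"
      by (intro mult_right_mono ennreal_leI) (auto simp: C_def)
    finally show "(\<integral>\<^sup>+x. enn_powr (lq q (\<lambda>k. u k x)) p \<partial>lborel) \<le> ennreal C * ?I" .
  qed
qed

section \<open>Quasi-norms on the scale axis\<close>

lemma Lp_qnorm_le_cmult: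
  assumes "0 < r" and [measurable]: "u \<in> borel_measurable M" "v \<in> borel_measurable M"
    and le: "AE x in M. u x \<le> c * v x"
  shows "Lp_qnorm M r u \<le> c * Lp_qnorm M r v"
proof (cases "r = \<infinity>")
  case True
  have "AE x in M. u x \<le> c * esssup M v"
    using le esssup_AE[of v M] by eventually_elim (meson mult_left_mono order_trans zero_le)
  then show ?thesis
    using True by (auto simp: Lp_qnorm_def intro!: esssup_I)
next
  case False
  then have e: "0 < enn2real r" using assms by (simp add: enn2real_pos)
  have "(\<integral>\<^sup>+x. enn_powr (u x) (enn2real r) \<partial>M) \<le> (\<integral>\<^sup>+x. enn_powr (c * v x) (enn2real r) \<partial>M)"
    using le by (intro nn_integral_mono_AE) (auto elim!: eventually_mono intro!: enn_powr_mono)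
  also have "\<dots> = enn_powr c (enn2real r) * (\<integral>\<^sup>+x. enn_powr (v x) (enn2real r) \<partial>M)"
    using e by (simp add: enn_powr_mult nn_integral_cmult)
  finally have "Lp_qnorm M r u \<le>
      enn_powr (enn_powr c (enn2real r) * (\<integral>\<^sup>+x. enn_powr (v x) (enn2real r) \<partial>M)) (1 / enn2real r)"
    using False e by (auto simp: Lp_qnorm_def intro!: enn_powr_mono)
  then show ?thesis
    using False e by (simp add: Lp_qnorm_def enn_powr_mult)
qed

lemma Lp_qnorm_le_SUP:
  assumes "0 < r" and S: "finite S" "S \<noteq> {}" and [measurable]: "u \<in> borel_measurable M"
    "\<And>i. i \<in> S \<Longrightarrow> v i \<in> borel_measurable M"
    and le: "AE x in M. u x \<le> (SUP i\<in>S. v i x)"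
  shows "Lp_qnorm M r u \<le> ennreal (real (card S) powr (1 / enn2real r)) * (SUP i\<in>S. Lp_qnorm M r (v i))"
proof (cases "r = \<infinity>")
  case True
  have "AE x in M. \<forall>i\<in>S. v i x \<le> esssup M (v i)"
    using S by (simp add: AE_ball_countable countable_finite esssup_AE)
  with le have "AE x in M. u x \<le> (SUP i\<in>S. esssup M (v i))"
    by eventually_elim (meson SUP_mono order_trans)
  then show ?thesis
    using True S by (auto simp: Lp_qnorm_def intro!: esssup_I)
next
  case False
  define e where "e = enn2real r"
  have e: "0 < e" using assms False by (simp add: enn2real_pos e_def)
  have pt: "enn_powr (u x) e \<le> (\<Sum>i\<in>S. enn_powr (v i x) e)" if "u x \<le> (SUP i\<in>S. v i x)" for x
  proof -
    have "enn_powr (u x) e \<le> (SUP i\<in>S. enn_powr (v i x) e)"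
      using enn_powr_mono[OF less_imp_le[OF e] that] by (simp add: enn_powr_SUP e)
    also have "\<dots> \<le> (\<Sum>i\<in>S. enn_powr (v i x) e)"
      using S by (intro SUP_least member_le_sum) auto
    finally show ?thesis .
  qed
  have "(\<integral>\<^sup>+x. enn_powr (u x) e \<partial>M) \<le> (\<integral>\<^sup>+x. (\<Sum>i\<in>S. enn_powr (v i x) e) \<partial>M)"
    using le by (intro nn_integral_mono_AE) (auto elim!: eventually_mono intro: pt)
  also have "\<dots> = (\<Sum>i\<in>S. \<integral>\<^sup>+x. enn_powr (v i x) e \<partial>M)"
    by (rule nn_integral_sum) measurable
  also have "\<dots> \<le> of_nat (card S) * (SUP i\<in>S. \<integral>\<^sup>+x. enn_powr (v i x) e \<partial>M)"
    by (intro sum_bounded_above SUP_upper)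
  finally have "Lp_qnorm M r u \<le>
      enn_powr (of_nat (card S) * (SUP i\<in>S. \<integral>\<^sup>+x. enn_powr (v i x) e \<partial>M)) (1 / e)"
    using False e by (auto simp: Lp_qnorm_def e_def intro!: enn_powr_mono)
  also have "\<dots> = ennreal (real (card S) powr (1 / enn2real r)) * (SUP i\<in>S. Lp_qnorm M r (v i))"
    using False e
    by (simp add: Lp_qnorm_def e_def enn_powr_mult enn_powr_SUP enn_powr_ennreal ennreal_of_nat_eq_real_of_nat)
  finally show ?thesis .
qed

lemma nn_integral_count_space_swap:
  assumes [measurable]: "\<And>k::int. a k \<in> borel_measurable M"
  shows "(\<integral>\<^sup>+x. \<integral>\<^sup>+k. a k x \<partial>count_space UNIV \<partial>M) = (\<integral>\<^sup>+k. \<integral>\<^sup>+x. a k x \<partial>M \<partial>count_space UNIV)"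
proof -
  have "(\<integral>\<^sup>+x. \<integral>\<^sup>+k. a k x \<partial>count_space UNIV \<partial>M) = (SUP N::nat. \<integral>\<^sup>+x. (\<Sum>k\<in>{- int N..int N}. a k x) \<partial>M)"
    unfolding nn_integral_count_space_int
    by (rule nn_integral_monotone_convergence_SUP)
       (auto simp: incseq_def le_fun_def intro!: sum_mono2)
  also have "\<dots> = (SUP N::nat. \<Sum>k\<in>{- int N..int N}. \<integral>\<^sup>+x. a k x \<partial>M)"
    by (subst nn_integral_sum) auto
  finally show ?thesis
    by (simp add: nn_integral_count_space_int)
qed

section \<open>From the measure dt/t to sequences over dyadic scales and back\<close>

lemma space_dt_over_t [simp]: "space dt_over_t = {0<..}"
  by (simp add: dt_over_t_def)

lemma sets_dt_over_t: "sets dt_over_t = sets (lebesgue_on {0<..})"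
  by (simp add: dt_over_t_def)

lemma sets_dt_over_tI: "A \<in> sets borel \<Longrightarrow> A \<subseteq> {0<..} \<Longrightarrow> A \<in> sets dt_over_t"
  unfolding sets_dt_over_t by (subst sets_restrict_space_iff) auto

lemma emeasure_dt_over_t:
  assumes "A \<in> sets borel" "A \<subseteq> {0<..}"
  shows "emeasure dt_over_t A = (\<integral>\<^sup>+t. ennreal (1 / t) * indicator A t \<partial>lborel)"
proof -
  have [measurable]: "A \<in> sets borel" by fact
  have m: "(\<lambda>t. ennreal (1 / t)) \<in> borel_measurable (lebesgue_on {0<..})"
    by (intro measurable_restrict_space1 measurable_completion) measurable
  have "emeasure dt_over_t A = (\<integral>\<^sup>+t. ennreal (1 / t) * indicator A t \<partial>lebesgue_on {0<..})"
    unfolding dt_over_t_def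
    using sets_dt_over_tI[OF assms] by (intro emeasure_density m) (simp add: sets_dt_over_t)
  also have "\<dots> = (\<integral>\<^sup>+t. ennreal (1 / t) * indicator A t * indicator {0<..} t \<partial>lebesgue)"
    by (subst nn_integral_restrict_space) auto
  also have "\<dots> = (\<integral>\<^sup>+t. ennreal (1 / t) * indicator A t \<partial>lborel)"
    unfolding nn_integral_completion
    using assms by (intro nn_integral_cong) (auto simp: indicator_def)
  finally show ?thesis .
qed

lemma emeasure_dt_over_t_interval:
  assumes "0 < a" "a \<le> b"
  shows "ennreal ((b - a) / b) \<le> emeasure dt_over_t {a..b}"
    and "emeasure dt_over_t {a<..b} \<le> ennreal ((b - a) / a)"
proof -
  have "ennreal ((b - a) / b) = (\<integral>\<^sup>+t. ennreal (1 / b) * indicator {a..b} t \<partial>lborel)"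
    using assms by (simp add: nn_integral_cmult_indicator ennreal_mult'[symmetric])
  also have "\<dots> \<le> (\<integral>\<^sup>+t. ennreal (1 / t) * indicator {a..b} t \<partial>lborel)"
    using assms by (intro nn_integral_mono) (auto simp: indicator_def frac_le intro!: ennreal_leI)
  also have "\<dots> = emeasure dt_over_t {a..b}"
    using assms by (intro emeasure_dt_over_t[symmetric]) auto
  finally show "ennreal ((b - a) / b) \<le> emeasure dt_over_t {a..b}" .
  have "emeasure dt_over_t {a<..b} = (\<integral>\<^sup>+t. ennreal (1 / t) * indicator {a<..b} t \<partial>lborel)"
    using assms by (intro emeasure_dt_over_t) auto
  also have "\<dots> \<le> (\<integral>\<^sup>+t. ennreal (1 / a) * indicator {a<..b} t \<partial>lborel)"
    using assms by (intro nn_integral_mono) (auto simp: indicator_def frac_le intro!: ennreal_leI)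
  also have "\<dots> = ennreal ((b - a) / a)"
    using assms by (simp add: nn_integral_cmult_indicator ennreal_mult'[symmetric])
  finally show "emeasure dt_over_t {a<..b} \<le> ennreal ((b - a) / a)" .
qed

lemma ex_dyadic_interval:
  fixes t :: real
  assumes "0 < t"
  shows "\<exists>k. t \<in> {2 powi k / 2<..2 powi k}"
proof -
  define k where "k = \<lceil>log 2 t\<rceil>"
  have p: "(2::real) powi j = 2 powr real_of_int j" for j
    by (simp add: powr_real_of_int')
  have "2 powr log 2 t \<le> 2 powr real_of_int k"
    unfolding k_def by (intro powr_mono) (auto intro: le_of_int_ceiling)
  moreover have "2 powr (real_of_int k - 1) < 2 powr log 2 t"
    unfolding k_def by (intro powr_less_mono) linarith+
  ultimately show ?thesis
    using assms by (intro exI[of _ k]) (auto simp: p powr_diff)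
qed

text \<open>Every interval (2^(k-1), 2^k] has measure at most 1 for dt/t (in fact ln 2), so
  replacing h by a constant bound on it costs no constant.\<close>

lemma Lp_qnorm_dt_le_lq:
  assumes "0 < q" and h: "h \<in> borel_measurable dt_over_t"
    and le: "\<And>k t. t \<in> {2 powi k / 2<..2 powi k} \<Longrightarrow> h t \<le> u k"
  shows "Lp_qnorm dt_over_t q h \<le> lq q u"
proof (cases "q = \<infinity>")
  case True
  have "AE t in dt_over_t. h t \<le> (SUP k. u k)"
  proof (rule AE_I2)
    fix t assume "t \<in> space dt_over_t"
    then obtain k where "t \<in> {2 powi k / 2<..2 powi k}"
      using ex_dyadic_interval[of t] by auto
    then show "h t \<le> (SUP k. u k)"
      using le by (intro SUP_upper2[of k]) auto
  qed
  then show ?thesis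
    using True h by (auto simp: Lp_qnorm_def lq_def intro!: esssup_I)
next
  case False
  define e where "e = enn2real q"
  have e: "0 < e" using assms False by (simp add: enn2real_pos e_def)
  define J where "J k = {(2::real) powi k / 2<..2 powi k}" for k
  have J_pos: "J k \<subseteq> {0<..}" for k
  proof
    fix t assume "t \<in> J k"
    moreover have "(0::real) < 2 powi k" by simp
    ultimately show "t \<in> {0<..}" unfolding J_def by (auto intro: less_trans[of 0 "2 powi k / 2"])
  qed
  have [measurable]: "J k \<in> sets dt_over_t" for k
    by (rule sets_dt_over_tI[OF _ J_pos]) (simp add: J_def)
  have "(\<integral>\<^sup>+t. enn_powr (h t) e \<partial>dt_over_t) \<le>
      (\<integral>\<^sup>+t. \<integral>\<^sup>+k. enn_powr (u k) e * indicator (J k) t \<partial>count_space UNIV \<partial>dt_over_t)"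
  proof (rule nn_integral_mono)
    fix t assume "t \<in> space dt_over_t"
    then obtain k where k: "t \<in> J k"
      using ex_dyadic_interval[of t] by (auto simp: J_def)
    then have "enn_powr (h t) e \<le> enn_powr (u k) e * indicator (J k) t"
      using le[of t k] e by (auto simp: J_def intro!: enn_powr_mono)
    also have "\<dots> \<le> (\<integral>\<^sup>+k. enn_powr (u k) e * indicator (J k) t \<partial>count_space UNIV)"
      by (rule nn_integral_ge_point) simp
    finally show "enn_powr (h t) e \<le> \<dots>" .
  qed
  also have "\<dots> = (\<integral>\<^sup>+k. \<integral>\<^sup>+t. enn_powr (u k) e * indicator (J k) t \<partial>dt_over_t \<partial>count_space UNIV)"
    by (rule nn_integral_count_space_swap) measurable
  also have "\<dots> \<le> (\<integral>\<^sup>+k. enn_powr (u k) e \<partial>count_space UNIV)"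
  proof (rule nn_integral_mono)
    fix k
    have "emeasure dt_over_t (J k) \<le> ennreal ((2 powi k - 2 powi k / 2) / (2 powi k / 2))"
      unfolding J_def by (rule emeasure_dt_over_t_interval) simp_all
    also have "\<dots> = 1" by (simp add: field_simps)
    finally have "enn_powr (u k) e * emeasure dt_over_t (J k) \<le> enn_powr (u k) e * 1"
      by (intro mult_left_mono) auto
    then show "(\<integral>\<^sup>+t. enn_powr (u k) e * indicator (J k) t \<partial>dt_over_t) \<le> enn_powr (u k) e"
      by (simp add: nn_integral_cmult_indicator)
  qed
  finally show ?thesis
    using False e by (auto simp: Lp_qnorm_def lq_def e_def intro!: enn_powr_mono)
qed

text \<open>Each \<open>u k\<close> is a lower bound for h on its own set of scales, and these sets
  are disjoint with measure at least \<delta> for dt/t. For q = \<infinity> positivity of that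
  measure is what makes \<open>u k\<close> visible to the essential supremum; the exponent of
  \<delta> is then 0.\<close>

lemma lq_le_Lp_qnorm_dt:
  assumes "0 < q" "0 < \<delta>" and a: "\<And>k::int. 0 < a k" "\<And>k. a k \<le> b k"
    and disj: "disjoint_family (\<lambda>k. {a k..b k})"
    and \<delta>: "\<And>k. \<delta> \<le> (b k - a k) / b k"
    and le: "\<And>k t. t \<in> {a k..b k} \<Longrightarrow> u k \<le> h t"
  shows "lq q u \<le> ennreal (\<delta> powr (- 1 / enn2real q)) * Lp_qnorm dt_over_t q h"
proof -
  have J_pos: "{a k..b k} \<subseteq> {0<..}" for k
    using a(1)[of k] by auto
  have [measurable]: "{a k..b k} \<in> sets dt_over_t" for k
    by (rule sets_dt_over_tI[OF _ J_pos]) simp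
  have meas: "ennreal \<delta> \<le> emeasure dt_over_t {a k..b k}" for k
    using emeasure_dt_over_t_interval(1)[OF a(1,2), of k] ennreal_leI[OF \<delta>[of k]] by (rule order_trans[rotated])
  show ?thesis
  proof (cases "q = \<infinity>")
    case True
    have "u k \<le> esssup dt_over_t h" for k
    proof (rule ccontr)
      assume neg: "\<not> u k \<le> esssup dt_over_t h"
      have "AE t in dt_over_t. h t \<le> esssup dt_over_t h" by (rule esssup_AE)
      then have "AE t in dt_over_t. t \<notin> {a k..b k}"
        by eventually_elim (use neg le[of _ k] in \<open>blast intro: order_trans\<close>)
      then have "emeasure dt_over_t {a k..b k} = 0"
        by (subst (asm) AE_iff_measurable[where N="{a k..b k}"]) (use J_pos[of k] in auto)
      then show False
        using meas[of k] \<open>0 < \<delta>\<close> by simp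
    qed
    then show ?thesis
      using True \<open>0 < \<delta>\<close> by (auto simp: Lp_qnorm_def lq_def intro!: SUP_least)
  next
    case False
    define e where "e = enn2real q"
    have e: "0 < e" using assms False by (simp add: enn2real_pos e_def)
    have "ennreal \<delta> * (\<integral>\<^sup>+k. enn_powr (u k) e \<partial>count_space UNIV) =
        (\<integral>\<^sup>+k. ennreal \<delta> * enn_powr (u k) e \<partial>count_space UNIV)"
      by (simp add: nn_integral_cmult)
    also have "\<dots> \<le> (\<integral>\<^sup>+k. \<integral>\<^sup>+t. enn_powr (u k) e * indicator {a k..b k} t \<partial>dt_over_t \<partial>count_space UNIV)"
    proof (rule nn_integral_mono)
      fix k
      have "ennreal \<delta> * enn_powr (u k) e \<le> enn_powr (u k) e * emeasure dt_over_t {a k..b k}"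
        by (subst mult.commute) (intro mult_left_mono meas, simp)
      then show "ennreal \<delta> * enn_powr (u k) e \<le>
          (\<integral>\<^sup>+t. enn_powr (u k) e * indicator {a k..b k} t \<partial>dt_over_t)"
        by (simp add: nn_integral_cmult_indicator)
    qed
    also have "\<dots> = (\<integral>\<^sup>+t. \<integral>\<^sup>+k. enn_powr (u k) e * indicator {a k..b k} t \<partial>count_space UNIV \<partial>dt_over_t)"
      by (rule nn_integral_count_space_swap[symmetric]) measurable
    also have "\<dots> \<le> (\<integral>\<^sup>+t. enn_powr (h t) e \<partial>dt_over_t)"
    proof (rule nn_integral_mono)
      fix t
      show "(\<integral>\<^sup>+k. enn_powr (u k) e * indicator {a k..b k} t \<partial>count_space UNIV) \<le> enn_powr (h t) e"
      proof (cases "\<exists>k. t \<in> {a k..b k}")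
        case True
        then obtain k where k: "t \<in> {a k..b k}" by blast
        have "indicator {a j..b j} t = (indicator {k} j :: ennreal)" for j
        proof (cases "j = k")
          case False
          then have "{a j..b j} \<inter> {a k..b k} = {}"
            using disj unfolding disjoint_family_on_def by blast
          then have "t \<notin> {a j..b j}" using k by blast
          then show ?thesis using False by simp
        qed (use k in simp)
        then have "(\<integral>\<^sup>+k. enn_powr (u k) e * indicator {a k..b k} t \<partial>count_space UNIV) =
            (\<integral>\<^sup>+j. enn_powr (u j) e * indicator {k} j \<partial>count_space UNIV)"
          by simp
        also have "\<dots> = enn_powr (u k) e"
          by (simp add: nn_integral_count_space_indicator[symmetric] nn_integral_count_space_finite)
        also have "\<dots> \<le> enn_powr (h t) e"
          using le[OF k] e by (intro enn_powr_mono) auto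
        finally show ?thesis .
      next
        case False
        then have "indicator {a k..b k} t = (0 :: ennreal)" for k
          by (simp add: indicator_def)
        then show ?thesis by simp
      qed
    qed
    finally have *: "ennreal \<delta> * (\<integral>\<^sup>+k. enn_powr (u k) e \<partial>count_space UNIV) \<le>
        (\<integral>\<^sup>+t. enn_powr (h t) e \<partial>dt_over_t)" .
    have "(\<integral>\<^sup>+k. enn_powr (u k) e \<partial>count_space UNIV) \<le>
        ennreal (1 / \<delta>) * (\<integral>\<^sup>+t. enn_powr (h t) e \<partial>dt_over_t)"
      using mult_left_mono[OF *, of "ennreal (1 / \<delta>)"] \<open>0 < \<delta>\<close>
      by (simp add: mult.assoc[symmetric] ennreal_mult'[symmetric])
    then have "lq q u \<le> enn_powr (ennreal (1 / \<delta>) * (\<integral>\<^sup>+t. enn_powr (h t) e \<partial>dt_over_t)) (1 / e)"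
      using False e by (auto simp: lq_def e_def intro!: enn_powr_mono)
    also have "\<dots> = ennreal (\<delta> powr (- 1 / enn2real q)) * Lp_qnorm dt_over_t q h"
      using False e \<open>0 < \<delta>\<close>
      by (simp add: Lp_qnorm_def e_def enn_powr_mult enn_powr_ennreal powr_divide powr_minus_divide)
    finally show ?thesis .
  qed
qed

section \<open>The dyadic quasi-norm\<close>

text \<open>Cutting g off to E and integrating over the whole space allows different regions to be
  compared under one measure.\<close>

definition loc_norm :: "ennreal \<Rightarrow> (real \<times> (real ^ 'n) \<Rightarrow> ennreal) \<Rightarrow> (real \<times> (real ^ 'n)) set \<Rightarrow> ennreal" where
  "loc_norm r g E = Lp_qnorm lborel r (\<lambda>w. g w * indicator E w)"

definition dy_cube :: "int \<Rightarrow> int ^ 'n \<Rightarrow> (real ^ 'n) set" where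
  "dy_cube k z = {x. dy_index k x = z}"

lemma dy_cube_sets [measurable]: "dy_cube k z \<in> sets borel"
proof -
  have "dy_index k -` {z} \<inter> space borel \<in> sets borel"
    by (rule measurable_sets[OF measurable_dy_index]) simp
  then show ?thesis by (simp add: dy_cube_def vimage_def)
qed

lemma dy_index_eq_iff:
  "dy_index k x = z \<longleftrightarrow> (\<forall>i. 2 powi k * real_of_int (z $ i) \<le> x $ i \<and> x $ i < 2 powi k * (real_of_int (z $ i) + 1))"
  by (simp add: dy_index_def vec_eq_iff floor_eq_iff field_simps)

lemma dyadic_cubes_at_eq: "dyadic_cubes_at k = range (dy_cube k)"
proof -
  have *: "(\<lambda>z. (2 powi k) *\<^sub>R (\<chi> i. real_of_int (m $ i)) + z) ` {z. \<forall>i. 0 \<le> z $ i \<and> z $ i < 2 powi k}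
      = dy_cube k m" for m :: "int ^ 'n"
  proof (intro subset_antisym subsetI)
    fix x assume "x \<in> dy_cube k m"
    then show "x \<in> (\<lambda>z. (2 powi k) *\<^sub>R (\<chi> i. real_of_int (m $ i)) + z) `
        {z. \<forall>i. 0 \<le> z $ i \<and> z $ i < 2 powi k}"
      by (intro image_eqI[of _ _ "x - (2 powi k) *\<^sub>R (\<chi> i. real_of_int (m $ i))"])
         (auto simp: dy_cube_def dy_index_eq_iff algebra_simps)
  qed (auto simp: dy_cube_def dy_index_eq_iff algebra_simps)
  have "\<exists>m :: int ^ 'n. x = (\<chi> i. real_of_int (m $ i))" if "\<forall>i. x $ i \<in> \<int>" for x :: "real ^ 'n"
    using that by (intro exI[of _ "\<chi> i. \<lfloor>x $ i\<rfloor>"]) (simp add: vec_eq_iff of_int_floor)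
  then have "dyadic_cubes_at k = range (\<lambda>m :: int ^ 'n.
      (\<lambda>z. (2 powi k) *\<^sub>R (\<chi> i. real_of_int (m $ i)) + z) ` {z. \<forall>i. 0 \<le> z $ i \<and> z $ i < 2 powi k})"
    unfolding dyadic_cubes_at_def by (auto; force)
  then show ?thesis
    by (simp only: *)
qed

lemma side_length_dy_cube: "side_length (dy_cube k z) = 2 powi k"
  by (rule side_length_dyadic_cube) (simp add: dyadic_cubes_at_eq)

text \<open>The half-open cube lies between the open and the closed box with the same corners, which
  have equal volume.\<close>

lemma measure_dy_cube: "measure lebesgue (dy_cube k (z :: int ^ 'n)) = (2 powi k) ^ CARD('n)"
proof -
  define a b :: "real ^ 'n" where "a = (\<chi> i. 2 powi k * real_of_int (z $ i))"
    and "b = (\<chi> i. 2 powi k * (real_of_int (z $ i) + 1))"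
  have sub: "box a b \<subseteq> dy_cube k z" "dy_cube k z \<subseteq> cbox a b"
    by (auto simp: dy_cube_def dy_index_eq_iff a_def b_def mem_box_cart less_imp_le)
  have le: "\<And>i. i \<in> Basis \<Longrightarrow> a \<bullet> i \<le> b \<bullet> i"
    by (auto simp: Basis_vec_def inner_axis a_def b_def)
  have "emeasure lborel (box a b) \<le> emeasure lborel (dy_cube k z)"
    "emeasure lborel (dy_cube k z) \<le> emeasure lborel (cbox a b)"
    using sub by (auto intro!: emeasure_mono)
  then have "emeasure lborel (dy_cube k z) = emeasure lborel (cbox a b)"
    using le by (auto simp: emeasure_lborel_box_eq emeasure_lborel_cbox_eq)
  then have "measure lborel (dy_cube k z) = measure lborel (cbox a b)"
    by (simp add: measure_def)
  also have "\<dots> = (\<Prod>i\<in>UNIV. b $ i - a $ i)"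
    by (rule content_cbox_cart) (simp add: interval_ne_empty_cart a_def b_def)
  also have "\<dots> = (2 powi k) ^ CARD('n)"
    by (simp add: a_def b_def algebra_simps)
  finally show ?thesis
    by (subst measure_completion) auto
qed

lemma measure_dy_cube_powr:
  "measure lebesgue (dy_cube k (z :: int ^ 'n)) powr (- (\<beta> * c) / CARD('n)) = (2 powi k) powr (- \<beta> * c)"
proof -
  have "measure lebesgue (dy_cube k z) = (2 powi k) powr real CARD('n)"
    unfolding measure_dy_cube by (rule powr_realpow[symmetric]) simp
  then show ?thesis by (simp add: powr_powr)
qed

lemma infsum_eq_nn_integral_count_space:
  fixes a :: "int \<Rightarrow> ennreal"
  shows "(\<Sum>\<^sub>\<infinity>k. a k) = (\<integral>\<^sup>+k. a k \<partial>count_space UNIV)"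
proof -
  have "(\<Sum>\<^sub>\<infinity>k. a k) = (SUP F\<in>{F. finite F \<and> F \<subseteq> UNIV}. sum a F)"
    by (rule nonneg_infsum_complete) simp
  also have "\<dots> = (SUP N::nat. \<Sum>k\<in>{- int N..int N}. a k)"
  proof (rule antisym)
    show "(SUP F\<in>{F. finite F \<and> F \<subseteq> UNIV}. sum a F) \<le> (SUP N::nat. \<Sum>k\<in>{- int N..int N}. a k)"
    proof (rule SUP_least)
      fix F :: "int set" assume "F \<in> {F. finite F \<and> F \<subseteq> UNIV}"
      then have F: "finite F" by simp
      define N where "N = nat (\<Sum>k\<in>F. \<bar>k\<bar>)"
      have "\<bar>k\<bar> \<le> int N" if "k \<in> F" for k
        using member_le_sum[OF that, of abs] F by (simp add: N_def sum_nonneg)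
      then have "F \<subseteq> {- int N..int N}" by (force simp: abs_le_iff)
      then show "sum a F \<le> (SUP N::nat. \<Sum>k\<in>{- int N..int N}. a k)"
        by (intro SUP_upper2[of N] sum_mono2) auto
    qed
  qed (auto intro!: SUP_least SUP_upper)
  finally show ?thesis by (simp add: nn_integral_count_space_int)
qed

definition dy_term :: "real \<Rightarrow> ennreal \<Rightarrow> (real \<times> (real ^ 'n) \<Rightarrow> complex) \<Rightarrow> int \<Rightarrow> real ^ 'n \<Rightarrow> ennreal" where
  "dy_term \<beta> r f k x = ennreal ((2 powi k) powr (- \<beta>)) *
     Lp_qnorm (whitney_box_measure (dy_cube k (dy_index k x))) r (\<lambda>w. ennreal (norm (f w)))"

text \<open>At each x exactly one cube of every level contributes, and cubes of different levels are
  different sets because \<open>side_length\<close> separates them; so the sum over all cubes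
  becomes a sum over k.\<close>

lemma dyadic_norm_eq:
  fixes f :: "real \<times> (real ^ 'n) \<Rightarrow> complex"
  assumes "0 < q"
  shows "dyadic_norm p q r \<beta> f = Lp_qnorm lebesgue (ennreal p) (\<lambda>x. lq q (\<lambda>k. dy_term \<beta> r f k x))"
proof -
  define L where "L Q = Lp_qnorm (whitney_box_measure Q) r (\<lambda>w. ennreal (norm (f w)))" for Q
  have cubes: "(dyadic_cubes :: (real ^ 'n) set set) = (\<Union>k. range (dy_cube k))"
    by (simp add: dyadic_cubes_def dyadic_cubes_at_eq)
  have inj: "inj (\<lambda>k. dy_cube k (dy_index k x))" for x :: "real ^ 'n"
  proof (rule injI)
    fix j k assume "dy_cube j (dy_index j x) = dy_cube k (dy_index k x)"
    then have "(2::real) powi j = 2 powi k"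
      by (metis side_length_dy_cube)
    then show "j = k"
      using power_int_strict_increasing[of j k "2::real"] power_int_strict_increasing[of k j "2::real"]
      by (cases j k rule: linorder_cases) auto
  qed
  have self: "x \<in> dy_cube k (dy_index k x)" for k and x :: "real ^ 'n"
    by (simp add: dy_cube_def)
  have other: "x \<notin> Q" if "Q \<in> dyadic_cubes - range (\<lambda>k. dy_cube k (dy_index k x))" for Q and x :: "real ^ 'n"
    using that by (auto simp: cubes dy_cube_def)
  have sup: "(SUP Q\<in>dyadic_cubes. indicator Q x * ennreal (measure lebesgue Q powr (- \<beta> / CARD('n))) * L Q) =
      (SUP k. dy_term \<beta> r f k x)" for x
  proof (rule antisym)
    show "(SUP Q\<in>dyadic_cubes. indicator Q x * ennreal (measure lebesgue Q powr (- \<beta> / CARD('n))) * L Q) \<le>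
        (SUP k. dy_term \<beta> r f k x)"
    proof (rule SUP_least)
      fix Q :: "(real ^ 'n) set" assume Q: "Q \<in> dyadic_cubes"
      show "indicator Q x * ennreal (measure lebesgue Q powr (- \<beta> / CARD('n))) * L Q \<le> (SUP k. dy_term \<beta> r f k x)"
      proof (cases "x \<in> Q")
        case True
        then obtain k where "Q = dy_cube k (dy_index k x)" using other Q by blast
        then show ?thesis
          using measure_dy_cube_powr[of k "dy_index k x" \<beta> 1] self[of x k]
          by (intro SUP_upper2[of k]) (auto simp: dy_term_def L_def)
      qed simp
    qed
    show "(SUP k. dy_term \<beta> r f k x) \<le>
        (SUP Q\<in>dyadic_cubes. indicator Q x * ennreal (measure lebesgue Q powr (- \<beta> / CARD('n))) * L Q)"
    proof (rule SUP_least)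
      fix k
      show "dy_term \<beta> r f k x \<le>
          (SUP Q\<in>dyadic_cubes. indicator Q x * ennreal (measure lebesgue Q powr (- \<beta> / CARD('n))) * L Q)"
        using measure_dy_cube_powr[of k "dy_index k x" \<beta> 1] self[of x k]
        by (intro SUP_upper2[of "dy_cube k (dy_index k x)"]) (auto simp: dy_term_def L_def cubes)
    qed
  qed
  have sum: "(\<Sum>\<^sub>\<infinity>Q\<in>dyadic_cubes. indicator Q x * ennreal (measure lebesgue Q powr (- (\<beta> * e) / CARD('n))) *
        enn_powr (L Q) e) = (\<integral>\<^sup>+k. enn_powr (dy_term \<beta> r f k x) e \<partial>count_space UNIV)" if e: "0 < e" for e x
  proof -
    have "(\<Sum>\<^sub>\<infinity>Q\<in>dyadic_cubes. indicator Q x * ennreal (measure lebesgue Q powr (- (\<beta> * e) / CARD('n))) *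
        enn_powr (L Q) e) =
        (\<Sum>\<^sub>\<infinity>Q\<in>range (\<lambda>k. dy_cube k (dy_index k x)).
          indicator Q x * ennreal (measure lebesgue Q powr (- (\<beta> * e) / CARD('n))) * enn_powr (L Q) e)"
    proof (rule infsum_cong_neutral)
      have "range (\<lambda>k. dy_cube k (dy_index k x)) \<subseteq> dyadic_cubes" by (auto simp: cubes)
      then show "indicator Q x * ennreal (measure lebesgue Q powr (- (\<beta> * e) / CARD('n))) * enn_powr (L Q) e = 0"
        if "Q \<in> range (\<lambda>k. dy_cube k (dy_index k x)) - dyadic_cubes" for Q
        using that by blast
    qed (use other in auto)
    also have "\<dots> = (\<Sum>\<^sub>\<infinity>k. enn_powr (dy_term \<beta> r f k x) e)"
      unfolding infsum_reindex[OF inj] comp_def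
    proof (rule infsum_cong)
      fix k
      show "indicator (dy_cube k (dy_index k x)) x *
          ennreal (measure lebesgue (dy_cube k (dy_index k x)) powr (- (\<beta> * e) / CARD('n))) *
          enn_powr (L (dy_cube k (dy_index k x))) e = enn_powr (dy_term \<beta> r f k x) e"
        unfolding measure_dy_cube_powr using self[of x k] e
        by (simp add: dy_term_def L_def enn_powr_mult enn_powr_ennreal powr_powr)
    qed
    finally show ?thesis by (simp add: infsum_eq_nn_integral_count_space)
  qed
  show ?thesis
    unfolding dyadic_norm_def lq_def L_def[symmetric]
    using sup sum enn2real_pos[OF assms] by (cases "q = \<infinity>") simp_all
qed

section \<open>Weighted norms on Whitney boxes as local quasi-norms of a Borel function\<close>

lemma fst_measurable_borel [measurable]: "(fst :: real \<times> (real ^ 'n) \<Rightarrow> real) \<in> borel \<rightarrow>\<^sub>M borel"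
  by (intro borel_measurable_continuous_onI continuous_intros)

lemma snd_measurable_borel [measurable]: "(snd :: real \<times> (real ^ 'n) \<Rightarrow> _) \<in> borel \<rightarrow>\<^sub>M borel"
  by (intro borel_measurable_continuous_onI continuous_intros)

lemma Times_sets_borel [measurable (raw)]:
  assumes "A \<in> sets borel" "B \<in> sets borel"
  shows "A \<times> B \<in> sets (borel :: (real \<times> (real ^ 'n)) measure)"
  unfolding borel_prod[symmetric] using assms by (rule pair_measureI)

lemma esssup_le_iff:
  fixes u :: "'a \<Rightarrow> ennreal"
  shows "u \<in> borel_measurable M \<Longrightarrow> esssup M u \<le> c \<longleftrightarrow> (AE x in M. u x \<le> c)"
  using esssup_AE[of u M] by (auto intro: esssup_I elim!: eventually_mono)

lemma borel_measurable_lebesgue_onI: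
  "u \<in> borel_measurable borel \<Longrightarrow> u \<in> borel_measurable (lebesgue_on E)"
  by (intro measurable_restrict_space1 measurable_completion) simp

text \<open>Both essential suprema have the same upper bounds c: outside E the function on the right
  is 0 and imposes no condition.\<close>

lemma esssup_lebesgue_on_eq:
  fixes u v :: "'a :: euclidean_space \<Rightarrow> ennreal"
  assumes u: "u \<in> borel_measurable (lebesgue_on E)" and [measurable]: "v \<in> borel_measurable borel" "E \<in> sets borel"
    and eq: "AE w in lborel. w \<in> E \<longrightarrow> u w = v w"
  shows "esssup (lebesgue_on E) u = esssup lborel (\<lambda>w. v w * indicator E w)"
proof -
  have "esssup (lebesgue_on E) u \<le> c \<longleftrightarrow> esssup lborel (\<lambda>w. v w * indicator E w) \<le> c" for c
  proof -
    have "esssup (lebesgue_on E) u \<le> c \<longleftrightarrow> (AE w in lborel. w \<in> E \<longrightarrow> u w \<le> c)"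
      using u by (simp add: esssup_le_iff AE_restrict_space_iff AE_completion_iff)
    also have "\<dots> \<longleftrightarrow> (AE w in lborel. v w * indicator E w \<le> c)"
      by (rule eventually_subst) (use eq in eventually_elim, auto simp: indicator_def)
    also have "\<dots> \<longleftrightarrow> esssup lborel (\<lambda>w. v w * indicator E w) \<le> c"
      by (subst esssup_le_iff) auto
    finally show ?thesis .
  qed
  then show ?thesis by (meson order.eq_iff order.refl)
qed

text \<open>On the box the height s lies in (l/2, l] with l = 2^k, so the weight s^(-d), d being the
  dimension of the half-space, stays between l^(-d) and 2^d l^(-d).\<close>

lemma whitney_box_norm_bounds:
  fixes f :: "real \<times> (real ^ 'n) \<Rightarrow> complex"
  assumes "0 < r" and f: "f \<in> borel_measurable (lebesgue_on upper_half_space)"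
    and [measurable]: "g \<in> borel_measurable borel"
    and fg: "AE w in lborel. 0 < fst w \<longrightarrow> ennreal (norm (f w)) = g w"
  defines "d \<equiv> real (CARD('n) + 1)"
  shows "ennreal ((2 powi k) powr (- d / enn2real r)) * loc_norm r g (whitney_box (dy_cube k z)) \<le>
      Lp_qnorm (whitney_box_measure (dy_cube k z)) r (\<lambda>w. ennreal (norm (f w)))" (is "?lower \<le> ?N")
    and "Lp_qnorm (whitney_box_measure (dy_cube k z)) r (\<lambda>w. ennreal (norm (f w))) \<le>
      ennreal (2 powr (d / enn2real r) * (2 powi k) powr (- d / enn2real r)) *
      loc_norm r g (whitney_box (dy_cube k z))" (is "_ \<le> ?upper")
proof -
  define l where "l = (2::real) powi k"
  define E where "E = whitney_box (dy_cube k z)"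
  have l: "0 < l" by (simp add: l_def)
  have E: "E = {l / 2<..l} \<times> dy_cube k z"
    by (simp add: E_def whitney_box_def side_length_dy_cube l_def)
  have [measurable]: "E \<in> sets borel" unfolding E by measurable
  have E_pos: "0 < fst w" if "w \<in> E" for w
    using that l by (auto simp: E intro: less_trans[of 0 "l / 2"])
  define \<phi> :: "real \<times> (real ^ 'n) \<Rightarrow> ennreal" where "\<phi> w = ennreal (1 / fst w ^ (CARD('n) + 1))" for w
  have \<phi>: "(\<lambda>(s, y). ennreal (1 / s ^ (CARD('n) + 1))) = \<phi>"
    by (auto simp: \<phi>_def)
  have \<phi>_meas[measurable]: "\<phi> \<in> borel_measurable borel"
    unfolding \<phi>_def by measurable
  have sub: "lebesgue_on E = restrict_space (lebesgue_on upper_half_space) E"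
    using E_pos by (subst restrict_restrict_space) (auto simp: upper_half_space_def intro!: arg_cong2[where f=restrict_space])
  have fm: "(\<lambda>w. ennreal (norm (f w))) \<in> borel_measurable (lebesgue_on E)"
    unfolding sub by (intro measurable_restrict_space1 measurable_compose[OF f]) measurable
  have \<phi>m: "\<phi> \<in> borel_measurable (lebesgue_on E)"
    by (rule borel_measurable_lebesgue_onI) measurable
  have fgE: "AE w in lborel. w \<in> E \<longrightarrow> ennreal (norm (f w)) = g w"
    using fg by eventually_elim (use E_pos in auto)
  have M: "whitney_box_measure (dy_cube k z) = density (lebesgue_on E) \<phi>"
    by (simp only: whitney_box_measure_def \<phi> E_def)
  have "?lower \<le> ?N \<and> ?N \<le> ?upper"
  proof (cases "r = \<infinity>")
    case True
    \<comment> \<open>A density that is positive on E has the same null sets, so the weight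
      disappears from the essential supremum.\<close>
    have "esssup (density (lebesgue_on E) \<phi>) (\<lambda>w. ennreal (norm (f w))) =
        esssup (lebesgue_on E) (\<lambda>w. ennreal (norm (f w)))"
    proof -
      have "esssup (density (lebesgue_on E) \<phi>) (\<lambda>w. ennreal (norm (f w))) \<le> c \<longleftrightarrow>
          esssup (lebesgue_on E) (\<lambda>w. ennreal (norm (f w))) \<le> c" for c
      proof -
        have "(AE w in lebesgue_on E. 0 < \<phi> w \<longrightarrow> ennreal (norm (f w)) \<le> c) \<longleftrightarrow>
            (AE w in lebesgue_on E. ennreal (norm (f w)) \<le> c)"
          using E_pos by (intro AE_cong) (simp add: \<phi>_def space_restrict_space)
        then show ?thesis
          using fm \<phi>m by (simp add: esssup_le_iff AE_density)
      qed
      then show ?thesis by (meson order.eq_iff order.refl)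
    qed
    also have "\<dots> = loc_norm r g E"
      using fm fgE True by (simp add: esssup_lebesgue_on_eq loc_norm_def Lp_qnorm_def)
    finally show ?thesis
      using True l by (simp add: Lp_qnorm_def M E_def l_def)
  next
    case False
    define e where "e = enn2real r"
    have e: "0 < e" using assms False by (simp add: enn2real_pos e_def)
    have "(\<integral>\<^sup>+w. enn_powr (ennreal (norm (f w))) e \<partial>density (lebesgue_on E) \<phi>) =
        (\<integral>\<^sup>+w. \<phi> w * enn_powr (ennreal (norm (f w))) e \<partial>lebesgue_on E)"
      by (intro nn_integral_density \<phi>m borel_measurable_enn_powr fm)
    also have "\<dots> = (\<integral>\<^sup>+w. \<phi> w * enn_powr (ennreal (norm (f w))) e * indicator E w \<partial>lebesgue)"
      by (subst nn_integral_restrict_space) auto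
    also have "\<dots> = (\<integral>\<^sup>+w. \<phi> w * enn_powr (g w * indicator E w) e \<partial>lborel)"
      unfolding nn_integral_completion
      by (rule nn_integral_cong_AE) (use fgE in eventually_elim, auto simp: indicator_def)
    finally have I: "(\<integral>\<^sup>+w. enn_powr (ennreal (norm (f w))) e \<partial>density (lebesgue_on E) \<phi>) =
        (\<integral>\<^sup>+w. \<phi> w * enn_powr (g w * indicator E w) e \<partial>lborel)" .
    have \<phi>_bounds: "ennreal (l powr (- d)) \<le> \<phi> w" "\<phi> w \<le> ennreal (2 powr d * l powr (- d))" if "w \<in> E" for w
    proof -
      have s: "l / 2 < fst w" "fst w \<le> l" "0 < fst w" using that E_pos by (auto simp: E)
      have "1 / fst w ^ (CARD('n) + 1) = fst w powr (- d)"
        unfolding powr_minus_divide d_def powr_realpow[OF s(3)] by simp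
      moreover have "l powr (- d) \<le> fst w powr (- d)"
        using s by (intro powr_mono2') (auto simp: d_def)
      moreover have "fst w powr (- d) \<le> (l / 2) powr (- d)"
        using s l by (intro powr_mono2') (auto simp: d_def)
      moreover have "(l / 2) powr (- d) = 2 powr d * l powr (- d)"
        using l by (simp add: powr_divide powr_minus_divide)
      ultimately show "ennreal (l powr (- d)) \<le> \<phi> w" "\<phi> w \<le> ennreal (2 powr d * l powr (- d))"
        by (auto simp: \<phi>_def intro!: ennreal_leI)
    qed
    have "ennreal (l powr (- d)) * (\<integral>\<^sup>+w. enn_powr (g w * indicator E w) e \<partial>lborel) =
        (\<integral>\<^sup>+w. ennreal (l powr (- d)) * enn_powr (g w * indicator E w) e \<partial>lborel)"
      by (rule nn_integral_cmult[symmetric]) measurable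
    also have "\<dots> \<le> (\<integral>\<^sup>+w. \<phi> w * enn_powr (g w * indicator E w) e \<partial>lborel)"
      using \<phi>_bounds(1) by (intro nn_integral_mono) (auto simp: indicator_def intro!: mult_right_mono)
    finally have "enn_powr (ennreal (l powr (- d)) * (\<integral>\<^sup>+w. enn_powr (g w * indicator E w) e \<partial>lborel)) (1 / e) \<le> ?N"
      unfolding I[symmetric] using False e by (simp add: Lp_qnorm_def M e_def enn_powr_mono)
    then have lower: "?lower \<le> ?N"
      using False e l by (simp add: loc_norm_def Lp_qnorm_def E_def e_def l_def enn_powr_mult enn_powr_ennreal powr_powr)
    have "(\<integral>\<^sup>+w. \<phi> w * enn_powr (g w * indicator E w) e \<partial>lborel) \<le>
        (\<integral>\<^sup>+w. ennreal (2 powr d * l powr (- d)) * enn_powr (g w * indicator E w) e \<partial>lborel)"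
      using \<phi>_bounds(2) by (intro nn_integral_mono) (auto simp: indicator_def intro!: mult_right_mono)
    also have "\<dots> = ennreal (2 powr d * l powr (- d)) * (\<integral>\<^sup>+w. enn_powr (g w * indicator E w) e \<partial>lborel)"
      by (rule nn_integral_cmult) measurable
    finally have "?N \<le> enn_powr (ennreal (2 powr d * l powr (- d)) *
        (\<integral>\<^sup>+w. enn_powr (g w * indicator E w) e \<partial>lborel)) (1 / e)"
      unfolding I[symmetric] using False e by (simp add: Lp_qnorm_def M e_def enn_powr_mono)
    then have "?N \<le> ?upper"
      using False e l by (simp add: loc_norm_def Lp_qnorm_def E_def e_def l_def enn_powr_mult enn_powr_ennreal
          powr_powr powr_mult)
    with lower show ?thesis by blast
  qed
  then show "?lower \<le> ?N" "?N \<le> ?upper" by auto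
qed

section \<open>Whitney means\<close>

text \<open>By Tonelli the nested means form one integral over the cylinder, normalised by its
  volume, which does not depend on x. For r = \<infinity> the prefactor has exponent 0 and equals
  1.\<close>

lemma whitney_mean_eq:
  fixes f :: "real \<times> (real ^ 'n) \<Rightarrow> complex"
  assumes "0 < r" and f: "f \<in> borel_measurable (lebesgue_on upper_half_space)"
    and [measurable]: "g \<in> borel_measurable borel"
    and fg: "AE w in lborel. 0 < fst w \<longrightarrow> ennreal (norm (f w)) = g w"
    and t: "0 < t"
  shows "whitney_mean r (\<lambda>(s, y). ennreal (norm ((s powr (- \<beta>)) *\<^sub>R f (s, y)))) t x =
    ennreal ((unit_ball_vol CARD('n) * t ^ CARD('n) * (t / 2)) powr (- 1 / enn2real r)) *
    loc_norm r (\<lambda>w. ennreal (fst w powr (- \<beta>)) * g w) ({t/2..t} \<times> ball x t)"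
proof -
  define h where "h w = ennreal (fst w powr (- \<beta>)) * g w" for w
  define u where "u w = ennreal (norm ((fst w powr (- \<beta>)) *\<^sub>R f w))" for w
  define E where "E = {t/2..t} \<times> ball x t"
  have u: "(\<lambda>(s, y). ennreal (norm ((s powr (- \<beta>)) *\<^sub>R f (s, y)))) = u"
    by (auto simp: u_def)
  have [measurable]: "h \<in> borel_measurable borel" "E \<in> sets borel"
    unfolding h_def[abs_def] E_def by measurable
  have uh: "AE w in lborel. 0 < fst w \<longrightarrow> u w = h w"
    using fg by eventually_elim (auto simp: u_def h_def ennreal_mult')
  have E_pos: "0 < fst w" if "w \<in> E" for w
    using that t by (auto simp: E_def)
  define V1 V2 where "V1 = unit_ball_vol CARD('n) * t ^ CARD('n)" and "V2 = t / 2"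
  have V: "0 < V1" "0 < V2"
    using t by (auto simp: V1_def V2_def)
  show ?thesis
  proof (cases "r = \<infinity>")
    case True
    have sub: "lebesgue_on E = restrict_space (lebesgue_on upper_half_space) E"
      using E_pos by (subst restrict_restrict_space) (auto simp: upper_half_space_def intro!: arg_cong2[where f=restrict_space])
    have fst_m: "(\<lambda>w. fst w powr (- \<beta>)) \<in> borel_measurable (lebesgue_on E)"
      by (intro measurable_restrict_space1 measurable_completion) measurable
    have "f \<in> borel_measurable (lebesgue_on E)"
      unfolding sub by (intro measurable_restrict_space1 f)
    then have "u \<in> borel_measurable (lebesgue_on E)"
      unfolding u_def[abs_def] using fst_m by measurable
    moreover have "AE w in lborel. w \<in> E \<longrightarrow> u w = h w"
      using uh by eventually_elim (use E_pos in auto)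
    ultimately have "esssup (lebesgue_on E) u = esssup lborel (\<lambda>w. h w * indicator E w)"
      by (intro esssup_lebesgue_on_eq) auto
    \<comment> \<open>The base of the prefactor must be nonzero because \<open>0 powr 0\<close> is
      0.\<close>
    moreover have "unit_ball_vol (real CARD('n)) \<noteq> 0"
      using unit_ball_vol_pos[of "real CARD('n)"] by (metis less_irrefl of_nat_0_le_iff)
    ultimately show ?thesis
      unfolding u using True t
      by (simp add: whitney_mean_def loc_norm_def Lp_qnorm_def E_def h_def V1_def V2_def)
  next
    case False
    define e where "e = enn2real r"
    have e: "0 < e" using assms False by (simp add: enn2real_pos e_def)
    have B: "emeasure lebesgue (ball x t) = ennreal V1" "emeasure lebesgue {t/2..t} = ennreal V2"
      using t by (simp_all add: emeasure_ball V1_def V2_def)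
    \<comment> \<open>The nested means see the function only through its slices, so the equality
      almost everywhere is passed to almost every slice.\<close>
    have uh': "AE s in lborel. AE y in lborel. 0 < s \<longrightarrow> u (s, y) = h (s, y)"
      using lborel_pair.AE_pair[of "\<lambda>w. 0 < fst w \<longrightarrow> u w = h w"] uh
      unfolding lborel_prod fst_conv by blast
    have inner: "AE s in lborel. s \<in> {t/2..t} \<longrightarrow>
        mean_nn_integral (ball x t) (\<lambda>y. enn_powr (u (s, y)) e) =
        (\<integral>\<^sup>+y. enn_powr (h (s, y)) e * indicator (ball x t) y \<partial>lborel) / ennreal V1"
      using uh'
    proof eventually_elim
      fix s assume AE: "AE y in lborel. 0 < s \<longrightarrow> u (s, y) = h (s, y)"
      show "s \<in> {t/2..t} \<longrightarrow> mean_nn_integral (ball x t) (\<lambda>y. enn_powr (u (s, y)) e) =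
          (\<integral>\<^sup>+y. enn_powr (h (s, y)) e * indicator (ball x t) y \<partial>lborel) / ennreal V1"
      proof
        assume "s \<in> {t/2..t}"
        then have "0 < s" using t by auto
        show "mean_nn_integral (ball x t) (\<lambda>y. enn_powr (u (s, y)) e) =
          (\<integral>\<^sup>+y. enn_powr (h (s, y)) e * indicator (ball x t) y \<partial>lborel) / ennreal V1"
          unfolding mean_nn_integral_def B nn_integral_completion
          by (intro arg_cong2[where f="(/)"] refl nn_integral_cong_AE)
             (use AE in eventually_elim, use \<open>0 < s\<close> in simp)
      qed
    qed
    have "(\<integral>\<^sup>+s\<in>{t/2..t}. mean_nn_integral (ball x t) (\<lambda>y. enn_powr (u (s, y)) e) \<partial>lebesgue) =
        (\<integral>\<^sup>+s. ((\<integral>\<^sup>+y. enn_powr (h (s, y)) e * indicator (ball x t) y \<partial>lborel) / ennreal V1) *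
          indicator {t/2..t} s \<partial>lborel)"
      unfolding nn_integral_completion
      by (rule nn_integral_cong_AE) (use inner in eventually_elim, auto simp: indicator_def)
    also have "\<dots> = (\<integral>\<^sup>+s. (\<integral>\<^sup>+y. enn_powr (h (s, y) * indicator E (s, y)) e \<partial>lborel) / ennreal V1 \<partial>lborel)"
    proof (rule nn_integral_cong)
      fix s
      show "((\<integral>\<^sup>+y. enn_powr (h (s, y)) e * indicator (ball x t) y \<partial>lborel) / ennreal V1) *
          indicator {t/2..t} s = (\<integral>\<^sup>+y. enn_powr (h (s, y) * indicator E (s, y)) e \<partial>lborel) / ennreal V1"
      proof (cases "s \<in> {t/2..t}")
        case True
        then have "enn_powr (h (s, y)) e * indicator (ball x t) y = enn_powr (h (s, y) * indicator E (s, y)) e" for y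
          by (simp add: E_def indicator_def)
        then show ?thesis using True by simp
      next
        case False
        then have "indicator E (s, y) = (0 :: ennreal)" for y
          by (auto simp: E_def indicator_def)
        then show ?thesis using False by simp
      qed
    qed
    also have "\<dots> = (\<integral>\<^sup>+s. (\<integral>\<^sup>+y. enn_powr (h (s, y) * indicator E (s, y)) e \<partial>lborel) \<partial>lborel) / ennreal V1"
    proof (rule nn_integral_divide)
      have "(\<lambda>w. enn_powr (h w * indicator E w) e) \<in> borel_measurable (lborel \<Otimes>\<^sub>M lborel)"
        unfolding lborel_prod by measurable
      then show "(\<lambda>s. \<integral>\<^sup>+y. enn_powr (h (s, y) * indicator E (s, y)) e \<partial>lborel) \<in> borel_measurable lborel"
        by (rule lborel.borel_measurable_nn_integral_fst)
    qed
    also have "(\<integral>\<^sup>+s. (\<integral>\<^sup>+y. enn_powr (h (s, y) * indicator E (s, y)) e \<partial>lborel) \<partial>lborel) =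
        (\<integral>\<^sup>+w. enn_powr (h w * indicator E w) e \<partial>(lborel \<Otimes>\<^sub>M lborel))"
      by (rule lborel.nn_integral_fst) (unfold lborel_prod, measurable)
    also have "\<dots> = (\<integral>\<^sup>+w. enn_powr (h w * indicator E w) e \<partial>lborel)"
      by (simp only: lborel_prod)
    finally have "whitney_mean r u t x =
        enn_powr ((\<integral>\<^sup>+w. enn_powr (h w * indicator E w) e \<partial>lborel) / ennreal V1 / ennreal V2) (1 / e)"
      using False B by (simp add: whitney_mean_def mean_nn_integral_def[of "{t/2..t}"] e_def)
    also have "(\<integral>\<^sup>+w. enn_powr (h w * indicator E w) e \<partial>lborel) / ennreal V1 / ennreal V2 =
        ennreal (1 / (V1 * V2)) * (\<integral>\<^sup>+w. enn_powr (h w * indicator E w) e \<partial>lborel)"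
    proof -
      have "ennreal (1 / (V1 * V2)) = ennreal (1 / V1) * ennreal (1 / V2)"
        using V by (simp add: ennreal_mult'[symmetric])
      then show ?thesis
        using V by (simp add: divide_ennreal_def inverse_ennreal mult_ac divide_inverse)
    qed
    also have "enn_powr \<dots> (1 / e) = ennreal ((V1 * V2) powr (- 1 / e)) * loc_norm r h E"
      using False e V
      by (simp add: loc_norm_def Lp_qnorm_def e_def enn_powr_mult enn_powr_ennreal powr_divide powr_minus_divide)
    finally show ?thesis
      unfolding u by (simp add: h_def[abs_def] E_def V1_def V2_def e_def)
  qed
qed

lemma loc_norm_le:
  assumes "0 < r" and [measurable]: "u \<in> borel_measurable borel" "v \<in> borel_measurable borel"
    "E \<in> sets borel" "E' \<in> sets borel"
    and "E \<subseteq> E'" and le: "\<And>w. w \<in> E \<Longrightarrow> u w \<le> c * v w"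
  shows "loc_norm r u E \<le> c * loc_norm r v E'"
  unfolding loc_norm_def
proof (rule Lp_qnorm_le_cmult[OF assms(1)])
  show "AE w in lborel. u w * indicator E w \<le> c * (v w * indicator E' w)"
    using le \<open>E \<subseteq> E'\<close> by (intro AE_I2) (auto simp: indicator_def)
qed measurable

lemma powr_between:
  fixes a u :: real
  assumes "1 / 4 \<le> u" "u \<le> 4"
  shows "4 powr (- \<bar>a\<bar>) \<le> u powr a" "u powr a \<le> 4 powr \<bar>a\<bar>"
proof -
  have u: "0 < u" using assms by auto
  have "ln (1 / 4) \<le> ln u" "ln u \<le> ln 4"
    using assms u by (subst ln_le_cancel_iff; simp)+
  then have "\<bar>ln u\<bar> \<le> ln 4" by (simp add: ln_div)
  then have "\<bar>a * ln u\<bar> \<le> \<bar>a\<bar> * ln 4"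
    unfolding abs_mult by (intro mult_left_mono) auto
  then show "4 powr (- \<bar>a\<bar>) \<le> u powr a" "u powr a \<le> 4 powr \<bar>a\<bar>"
    using u by (simp_all add: powr_def abs_le_iff)
qed

text \<open>With l = 2^k, both t/l and s/l lie in [1/4, 4] on the region, so by
  \<open>powr_between\<close> the factor s^(-\<beta>) and the volume normalisation can be replaced
  by powers of l, whose exponents add up to \<gamma>.\<close>

lemma whitney_mean_bounds:
  fixes r :: ennreal and \<beta> :: real
  assumes "0 < r"
  defines "\<gamma> \<equiv> - \<beta> - real (CARD('n) + 1) / enn2real r"
  shows "\<exists>c C :: real. 0 < c \<and> 0 < C \<and> (\<forall>(f :: real \<times> (real ^ 'n) \<Rightarrow> complex) g k t x.
    f \<in> borel_measurable (lebesgue_on upper_half_space) \<longrightarrow> g \<in> borel_measurable borel \<longrightarrow>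
    (AE w in lborel. 0 < fst w \<longrightarrow> ennreal (norm (f w)) = g w) \<longrightarrow>
    2 powi k / 2 \<le> t \<longrightarrow> t \<le> 2 * 2 powi k \<longrightarrow>
    ennreal (c * (2 powi k) powr \<gamma>) * loc_norm r g ({t/2..t} \<times> ball x t) \<le>
      whitney_mean r (\<lambda>(s, y). ennreal (norm ((s powr (- \<beta>)) *\<^sub>R f (s, y)))) t x \<and>
    whitney_mean r (\<lambda>(s, y). ennreal (norm ((s powr (- \<beta>)) *\<^sub>R f (s, y)))) t x \<le>
      ennreal (C * (2 powi k) powr \<gamma>) * loc_norm r g ({t/2..t} \<times> ball x t))"
proof -
  define d where "d = real (CARD('n) + 1)"
  define e where "e = 1 / enn2real r"
  define \<omega> where "\<omega> = unit_ball_vol (real CARD('n)) / 2"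
  define c C where "c = \<omega> powr (- e) * 4 powr (- \<bar>- d * e\<bar>) * 4 powr (- \<bar>- \<beta>\<bar>)"
    and "C = \<omega> powr (- e) * 4 powr \<bar>- d * e\<bar> * 4 powr \<bar>- \<beta>\<bar>"
  have \<omega>: "0 < \<omega>" by (simp add: \<omega>_def)
  then have cC: "0 < c" "0 < C" by (simp_all add: c_def C_def)
  show ?thesis
  proof (rule exI[of _ c], rule exI[of _ C], intro conjI allI impI cC)
    fix f :: "real \<times> (real ^ 'n) \<Rightarrow> complex" and g k and t :: real and x :: "real ^ 'n"
    assume f: "f \<in> borel_measurable (lebesgue_on upper_half_space)"
      and g[measurable]: "g \<in> borel_measurable borel"
      and fg: "AE w in lborel. 0 < fst w \<longrightarrow> ennreal (norm (f w)) = g w"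
      and t: "2 powi k / 2 \<le> t" "t \<le> 2 * 2 powi k"
    define l where "l = (2::real) powi k"
    have l: "0 < l" by (simp add: l_def)
    have t_pos: "0 < t" using t l unfolding l_def by linarith
    define E where "E = {t/2..t} \<times> ball x t"
    have [measurable]: "E \<in> sets borel" unfolding E_def by (rule Times_sets_borel) auto
    define h where "h = (\<lambda>w. ennreal (fst w powr (- \<beta>)) * g w)"
    have [measurable]: "h \<in> borel_measurable borel" unfolding h_def by measurable
    have scale: "v powr a = l powr a * (v / l) powr a" if "0 < v" for v a :: real
      using that l by (simp add: powr_mult[symmetric])
    have V: "(unit_ball_vol CARD('n) * t ^ CARD('n) * (t / 2)) powr (- e) =
        \<omega> powr (- e) * (l powr (- d * e) * (t / l) powr (- d * e))"
    proof -
      have "unit_ball_vol CARD('n) * t ^ CARD('n) * (t / 2) = \<omega> * t powr d"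
        unfolding d_def powr_realpow[OF t_pos] by (simp add: \<omega>_def)
      then have "(unit_ball_vol CARD('n) * t ^ CARD('n) * (t / 2)) powr (- e) = \<omega> powr (- e) * t powr (- d * e)"
        using \<omega> t_pos by (simp add: powr_mult powr_powr)
      then show ?thesis using scale[OF t_pos] by simp
    qed
    have wm: "whitney_mean r (\<lambda>(s, y). ennreal (norm ((s powr (- \<beta>)) *\<^sub>R f (s, y)))) t x =
        ennreal (\<omega> powr (- e) * (l powr (- d * e) * (t / l) powr (- d * e))) * loc_norm r h E"
      unfolding whitney_mean_eq[OF assms(1) f g fg t_pos] h_def E_def V[symmetric] by (simp add: e_def)
    have tl: "1 / 4 \<le> t / l" "t / l \<le> 4"
      using t l by (auto simp: l_def field_simps)
    have sl: "1 / 4 \<le> fst w / l" "fst w / l \<le> 4" "0 < fst w" if "w \<in> E" for w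
      using that t l t_pos by (auto simp: E_def l_def field_simps)
    have lg: "l powr (- d * e) * l powr (- \<beta>) = l powr \<gamma>"
    proof -
      have "\<gamma> = - d * e + - \<beta>" unfolding \<gamma>_def d_def[symmetric] e_def by simp
      then show ?thesis by (simp only: powr_add)
    qed
    have h_bounds: "g w \<le> ennreal (4 powr \<bar>- \<beta>\<bar> / l powr (- \<beta>)) * h w"
      "h w \<le> ennreal (l powr (- \<beta>) * 4 powr \<bar>- \<beta>\<bar>) * g w" if "w \<in> E" for w
    proof -
      have b: "4 powr (- \<bar>- \<beta>\<bar>) \<le> (fst w / l) powr (- \<beta>)" "(fst w / l) powr (- \<beta>) \<le> 4 powr \<bar>- \<beta>\<bar>"
        using powr_between[OF sl(1,2)[OF that], of "- \<beta>"] by auto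
      have "1 \<le> (4 powr \<bar>- \<beta>\<bar> / l powr (- \<beta>)) * fst w powr (- \<beta>)"
        unfolding scale[OF sl(3)[OF that], of "- \<beta>"] using b(1) l
        by (simp add: powr_minus_divide[of 4 "\<bar>\<beta>\<bar>"] field_simps)
      then have "ennreal 1 * g w \<le> ennreal ((4 powr \<bar>- \<beta>\<bar> / l powr (- \<beta>)) * fst w powr (- \<beta>)) * g w"
        by (intro mult_right_mono ennreal_leI) auto
      then show "g w \<le> ennreal (4 powr \<bar>- \<beta>\<bar> / l powr (- \<beta>)) * h w"
        by (subst (asm) ennreal_mult') (simp_all only: h_def mult.assoc ennreal_1 mult_1 divide_nonneg_nonneg powr_ge_zero)
      have "fst w powr (- \<beta>) \<le> l powr (- \<beta>) * 4 powr \<bar>- \<beta>\<bar>"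
        unfolding scale[OF sl(3)[OF that], of "- \<beta>"] using b(2) by (intro mult_left_mono) auto
      then show "h w \<le> ennreal (l powr (- \<beta>) * 4 powr \<bar>- \<beta>\<bar>) * g w"
        unfolding h_def by (intro mult_right_mono ennreal_leI) auto
    qed
    have "loc_norm r g E \<le> ennreal (4 powr \<bar>- \<beta>\<bar> / l powr (- \<beta>)) * loc_norm r h E"
      using h_bounds(1) by (intro loc_norm_le assms(1)) auto
    then have "ennreal (c * l powr \<gamma>) * loc_norm r g E \<le>
        ennreal (c * l powr \<gamma>) * (ennreal (4 powr \<bar>- \<beta>\<bar> / l powr (- \<beta>)) * loc_norm r h E)"
      by (intro mult_left_mono) auto
    also have "\<dots> = ennreal (c * l powr \<gamma> * (4 powr \<bar>- \<beta>\<bar> / l powr (- \<beta>))) * loc_norm r h E"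
      using cC by (simp add: ennreal_mult'[symmetric] mult.assoc[symmetric])
    also have "c * l powr \<gamma> * (4 powr \<bar>- \<beta>\<bar> / l powr (- \<beta>)) =
        \<omega> powr (- e) * (l powr (- d * e) * 4 powr (- \<bar>- d * e\<bar>))"
      using l by (simp add: lg[symmetric] c_def powr_minus_divide[of 4 "\<bar>\<beta>\<bar>"])
    also have "ennreal (\<omega> powr (- e) * (l powr (- d * e) * 4 powr (- \<bar>- d * e\<bar>))) * loc_norm r h E \<le>
        ennreal (\<omega> powr (- e) * (l powr (- d * e) * (t / l) powr (- d * e))) * loc_norm r h E"
      using powr_between(1)[OF tl, of "- d * e"] by (intro mult_right_mono ennreal_leI mult_left_mono) auto
    finally show "ennreal (c * (2 powi k) powr \<gamma>) * loc_norm r g ({t/2..t} \<times> ball x t) \<le>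
        whitney_mean r (\<lambda>(s, y). ennreal (norm ((s powr (- \<beta>)) *\<^sub>R f (s, y)))) t x"
      unfolding wm by (simp add: l_def E_def)
    have "loc_norm r h E \<le> ennreal (l powr (- \<beta>) * 4 powr \<bar>- \<beta>\<bar>) * loc_norm r g E"
      using h_bounds(2) by (intro loc_norm_le assms(1)) auto
    then have "ennreal (\<omega> powr (- e) * (l powr (- d * e) * (t / l) powr (- d * e))) * loc_norm r h E \<le>
        ennreal (\<omega> powr (- e) * (l powr (- d * e) * 4 powr \<bar>- d * e\<bar>)) *
        (ennreal (l powr (- \<beta>) * 4 powr \<bar>- \<beta>\<bar>) * loc_norm r g E)"
      using powr_between(2)[OF tl, of "- d * e"] by (intro mult_mono ennreal_leI mult_left_mono) auto
    also have "\<dots> = ennreal (\<omega> powr (- e) * (l powr (- d * e) * 4 powr \<bar>- d * e\<bar>) *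
        (l powr (- \<beta>) * 4 powr \<bar>- \<beta>\<bar>)) * loc_norm r g E"
      by (simp add: ennreal_mult'[symmetric] mult.assoc[symmetric])
    also have "\<omega> powr (- e) * (l powr (- d * e) * 4 powr \<bar>- d * e\<bar>) * (l powr (- \<beta>) * 4 powr \<bar>- \<beta>\<bar>) =
        C * l powr \<gamma>"
      by (simp add: lg[symmetric] C_def mult_ac)
    finally show "whitney_mean r (\<lambda>(s, y). ennreal (norm ((s powr (- \<beta>)) *\<^sub>R f (s, y)))) t x \<le>
      ennreal (C * (2 powi k) powr \<gamma>) * loc_norm r g ({t/2..t} \<times> ball x t)"
      unfolding wm by (simp add: l_def E_def)
  qed
qed

text \<open>For r = \<infinity> the norm is at most c iff a section of a jointly measurable set is
  null, and the measure of sections depends measurably on t. For finite r this is Tonelli.\<close>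

lemma measurable_loc_norm_whitney:
  fixes h :: "real \<times> (real ^ 'n) \<Rightarrow> ennreal"
  assumes [measurable]: "h \<in> borel_measurable borel"
  shows "(\<lambda>t. loc_norm r h ({t/2..t} \<times> ball x t)) \<in> borel_measurable borel"
proof -
  have eq: "h w * indicator ({t/2..t} \<times> ball x t) w =
      (if t / 2 \<le> fst w \<and> fst w \<le> t \<and> dist x (snd w) < t then h w else 0)" for t w
    by (cases w) (auto simp: indicator_def)
  have [measurable]: "(\<lambda>(t, w). if t / 2 \<le> fst w \<and> fst w \<le> t \<and> dist x (snd w) < t then h w else 0)
      \<in> borel_measurable (borel \<Otimes>\<^sub>M lborel)"
    by measurable
  show ?thesis
  proof (cases "r = \<infinity>")
    case True
    have "(\<lambda>t. esssup lborel (\<lambda>w. h w * indicator ({t/2..t} \<times> ball x t) w)) \<in> borel_measurable borel"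
    proof (rule borel_measurableI_le)
      fix c :: ennreal
      have "esssup lborel (\<lambda>w. h w * indicator ({t/2..t} \<times> ball x t) w) \<le> c \<longleftrightarrow>
          emeasure lborel {w \<in> space lborel. c < (if t / 2 \<le> fst w \<and> fst w \<le> t \<and> dist x (snd w) < t then h w else 0)} = 0" for t
        unfolding eq
        by (subst esssup_le_iff, measurable, subst AE_iff_measurable[OF _ refl], measurable)
           (simp add: not_le)
      then have "{t \<in> space borel. esssup lborel (\<lambda>w. h w * indicator ({t/2..t} \<times> ball x t) w) \<le> c} =
          {t \<in> space borel. emeasure lborel {w \<in> space lborel. c < (if t / 2 \<le> fst w \<and> fst w \<le> t \<and> dist x (snd w) < t then h w else 0)} = 0}"
        by simp
      also have "\<dots> \<in> sets borel" by measurable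
      finally show "{t \<in> space borel. esssup lborel (\<lambda>w. h w * indicator ({t/2..t} \<times> ball x t) w) \<le> c} \<in> sets borel" .
    qed
    then show ?thesis
      using True by (simp add: loc_norm_def Lp_qnorm_def)
  next
    case False
    then show ?thesis
      unfolding loc_norm_def Lp_qnorm_def eq by simp
  qed
qed

lemma whitney_mean_measurable:
  fixes f :: "real \<times> (real ^ 'n) \<Rightarrow> complex"
  assumes "0 < r" and f: "f \<in> borel_measurable (lebesgue_on upper_half_space)"
    and g[measurable]: "g \<in> borel_measurable borel"
    and fg: "AE w in lborel. 0 < fst w \<longrightarrow> ennreal (norm (f w)) = g w"
  shows "(\<lambda>t. whitney_mean r (\<lambda>(s, y). ennreal (norm ((s powr (- \<beta>)) *\<^sub>R f (s, y)))) t x)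
    \<in> borel_measurable dt_over_t"
proof -
  define H where "H t = ennreal ((unit_ball_vol CARD('n) * t ^ CARD('n) * (t / 2)) powr (- 1 / enn2real r)) *
    loc_norm r (\<lambda>w. ennreal (fst w powr (- \<beta>)) * g w) ({t/2..t} \<times> ball x t)" for t
  have [measurable]: "H \<in> borel_measurable borel"
  proof -
    have [measurable]: "(\<lambda>t. loc_norm r (\<lambda>w. ennreal (fst w powr (- \<beta>)) * g w) ({t/2..t} \<times> ball x t))
        \<in> borel_measurable borel"
      by (rule measurable_loc_norm_whitney) measurable
    show ?thesis unfolding H_def[abs_def] by measurable
  qed
  have "H \<in> borel_measurable dt_over_t"
    unfolding dt_over_t_def using borel_measurable_lebesgue_onI[of H] by simp
  then show ?thesis
    by (rule measurable_cong[THEN iffD1, rotated])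
       (simp only: H_def whitney_mean_eq[OF assms] space_dt_over_t greaterThan_iff)
qed

section \<open>Comparison\<close>

text \<open>The estimates of the local norms take such a g as input: Tonelli and joint measurability
  need a Borel function, and both quasi-norms see |f| only up to null sets.\<close>

lemma ex_borel_representative:
  fixes f :: "real \<times> (real ^ 'n) \<Rightarrow> complex"
  assumes "f \<in> borel_measurable (lebesgue_on upper_half_space)"
  obtains g where "g \<in> borel_measurable borel"
    "AE w in lborel. 0 < fst w \<longrightarrow> ennreal (norm (f w)) = g w"
proof -
  let ?U = "upper_half_space :: (real \<times> (real ^ 'n)) set"
  have U: "?U \<in> sets borel" unfolding upper_half_space_def by (rule Times_sets_borel) auto
  have "(\<lambda>w. ennreal (norm (f w))) \<in> borel_measurable (lebesgue_on ?U)"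
    using assms by measurable
  then have "(\<lambda>w. ennreal (norm (f w)) * indicator ?U w) \<in> borel_measurable lebesgue"
    using U by (subst (asm) borel_measurable_restrict_space_iff_ennreal) auto
  then obtain g where g: "g \<in> borel_measurable lborel"
    "AE w in lborel. ennreal (norm (f w)) * indicator ?U w = g w"
    using completion_ex_borel_measurable by blast
  show thesis
  proof (rule that[of g])
    show "AE w in lborel. 0 < fst w \<longrightarrow> ennreal (norm (f w)) = g w"
      using g(2) by eventually_elim (auto simp: upper_half_space_def indicator_def split: if_splits)
  qed (use g in simp)
qed

text \<open>For \<open>M = 0\<close> the region is a Whitney box. For \<open>M > 0\<close> its base is small compared with its
  height, so that each half of it lies in a Whitney region centred at any given point
  of the base.\<close>

definition dy_coeff ::
  "real \<Rightarrow> ennreal \<Rightarrow> (real \<times> (real ^ 'n) \<Rightarrow> ennreal) \<Rightarrow> int \<Rightarrow> int \<Rightarrow> real ^ 'n \<Rightarrow> ennreal" where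
  "dy_coeff \<gamma> r g M j x = ennreal ((2 powi j) powr \<gamma>) *
     loc_norm r g ({2 powi (j + M) / 2<..2 powi (j + M)} \<times> dy_cube j (dy_index j x))"

lemma level_const_dy_coeff: "level_const j (dy_coeff \<gamma> r g M j)"
  unfolding level_const_def dy_coeff_def by simp

lemma dy_coeff_shift:
  "dy_coeff \<gamma> r g M j (dy_shift j m x) = ennreal ((2 powi j) powr \<gamma>) *
     loc_norm r g ({2 powi (j + M) / 2<..2 powi (j + M)} \<times> dy_cube j (dy_index j x + m))"
  by (simp add: dy_coeff_def)

lemma power_int_powr_le:
  assumes "\<bar>k - j\<bar> \<le> m"
  shows "(2 powi k) powr \<gamma> \<le> 2 powr (real_of_int m * \<bar>\<gamma>\<bar>) * (2 powi j) powr (\<gamma> :: real)"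
proof -
  have p: "((2::real) powi i) powr \<gamma> = 2 powr (real_of_int i * \<gamma>)" for i
    by (simp add: powr_real_of_int'[symmetric] powr_powr)
  have "real_of_int (k - j) * \<gamma> \<le> \<bar>real_of_int (k - j)\<bar> * \<bar>\<gamma>\<bar>"
    by (simp add: abs_mult[symmetric])
  also have "\<dots> \<le> real_of_int m * \<bar>\<gamma>\<bar>"
    using assms by (intro mult_right_mono) linarith+
  finally have "real_of_int k * \<gamma> \<le> real_of_int m * \<bar>\<gamma>\<bar> + real_of_int j * \<gamma>"
    by (simp add: algebra_simps)
  then show ?thesis
    by (simp add: p powr_add[symmetric])
qed

lemma ennreal_SUP_left_commute:
  fixes f :: "'a \<Rightarrow> ennreal"
  shows "a * (c * (SUP i\<in>I. f i)) = c * (SUP i\<in>I. a * f i)"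
proof -
  have "(SUP i\<in>I. a * f i) = a * (SUP i\<in>I. f i)"
    by (simp add: SUP_mult_left_ennreal)
  then show ?thesis by (simp only: mult.left_commute)
qed

lemma loc_norm_le_SUP:
  assumes "0 < r" "finite S" "S \<noteq> {}" and [measurable]: "g \<in> borel_measurable borel"
    "E \<in> sets borel" "\<And>i. i \<in> S \<Longrightarrow> D i \<in> sets borel"
    and cover: "E \<subseteq> (\<Union>i\<in>S. D i)"
  shows "loc_norm r g E \<le> ennreal (real (card S) powr (1 / enn2real r)) * (SUP i\<in>S. loc_norm r g (D i))"
  unfolding loc_norm_def
proof (rule Lp_qnorm_le_SUP[OF assms(1-3)])
  show "AE w in lborel. g w * indicator E w \<le> (SUP i\<in>S. g w * indicator (D i) w)"
  proof (rule AE_I2)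
    fix w
    show "g w * indicator E w \<le> (SUP i\<in>S. g w * indicator (D i) w)"
    proof (cases "w \<in> E")
      case True
      then obtain i where "i \<in> S" "w \<in> D i" using cover by blast
      then show ?thesis using True by (intro SUP_upper2[of i]) auto
    qed simp
  qed
qed measurable

lemma component_dist_le:
  fixes x y :: "real ^ 'n"
  shows "\<bar>y $ i - x $ i\<bar> \<le> dist x y"
  using component_le_norm_cart[of "y - x" i] by (simp add: dist_norm norm_minus_commute)

lemma dy_term_bounds:
  fixes f :: "real \<times> (real ^ 'n) \<Rightarrow> complex" and \<beta> :: real
  assumes "0 < r" and "f \<in> borel_measurable (lebesgue_on upper_half_space)"
    and "g \<in> borel_measurable borel"
    and "AE w in lborel. 0 < fst w \<longrightarrow> ennreal (norm (f w)) = g w"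
  defines "d \<equiv> real (CARD('n) + 1)"
  defines "\<gamma> \<equiv> - \<beta> - d / enn2real r"
  shows "dy_coeff \<gamma> r g 0 k x \<le> dy_term \<beta> r f k x"
    and "dy_term \<beta> r f k x \<le> ennreal (2 powr (d / enn2real r)) * dy_coeff \<gamma> r g 0 k x"
proof -
  define N where "N = loc_norm r g (whitney_box (dy_cube k (dy_index k x)))"
  define l where "l = (2::real) powi k"
  have N: "dy_coeff \<gamma> r g 0 k x = ennreal (l powr \<gamma>) * N"
    by (simp add: dy_coeff_def N_def whitney_box_def side_length_dy_cube l_def)
  have l: "l powr \<gamma> = l powr (- \<beta>) * l powr (- d / enn2real r)"
    by (simp add: \<gamma>_def powr_add[symmetric])
  note b = whitney_box_norm_bounds[OF assms(1-4), of k "dy_index k x", folded d_def l_def N_def]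
  show "dy_coeff \<gamma> r g 0 k x \<le> dy_term \<beta> r f k x"
    using mult_left_mono[OF b(1), of "ennreal (l powr (- \<beta>))"]
    unfolding N l dy_term_def l_def[symmetric] by (simp add: ennreal_mult' mult.assoc)
  show "dy_term \<beta> r f k x \<le> ennreal (2 powr (d / enn2real r)) * dy_coeff \<gamma> r g 0 k x"
    using mult_left_mono[OF b(2), of "ennreal (l powr (- \<beta>))"]
    unfolding N l dy_term_def l_def[symmetric] by (simp add: ennreal_mult' mult_ac)
qed

text \<open>With l = 2^k, the heights in [t/2, t] lie in (l/4, l], covered by the Whitney heights of
  levels k and k - 1. The radius of the ball is at most l, which is 2 side lengths of level k - 1;
  hence the bound 2 on m.\<close>

lemma whitney_region_le_dy_coeff:
  fixes g :: "real \<times> (real ^ 'n) \<Rightarrow> ennreal"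
  assumes "0 < r" and g[measurable]: "g \<in> borel_measurable borel"
    and t: "t \<in> {2 powi k / 2<..2 powi k}"
  defines "S \<equiv> {0, 1} \<times> {m :: int ^ 'n. \<forall>i. \<bar>m $ i\<bar> \<le> 2}"
  shows "ennreal ((2 powi k) powr \<gamma>) * loc_norm r g ({t/2..t} \<times> ball x t) \<le>
    ennreal (2 powr \<bar>\<gamma>\<bar> * real (card S) powr (1 / enn2real r)) *
    (SUP (i, m)\<in>S. dy_coeff \<gamma> r g 0 (k - i) (dy_shift (k - i) m x))"
proof -
  define D where "D i m = {(2::real) powi (k - i) / 2<..2 powi (k - i)} \<times> dy_cube (k - i) (dy_index (k - i) x + m)"
    for i and m :: "int ^ 'n"
  have S: "finite S" "S \<noteq> {}"
  proof -
    show "finite S" unfolding S_def by (intro finite_cartesian_product finite_int_vec_box) simp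
    have "(0, 0) \<in> S" by (simp add: S_def)
    then show "S \<noteq> {}" by blast
  qed
  have half: "(2::real) powi (k - 1) = 2 powi k / 2"
    by (simp add: power_int_diff)
  have "{t/2..t} \<times> ball x t \<subseteq> (\<Union>(i, m)\<in>S. D i m)"
  proof clarify
    fix s y assume s: "s \<in> {t/2..t}" and y: "y \<in> ball x t"
    have m: "dy_index (k - i) y - dy_index (k - i) x \<in> {m. \<forall>i. \<bar>m $ i\<bar> \<le> 2}" if "i \<in> {0, 1}" for i
    proof -
      have "\<bar>y $ j - x $ j\<bar> \<le> real_of_int 2 * 2 powi (k - i)" for j
        using component_dist_le[of y j x] y t that by (auto simp: half)
      then show ?thesis using dy_index_close[of y x 2 "k - i"] by blast
    qed
    have "\<exists>i\<in>{0, 1}. s \<in> {2 powi (k - i) / 2<..2 powi (k - i)}"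
      using s t by (auto simp: half)
    then obtain i where i: "i \<in> {0, 1}" "s \<in> {2 powi (k - i) / 2<..2 powi (k - i)}" by blast
    then have "(i, dy_index (k - i) y - dy_index (k - i) x) \<in> S"
      using m by (auto simp: S_def)
    moreover have "(s, y) \<in> D i (dy_index (k - i) y - dy_index (k - i) x)"
      using i by (auto simp: D_def dy_cube_def)
    ultimately show "(s, y) \<in> (\<Union>(i, m)\<in>S. D i m)" by blast
  qed
  then have "loc_norm r g ({t/2..t} \<times> ball x t) \<le>
      ennreal (real (card S) powr (1 / enn2real r)) * (SUP z\<in>S. loc_norm r g (case z of (i, m) \<Rightarrow> D i m))"
    by (intro loc_norm_le_SUP assms(1) S g) (auto simp: D_def intro!: Times_sets_borel)
  then have "ennreal ((2 powi k) powr \<gamma>) * loc_norm r g ({t/2..t} \<times> ball x t) \<le>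
      ennreal ((2 powi k) powr \<gamma>) * (ennreal (real (card S) powr (1 / enn2real r)) *
      (SUP z\<in>S. loc_norm r g (case z of (i, m) \<Rightarrow> D i m)))"
    by (intro mult_left_mono) auto
  also have "\<dots> = ennreal (real (card S) powr (1 / enn2real r)) *
      (SUP z\<in>S. ennreal ((2 powi k) powr \<gamma>) * loc_norm r g (case z of (i, m) \<Rightarrow> D i m))"
    by (rule ennreal_SUP_left_commute)
  also have "\<dots> \<le> ennreal (real (card S) powr (1 / enn2real r)) *
      (SUP z\<in>S. ennreal (2 powr \<bar>\<gamma>\<bar>) * (case z of (i, m) \<Rightarrow> dy_coeff \<gamma> r g 0 (k - i) (dy_shift (k - i) m x)))"
  proof (intro mult_left_mono SUP_mono bexI)
    fix z assume z: "z \<in> S"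
    obtain i m where im: "z = (i, m)" "i \<in> {0, 1}" using z by (auto simp: S_def)
    have "(2 powi k) powr \<gamma> \<le> 2 powr \<bar>\<gamma>\<bar> * (2 powi (k - i)) powr \<gamma>"
      using power_int_powr_le[of k "k - i" 1 \<gamma>] im(2) by auto
    then have "ennreal ((2 powi k) powr \<gamma>) * loc_norm r g (D i m) \<le>
        ennreal (2 powr \<bar>\<gamma>\<bar> * (2 powi (k - i)) powr \<gamma>) * loc_norm r g (D i m)"
      by (intro mult_right_mono ennreal_leI) auto
    then show "ennreal ((2 powi k) powr \<gamma>) * loc_norm r g (case z of (i, m) \<Rightarrow> D i m) \<le>
        ennreal (2 powr \<bar>\<gamma>\<bar>) * (case z of (i, m) \<Rightarrow> dy_coeff \<gamma> r g 0 (k - i) (dy_shift (k - i) m x))"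
      unfolding im by (simp add: dy_coeff_shift D_def ennreal_mult' mult.assoc)
  qed auto
  also have "\<dots> = ennreal (2 powr \<bar>\<gamma>\<bar> * real (card S) powr (1 / enn2real r)) *
    (SUP (i, m)\<in>S. dy_coeff \<gamma> r g 0 (k - i) (dy_shift (k - i) m x))"
    by (simp add: ennreal_mult' SUP_mult_left_ennreal[symmetric] mult_ac)
  finally show ?thesis .
qed

text \<open>The base of the Whitney box is cut into cubes of side 2^(k-M) while the height is kept.
  They lie in the same cube of side 2^k as x, that is, within 2^M of the small side lengths.\<close>

lemma dy_coeff_le_refined:
  fixes g :: "real \<times> (real ^ 'n) \<Rightarrow> ennreal" and M :: nat
  assumes "0 < r" and g[measurable]: "g \<in> borel_measurable borel"
  defines "S \<equiv> {int M} \<times> {m :: int ^ 'n. \<forall>i. \<bar>m $ i\<bar> \<le> 2 ^ M}"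
  shows "dy_coeff \<gamma> r g 0 k x \<le>
    ennreal (2 powr (real M * \<bar>\<gamma>\<bar>) * real (card S) powr (1 / enn2real r)) *
    (SUP (i, m)\<in>S. dy_coeff \<gamma> r g (int M) (k - i) (dy_shift (k - i) m x))"
proof -
  define j where "j = k - int M"
  define D where "D m = {(2::real) powi k / 2<..2 powi k} \<times> dy_cube j (dy_index j x + m)" for m :: "int ^ 'n"
  define E where "E = {(2::real) powi k / 2<..2 powi k} \<times> dy_cube k (dy_index k x)"
  have S: "finite S" "S \<noteq> {}"
  proof -
    show "finite S" unfolding S_def by (intro finite_cartesian_product finite_int_vec_box) simp
    have "(int M, 0) \<in> S" by (simp add: S_def)
    then show "S \<noteq> {}" by blast
  qed
  have "E \<subseteq> (\<Union>z\<in>S. D (snd z))"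
  proof
    fix w assume w: "w \<in> E"
    define y where "y = snd w"
    have idx: "dy_index k y = dy_index k x"
      using w by (auto simp: E_def dy_cube_def y_def)
    have "(2::real) powi k = 2 ^ M * 2 powi j"
      by (simp add: j_def power_int_diff)
    moreover have "\<bar>y $ i - x $ i\<bar> \<le> 2 powi k" for i
    proof -
      have 1: "2 powi k * real_of_int (dy_index k x $ i) \<le> x $ i \<and>
          x $ i < 2 powi k * (real_of_int (dy_index k x $ i) + 1)"
        using dy_index_eq_iff[of k x "dy_index k x"] by blast
      have 2: "2 powi k * real_of_int (dy_index k x $ i) \<le> y $ i \<and>
          y $ i < 2 powi k * (real_of_int (dy_index k x $ i) + 1)"
        using dy_index_eq_iff[of k y "dy_index k x"] idx by blast
      show ?thesis using 1 2 by (simp add: distrib_left abs_le_iff)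
    qed
    ultimately have "\<bar>y $ i - x $ i\<bar> \<le> real_of_int (2 ^ M) * 2 powi j" for i
      by simp
    then have "(int M, dy_index j y - dy_index j x) \<in> S"
      using dy_index_close[of y x "2 ^ M" j] by (auto simp: S_def)
    moreover have "w \<in> D (dy_index j y - dy_index j x)"
      using w by (auto simp: E_def D_def dy_cube_def y_def)
    ultimately show "w \<in> (\<Union>z\<in>S. D (snd z))" by force
  qed
  then have "loc_norm r g E \<le>
      ennreal (real (card S) powr (1 / enn2real r)) * (SUP z\<in>S. loc_norm r g (D (snd z)))"
    by (intro loc_norm_le_SUP assms(1) S g) (auto simp: D_def E_def intro!: Times_sets_borel)
  then have "dy_coeff \<gamma> r g 0 k x \<le>
      ennreal ((2 powi k) powr \<gamma>) * (ennreal (real (card S) powr (1 / enn2real r)) *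
      (SUP z\<in>S. loc_norm r g (D (snd z))))"
    unfolding dy_coeff_def E_def by (intro mult_left_mono) auto
  also have "\<dots> = ennreal (real (card S) powr (1 / enn2real r)) *
      (SUP z\<in>S. ennreal ((2 powi k) powr \<gamma>) * loc_norm r g (D (snd z)))"
    by (rule ennreal_SUP_left_commute)
  also have "\<dots> \<le> ennreal (real (card S) powr (1 / enn2real r)) *
      (SUP z\<in>S. ennreal (2 powr (real M * \<bar>\<gamma>\<bar>)) *
        (case z of (i, m) \<Rightarrow> dy_coeff \<gamma> r g (int M) (k - i) (dy_shift (k - i) m x)))"
  proof (intro mult_left_mono SUP_mono bexI)
    fix z assume z: "z \<in> S"
    obtain m where m: "z = (int M, m)" using z by (auto simp: S_def)
    have "(2 powi k) powr \<gamma> \<le> 2 powr (real M * \<bar>\<gamma>\<bar>) * (2 powi j) powr \<gamma>"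
      using power_int_powr_le[of k j "int M" \<gamma>] by (auto simp: j_def)
    then have "ennreal ((2 powi k) powr \<gamma>) * loc_norm r g (D m) \<le>
        ennreal (2 powr (real M * \<bar>\<gamma>\<bar>) * (2 powi j) powr \<gamma>) * loc_norm r g (D m)"
      by (intro mult_right_mono ennreal_leI) auto
    then show "ennreal ((2 powi k) powr \<gamma>) * loc_norm r g (D (snd z)) \<le>
        ennreal (2 powr (real M * \<bar>\<gamma>\<bar>)) *
        (case z of (i, m) \<Rightarrow> dy_coeff \<gamma> r g (int M) (k - i) (dy_shift (k - i) m x))"
      unfolding m by (simp add: dy_coeff_shift D_def j_def ennreal_mult' mult.assoc)
  qed auto
  also have "\<dots> = ennreal (2 powr (real M * \<bar>\<gamma>\<bar>) * real (card S) powr (1 / enn2real r)) *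
    (SUP (i, m)\<in>S. dy_coeff \<gamma> r g (int M) (k - i) (dy_shift (k - i) m x))"
    by (simp add: ennreal_mult' SUP_mult_left_ennreal[symmetric] mult_ac)
  finally show ?thesis .
qed

lemma disjoint_family_dyadic_scales:
  fixes a b :: real
  assumes "0 < a" "b < 2 * a"
  shows "disjoint_family (\<lambda>j::int. {a * 2 powi (j + M)..b * 2 powi (j + M)})"
proof -
  have *: "{a * 2 powi (j + M)..b * 2 powi (j + M)} \<inter> {a * 2 powi (k + M)..b * 2 powi (k + M)} = {}"
    if "j < k" for j k :: int
  proof (rule ccontr)
    assume "\<not> ?thesis"
    then have le: "a * 2 powi (k + M) \<le> b * 2 powi (j + M)" by force
    have "b * 2 powi (j + M) < 2 * a * 2 powi (j + M)"
      using assms by (intro mult_strict_right_mono) auto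
    also have "\<dots> = a * 2 powi (j + M + 1)"
      by (simp add: power_int_add)
    also have "\<dots> \<le> a * 2 powi (k + M)"
      using that assms by (intro mult_left_mono power_int_increasing) auto
    finally show False using le by simp
  qed
  show ?thesis
    unfolding disjoint_family_on_def
  proof (intro ballI impI)
    fix j k :: int assume "j \<noteq> k"
    then show "{a * 2 powi (j + M)..b * 2 powi (j + M)} \<inter> {a * 2 powi (k + M)..b * 2 powi (k + M)} = {}"
      using *[of j k] *[of k j] by (cases j k rule: linorder_cases) auto
  qed
qed

text \<open>With L = 2^(j+M), the heights (L/2, L] fit into [t/2, t] for the single scale t = L
  only. Cut at 3L/4, the lower half fits for all t in [3L/4, L] and the upper one for all t in
  [L, 3L/2]; both ranges have relative length at least 1/4. The choice of M makes the diameter of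
  the base at most L/2, hence less than t.\<close>

lemma lq_dy_coeff_le_Lp_qnorm_dt:
  fixes g :: "real \<times> (real ^ 'n) \<Rightarrow> ennreal" and c :: real and M :: nat
  assumes "0 < q" "0 < r" "0 < c" and g[measurable]: "g \<in> borel_measurable borel"
    and M: "2 * CARD('n) \<le> 2 ^ M"
    and h: "\<And>k t. 2 powi k / 2 \<le> t \<Longrightarrow> t \<le> 2 * 2 powi k \<Longrightarrow>
      ennreal (c * (2 powi k) powr \<gamma>) * loc_norm r g ({t/2..t} \<times> ball x t) \<le> h t"
  shows "lq q (\<lambda>j. dy_coeff \<gamma> r g (int M) j x) \<le>
    ennreal (2 powr (1 / enn2real r) * 2 powr (1 / enn2real q) * (2 powr (real M * \<bar>\<gamma>\<bar>) / c) *
      (1 / 4) powr (- 1 / enn2real q)) * Lp_qnorm dt_over_t q h"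
proof -
  define L where "L j = (2::real) powi (j + int M)" for j
  have L: "0 < L j" for j by (simp add: L_def)
  \<comment> \<open>\<tau> is true for the upper half of the heights.\<close>
  define D where "D \<tau> j = (if \<tau> then {3 / 4 * L j<..L j} else {L j / 2<..3 / 4 * L j}) \<times> dy_cube j (dy_index j x)"
    for \<tau> j
  define P where "P \<tau> j = ennreal ((2 powi j) powr \<gamma>) * loc_norm r g (D \<tau> j)" for \<tau> j
  \<comment> \<open>The power \<gamma> of the side 2^j is to be replaced by that of the height
    \<open>L j\<close>, larger by the factor 2^M; c' pays for this for either sign of
    \<gamma>.\<close>
  define c' where "c' = c / 2 powr (real M * \<bar>\<gamma>\<bar>)"
  have c': "0 < c'" "c' * (2 powr (real M * \<bar>\<gamma>\<bar>) / c) = 1" using \<open>0 < c\<close> by (simp_all add: c'_def)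
  have D_meas[measurable]: "D \<tau> j \<in> sets borel" for \<tau> j
    unfolding D_def by (rule Times_sets_borel) auto
  have split: "dy_coeff \<gamma> r g (int M) j x \<le> ennreal (2 powr (1 / enn2real r)) * (SUP \<tau>. P \<tau> j)" for j
  proof -
    have "loc_norm r g ({2 powi (j + int M) / 2<..2 powi (j + int M)} \<times> dy_cube j (dy_index j x)) \<le>
        ennreal (real (card (UNIV :: bool set)) powr (1 / enn2real r)) * (SUP \<tau>. loc_norm r g (D \<tau> j))"
      by (intro loc_norm_le_SUP assms(2)) (auto simp: D_def L_def UNIV_bool intro!: Times_sets_borel)
    then have "dy_coeff \<gamma> r g (int M) j x \<le> ennreal ((2 powi j) powr \<gamma>) *
        (ennreal (2 powr (1 / enn2real r)) * (SUP \<tau>. loc_norm r g (D \<tau> j)))"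
      unfolding dy_coeff_def by (intro mult_left_mono) auto
    also have "\<dots> = ennreal (2 powr (1 / enn2real r)) * (SUP \<tau>. P \<tau> j)"
      unfolding P_def by (rule ennreal_SUP_left_commute)
    finally show ?thesis .
  qed
  have region: "ennreal c' * P \<tau> j \<le> h t"
    if t: "t \<in> {(if \<tau> then 1 else 3 / 4) * L j..(if \<tau> then 3 / 2 else 1) * L j}" for \<tau> j t
  proof -
    have t': "L j / 2 \<le> t" "t \<le> 2 * L j" "L j / 2 < t"
      using t L[of j] by (auto split: if_splits)
    have sub: "D \<tau> j \<subseteq> {t/2..t} \<times> ball x t"
    proof
      fix w assume w: "w \<in> D \<tau> j"
      obtain s y where sy: "w = (s, y)" by (cases w)
      have s: "s \<in> {t/2..t}"
        using w t L[of j] by (auto simp: sy D_def split: if_splits)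
      have idx: "dy_index j y = dy_index j x"
        using w by (auto simp: sy D_def dy_cube_def)
      have "\<bar>(y - x) $ i\<bar> \<le> 2 powi j" for i
      proof -
        have 1: "2 powi j * real_of_int (dy_index j x $ i) \<le> x $ i \<and>
            x $ i < 2 powi j * (real_of_int (dy_index j x $ i) + 1)"
          using dy_index_eq_iff[of j x "dy_index j x"] by blast
        have 2: "2 powi j * real_of_int (dy_index j x $ i) \<le> y $ i \<and>
            y $ i < 2 powi j * (real_of_int (dy_index j x $ i) + 1)"
          using dy_index_eq_iff[of j y "dy_index j x"] idx by blast
        show ?thesis using 1 2 by (simp add: distrib_left abs_le_iff)
      qed
      then have "norm (y - x) \<le> real CARD('n) * 2 powi j"
        using norm_le_l1_cart[of "y - x"] sum_bounded_above[of UNIV "\<lambda>i. \<bar>(y - x) $ i\<bar>" "2 powi j"]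
        by simp
      also have "\<dots> \<le> (2 ^ M / 2) * 2 powi j"
        using of_nat_mono[OF M, where 'a=real] by (intro mult_right_mono) auto
      also have "\<dots> = L j / 2" by (simp add: L_def power_int_add)
      finally have "dist x y < t" using t'(3) by (simp add: dist_norm norm_minus_commute)
      then show "w \<in> {t/2..t} \<times> ball x t" using s by (simp add: sy)
    qed
    have "loc_norm r g (D \<tau> j) \<le> 1 * loc_norm r g ({t/2..t} \<times> ball x t)"
      using sub by (intro loc_norm_le assms(2)) (auto intro!: Times_sets_borel)
    moreover have "c' * (2 powi j) powr \<gamma> \<le> c * (L j) powr \<gamma>"
    proof -
      have "c' * (2 powi j) powr \<gamma> \<le> c' * (2 powr (real M * \<bar>\<gamma>\<bar>) * (L j) powr \<gamma>)"
        using power_int_powr_le[of j "j + int M" "int M" \<gamma>] c'(1) by (intro mult_left_mono) (auto simp: L_def)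
      also have "\<dots> = c * (L j) powr \<gamma>" by (simp add: c'_def)
      finally show ?thesis .
    qed
    ultimately have "ennreal (c' * (2 powi j) powr \<gamma>) * loc_norm r g (D \<tau> j) \<le>
        ennreal (c * (L j) powr \<gamma>) * loc_norm r g ({t/2..t} \<times> ball x t)"
      by (intro mult_mono[OF ennreal_leI]) simp_all
    also have "\<dots> \<le> h t"
      using h[of "j + int M" t] t' by (simp add: L_def)
    finally show ?thesis
      using c' by (simp add: P_def ennreal_mult' mult.assoc)
  qed
  have lqP: "lq q (P \<tau>) \<le> ennreal (2 powr (real M * \<bar>\<gamma>\<bar>) / c * (1 / 4) powr (- 1 / enn2real q)) *
      Lp_qnorm dt_over_t q h" for \<tau>
  proof -
    have "ennreal c' * lq q (P \<tau>) = lq q (\<lambda>j. ennreal c' * P \<tau> j)"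
      by (rule lq_cmult[OF assms(1), symmetric])
    also have "\<dots> \<le> ennreal ((1 / 4) powr (- 1 / enn2real q)) * Lp_qnorm dt_over_t q h"
    proof (rule lq_le_Lp_qnorm_dt[OF assms(1)])
      show "disjoint_family (\<lambda>j. {(if \<tau> then 1 else 3 / 4) * L j..(if \<tau> then 3 / 2 else 1) * L j})"
        unfolding L_def by (rule disjoint_family_dyadic_scales) auto
      show "ennreal c' * P \<tau> j \<le> h t"
        if "t \<in> {(if \<tau> then 1 else 3 / 4) * L j..(if \<tau> then 3 / 2 else 1) * L j}" for j t
        using that by (rule region)
      show "0 < (if \<tau> then 1 else 3 / 4) * L j" for j
        using L[of j] by simp
      show "(if \<tau> then 1 else 3 / 4) * L j \<le> (if \<tau> then 3 / 2 else 1) * L j" for j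
        using L[of j] by simp
      show "1 / 4 \<le> ((if \<tau> then 3 / 2 else 1) * L j - (if \<tau> then 1 else 3 / 4) * L j) / ((if \<tau> then 3 / 2 else 1) * L j)" for j
        using L[of j] by (simp add: field_simps)
    qed simp
    finally have "ennreal (2 powr (real M * \<bar>\<gamma>\<bar>) / c) * (ennreal c' * lq q (P \<tau>)) \<le>
        ennreal (2 powr (real M * \<bar>\<gamma>\<bar>) / c) * (ennreal ((1 / 4) powr (- 1 / enn2real q)) * Lp_qnorm dt_over_t q h)"
      by (rule mult_left_mono) simp
    moreover have "ennreal (2 powr (real M * \<bar>\<gamma>\<bar>) / c) * ennreal c' = 1"
      using c' \<open>0 < c\<close> by (simp add: ennreal_mult'[symmetric] mult.commute)
    moreover have "ennreal (2 powr (real M * \<bar>\<gamma>\<bar>) / c * (1 / 4) powr (- 1 / enn2real q)) =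
        ennreal (2 powr (real M * \<bar>\<gamma>\<bar>) / c) * ennreal ((1 / 4) powr (- 1 / enn2real q))"
      using \<open>0 < c\<close> by (intro ennreal_mult') simp
    ultimately show ?thesis
      by (simp only: mult.assoc[symmetric] mult_1)
  qed
  have "lq q (\<lambda>j. dy_coeff \<gamma> r g (int M) j x) \<le> lq q (\<lambda>j. ennreal (2 powr (1 / enn2real r)) * (SUP \<tau>. P \<tau> j))"
    using assms(1) split by (rule lq_mono)
  also have "\<dots> = ennreal (2 powr (1 / enn2real r)) * lq q (\<lambda>j. SUP \<tau>. P \<tau> j)"
    by (rule lq_cmult[OF assms(1)])
  also have "\<dots> \<le> ennreal (2 powr (1 / enn2real r)) *
      (ennreal (real (card (UNIV :: bool set)) powr (1 / enn2real q)) * (SUP \<tau>. lq q (P \<tau>)))"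
    by (intro mult_left_mono lq_SUP_le assms(1)) auto
  also have "\<dots> \<le> ennreal (2 powr (1 / enn2real r)) * (ennreal (2 powr (1 / enn2real q)) *
      (ennreal (2 powr (real M * \<bar>\<gamma>\<bar>) / c * (1 / 4) powr (- 1 / enn2real q)) * Lp_qnorm dt_over_t q h))"
    using lqP by (intro mult_mono SUP_least) auto
  also have "\<dots> = ennreal (2 powr (1 / enn2real r) * 2 powr (1 / enn2real q) * (2 powr (real M * \<bar>\<gamma>\<bar>) / c) *
      (1 / 4) powr (- 1 / enn2real q)) * Lp_qnorm dt_over_t q h"
    using \<open>0 < c\<close> by (simp add: ennreal_mult'[symmetric] mult.assoc[symmetric])
  finally show ?thesis .
qed

text \<open>Measurability is assumed for u only, since v will be the Whitney functional. So K is
  divided off inside the integral of u before monotonicity is used, instead of being pulled out of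
  the integral of v.\<close>

lemma enn_powr_nn_integral_le_cmult:
  assumes "0 < p" "0 < K" and [measurable]: "u \<in> borel_measurable M"
    and le: "\<And>x. u x \<le> ennreal K * v x"
  shows "enn_powr (\<integral>\<^sup>+x. enn_powr (u x) p \<partial>M) (1 / p) \<le>
    ennreal K * enn_powr (\<integral>\<^sup>+x. enn_powr (v x) p \<partial>M) (1 / p)"
proof -
  have inv: "ennreal (1 / K) * (ennreal K * z) = z" "ennreal K * (ennreal (1 / K) * z) = z" for z
    using \<open>0 < K\<close> by (simp_all add: mult.assoc[symmetric] ennreal_mult'[symmetric])
  have "ennreal (1 / K) * u x \<le> v x" for x
    using mult_left_mono[OF le, of "ennreal (1 / K)" x] by (simp add: inv)
  then have "(\<integral>\<^sup>+x. enn_powr (ennreal (1 / K) * u x) p \<partial>M) \<le> (\<integral>\<^sup>+x. enn_powr (v x) p \<partial>M)"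
    using \<open>0 < p\<close> by (intro nn_integral_mono enn_powr_mono) auto
  then have "enn_powr (enn_powr (ennreal (1 / K)) p * (\<integral>\<^sup>+x. enn_powr (u x) p \<partial>M)) (1 / p) \<le>
      enn_powr (\<integral>\<^sup>+x. enn_powr (v x) p \<partial>M) (1 / p)"
    using \<open>0 < p\<close> by (intro enn_powr_mono) (simp_all add: enn_powr_mult nn_integral_cmult)
  then have "ennreal (1 / K) * enn_powr (\<integral>\<^sup>+x. enn_powr (u x) p \<partial>M) (1 / p) \<le>
      enn_powr (\<integral>\<^sup>+x. enn_powr (v x) p \<partial>M) (1 / p)"
    using \<open>0 < p\<close> by (simp add: enn_powr_mult)
  from mult_left_mono[OF this, of "ennreal K"] show ?thesis
    by (simp add: inv)
qed

lemma Lp_qnorm_lebesgue_eq: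
  assumes "0 < p"
  shows "Lp_qnorm lebesgue (ennreal p) u = enn_powr (\<integral>\<^sup>+x. enn_powr (u x) p \<partial>lborel) (1 / p)"
  using assms by (simp add: Lp_qnorm_def nn_integral_completion)

theorem proposition3p13:
  fixes p \<beta> :: real and q r :: ennreal
  assumes "0 < p" and "0 < q" and "0 < r"
  shows "\<exists>c C :: real. 0 < c \<and> 0 < C \<and>
    (\<forall>f :: real \<times> (real ^ 'n) \<Rightarrow> complex. f \<in> T_space p q r \<beta> \<longrightarrow>
       ennreal c * T_norm p q r \<beta> f \<le> dyadic_norm p q r \<beta> f \<and>
       dyadic_norm p q r \<beta> f \<le> ennreal C * T_norm p q r \<beta> f)"
proof -
  define d where "d = real (CARD('n) + 1)"
  define \<gamma> where "\<gamma> = - \<beta> - d / enn2real r"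
  define wm where "wm f t x = whitney_mean r (\<lambda>(s, y). ennreal (norm ((s powr (- \<beta>)) *\<^sub>R f (s, y)))) t x"
    for f :: "real \<times> (real ^ 'n) \<Rightarrow> complex" and t x
  have wm_ex: "\<exists>c C :: real. 0 < c \<and> 0 < C \<and> (\<forall>(f :: real \<times> (real ^ 'n) \<Rightarrow> complex) g k t x.
      f \<in> borel_measurable (lebesgue_on upper_half_space) \<longrightarrow> g \<in> borel_measurable borel \<longrightarrow>
      (AE w in lborel. 0 < fst w \<longrightarrow> ennreal (norm (f w)) = g w) \<longrightarrow>
      2 powi k / 2 \<le> t \<longrightarrow> t \<le> 2 * 2 powi k \<longrightarrow>
      ennreal (c * (2 powi k) powr \<gamma>) * loc_norm r g ({t/2..t} \<times> ball x t) \<le> wm f t x \<and>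
      wm f t x \<le> ennreal (C * (2 powi k) powr \<gamma>) * loc_norm r g ({t/2..t} \<times> ball x t))"
    unfolding wm_def \<gamma>_def d_def by (rule whitney_mean_bounds[OF assms(3)])
  then obtain c0 C0 :: real where c0: "0 < c0" and C0: "0 < C0" and
    wm: "\<And>(f :: real \<times> (real ^ 'n) \<Rightarrow> complex) g k t x.
      f \<in> borel_measurable (lebesgue_on upper_half_space) \<Longrightarrow> g \<in> borel_measurable borel \<Longrightarrow>
      AE w in lborel. 0 < fst w \<longrightarrow> ennreal (norm (f w)) = g w \<Longrightarrow>
      2 powi k / 2 \<le> t \<Longrightarrow> t \<le> 2 * 2 powi k \<Longrightarrow>
      ennreal (c0 * (2 powi k) powr \<gamma>) * loc_norm r g ({t/2..t} \<times> ball x t) \<le> wm f t x \<and>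
      wm f t x \<le> ennreal (C0 * (2 powi k) powr \<gamma>) * loc_norm r g ({t/2..t} \<times> ball x t)"
    by blast
  define S1 where "S1 = {0, 1 :: int} \<times> {m :: int ^ 'n. \<forall>i. \<bar>m $ i\<bar> \<le> 2}"
  define K1 where "K1 = C0 * (2 powr \<bar>\<gamma>\<bar> * real (card S1) powr (1 / enn2real r))"
  \<comment> \<open>A convenient exponent, depending on the dimension only, for which 2^M is at
    least twice the dimension.\<close>
  define M where "M = (2 * CARD('n) :: nat)"
  have M: "2 * CARD('n) \<le> 2 ^ M" unfolding M_def by (rule less_imp_le[OF less_exp])
  define S2 where "S2 = {int M} \<times> {m :: int ^ 'n. \<forall>i. \<bar>m $ i\<bar> \<le> 2 ^ M}"
  define K2 where "K2 = 2 powr (real M * \<bar>\<gamma>\<bar>) * real (card S2) powr (1 / enn2real r)"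
  define K3 where "K3 = 2 powr (1 / enn2real r) * 2 powr (1 / enn2real q) * (2 powr (real M * \<bar>\<gamma>\<bar>) / c0) *
      (1 / 4) powr (- 1 / enn2real q)"
  have K3: "0 < K3" using c0 by (simp add: K3_def)
  have fin: "finite S1" "finite S2"
    unfolding S1_def S2_def by (intro finite_cartesian_product finite_int_vec_box; simp)+
  obtain A1 where A1: "0 < A1" "\<And>b u. \<forall>k. level_const k (b k) \<Longrightarrow>
      \<forall>k (x :: real ^ 'n). u k x \<le> ennreal K1 * (SUP (i, m)\<in>S1. b (k - i) (dy_shift (k - i) m x)) \<Longrightarrow>
      (\<integral>\<^sup>+x. enn_powr (lq q (\<lambda>k. u k x)) p \<partial>lborel) \<le>
      ennreal A1 * (\<integral>\<^sup>+x. enn_powr (lq q (\<lambda>k. b k x)) p \<partial>lborel)"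
    using nn_integral_lq_dominated[OF assms(1,2) fin(1), of K1] C0 by (auto simp: K1_def)
  obtain A2 where A2: "0 < A2" "\<And>b u. \<forall>k. level_const k (b k) \<Longrightarrow>
      \<forall>k (x :: real ^ 'n). u k x \<le> ennreal K2 * (SUP (i, m)\<in>S2. b (k - i) (dy_shift (k - i) m x)) \<Longrightarrow>
      (\<integral>\<^sup>+x. enn_powr (lq q (\<lambda>k. u k x)) p \<partial>lborel) \<le>
      ennreal A2 * (\<integral>\<^sup>+x. enn_powr (lq q (\<lambda>k. b k x)) p \<partial>lborel)"
    using nn_integral_lq_dominated[OF assms(1,2) fin(2), of K2] by (auto simp: K2_def)
  define Q where "Q = 2 powr (d / enn2real r)"
  \<comment> \<open>These come from NT \<le> A1^(1/p) NB \<le> A1^(1/p) ND and ND \<le> Q NB \<le> Q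
    A2^(1/p) K3 NT below, where NB, the norm of the coefficients without the weight, mediates
    between the two sides.\<close>
  define c C where "c = 1 / A1 powr (1 / p)" and "C = Q * A2 powr (1 / p) * K3"
  have cC: "0 < c" "0 < C" using A1 A2 K3 by (simp_all add: c_def C_def Q_def)
  show ?thesis
  proof (rule exI[of _ c], rule exI[of _ C], intro conjI allI impI cC)
    fix f :: "real \<times> (real ^ 'n) \<Rightarrow> complex" assume "f \<in> T_space p q r \<beta>"
    then have f: "f \<in> borel_measurable (lebesgue_on upper_half_space)"
      by (simp add: T_space_def)
    obtain g where g: "g \<in> borel_measurable borel"
      and fg: "AE w in lborel. 0 < fst w \<longrightarrow> ennreal (norm (f w)) = g w"
      using ex_borel_representative[OF f] by blast
    define b where "b k x = dy_coeff \<gamma> r g 0 k x" for k x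
    define \<Phi> where "\<Phi> x = Lp_qnorm dt_over_t q (\<lambda>t. wm f t x)" for x
    define NT ND NB where "NT = enn_powr (\<integral>\<^sup>+x. enn_powr (\<Phi> x) p \<partial>lborel) (1 / p)"
      and "ND = enn_powr (\<integral>\<^sup>+x. enn_powr (lq q (\<lambda>k. dy_term \<beta> r f k x)) p \<partial>lborel) (1 / p)"
      and "NB = enn_powr (\<integral>\<^sup>+x. enn_powr (lq q (\<lambda>k. b k x)) p \<partial>lborel) (1 / p)"
    have NT: "T_norm p q r \<beta> f = NT"
      unfolding T_norm_def Lp_qnorm_lebesgue_eq[OF assms(1)] NT_def \<Phi>_def wm_def ..
    have ND: "dyadic_norm p q r \<beta> f = ND"
      unfolding dyadic_norm_eq[OF assms(2)] Lp_qnorm_lebesgue_eq[OF assms(1)] ND_def ..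
    have b: "\<forall>k. level_const k (b k)"
      unfolding b_def[abs_def] using level_const_dy_coeff by blast
    have bD: "b k x \<le> dy_term \<beta> r f k x" "dy_term \<beta> r f k x \<le> ennreal Q * b k x" for k x
      using dy_term_bounds[OF assms(3) f g fg, of \<beta> k x] by (auto simp: b_def \<gamma>_def d_def Q_def)

    have BD: "NB \<le> ND"
      unfolding NB_def ND_def using assms bD by (intro enn_powr_mono nn_integral_mono lq_mono) auto

    have D_meas: "(\<lambda>x. lq q (\<lambda>k. dy_term \<beta> r f k x)) \<in> borel_measurable lborel"
    proof (rule borel_measurable_lq[OF assms(2)])
      show "(\<lambda>x. dy_term \<beta> r f k x) \<in> borel_measurable lborel" for k
        using level_const_measurable[of k "dy_term \<beta> r f k" borel]
        by (simp add: level_const_def dy_term_def)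
    qed
    have coeff_meas: "(\<lambda>x. lq q (\<lambda>k. dy_coeff \<gamma> r g (int M) k x)) \<in> borel_measurable lborel"
    proof (rule borel_measurable_lq[OF assms(2)])
      show "(\<lambda>x. dy_coeff \<gamma> r g (int M) k x) \<in> borel_measurable lborel" for k
        using level_const_measurable[OF level_const_dy_coeff, where N=borel] by simp
    qed

    have "lq q (\<lambda>k. dy_term \<beta> r f k x) \<le> ennreal Q * lq q (\<lambda>k. b k x)" for x
      unfolding lq_cmult[OF assms(2), symmetric] using bD by (intro lq_mono assms(2))
    then have DB: "ND \<le> ennreal Q * NB"
      unfolding ND_def NB_def
      by (intro enn_powr_nn_integral_le_cmult assms(1) D_meas) (simp_all add: Q_def)

    have "(\<integral>\<^sup>+x. enn_powr (\<Phi> x) p \<partial>lborel) \<le>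
        (\<integral>\<^sup>+x. enn_powr (lq q (\<lambda>k. ennreal K1 * (SUP (i, m)\<in>S1. b (k - i) (dy_shift (k - i) m x)))) p \<partial>lborel)"
    proof (intro nn_integral_mono enn_powr_mono)
      fix x
      show "\<Phi> x \<le> lq q (\<lambda>k. ennreal K1 * (SUP (i, m)\<in>S1. b (k - i) (dy_shift (k - i) m x)))"
        unfolding \<Phi>_def
      proof (rule Lp_qnorm_dt_le_lq[OF assms(2)])
        show "(\<lambda>t. wm f t x) \<in> borel_measurable dt_over_t"
          unfolding wm_def by (rule whitney_mean_measurable[OF assms(3) f g fg])
        fix k t assume t: "t \<in> {2 powi k / 2<..2 powi k :: real}"
        have "t \<le> 2 powi k" "(0::real) < 2 powi k" using t by auto
        then have t2: "t \<le> 2 * 2 powi k" by linarith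
        have "wm f t x \<le> ennreal C0 * (ennreal ((2 powi k) powr \<gamma>) * loc_norm r g ({t/2..t} \<times> ball x t))"
          using wm[OF f g fg _ t2, of x] t C0 by (simp add: ennreal_mult' mult.assoc)
        also have "\<dots> \<le> ennreal C0 * (ennreal (2 powr \<bar>\<gamma>\<bar> * real (card S1) powr (1 / enn2real r)) *
            (SUP (i, m)\<in>S1. b (k - i) (dy_shift (k - i) m x)))"
          unfolding S1_def b_def by (intro mult_left_mono whitney_region_le_dy_coeff assms(3) g t) simp
        also have "\<dots> = ennreal K1 * (SUP (i, m)\<in>S1. b (k - i) (dy_shift (k - i) m x))"
          using C0 by (simp add: K1_def ennreal_mult' mult.assoc)
        finally show "wm f t x \<le> ennreal K1 * (SUP (i, m)\<in>S1. b (k - i) (dy_shift (k - i) m x))" .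
      qed
    qed (use assms in auto)
    also have "\<dots> \<le> ennreal A1 * (\<integral>\<^sup>+x. enn_powr (lq q (\<lambda>k. b k x)) p \<partial>lborel)"
      by (rule A1(2)[OF b]) simp
    finally have "NT \<le> enn_powr (ennreal A1 * (\<integral>\<^sup>+x. enn_powr (lq q (\<lambda>k. b k x)) p \<partial>lborel)) (1 / p)"
      unfolding NT_def using assms(1) by (intro enn_powr_mono) auto
    also have "\<dots> = ennreal (A1 powr (1 / p)) * NB"
      using assms(1) A1(1) by (simp add: NB_def enn_powr_mult enn_powr_ennreal)
    finally have TB: "NT \<le> ennreal (A1 powr (1 / p)) * NB" .

    have "(\<integral>\<^sup>+x. enn_powr (lq q (\<lambda>k. b k x)) p \<partial>lborel) \<le>
        ennreal A2 * (\<integral>\<^sup>+x. enn_powr (lq q (\<lambda>k. dy_coeff \<gamma> r g (int M) k x)) p \<partial>lborel)"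
    proof (rule A2(2))
      show "\<forall>k. level_const k (dy_coeff \<gamma> r g (int M) k)"
        using level_const_dy_coeff by blast
      show "\<forall>k x. b k x \<le> ennreal K2 * (SUP (i, m)\<in>S2. dy_coeff \<gamma> r g (int M) (k - i) (dy_shift (k - i) m x))"
        unfolding b_def K2_def S2_def by (intro allI dy_coeff_le_refined assms(3) g)
    qed
    then have "NB \<le> enn_powr (ennreal A2 *
        (\<integral>\<^sup>+x. enn_powr (lq q (\<lambda>k. dy_coeff \<gamma> r g (int M) k x)) p \<partial>lborel)) (1 / p)"
      unfolding NB_def using assms(1) by (intro enn_powr_mono) auto
    also have "\<dots> = ennreal (A2 powr (1 / p)) *
        enn_powr (\<integral>\<^sup>+x. enn_powr (lq q (\<lambda>k. dy_coeff \<gamma> r g (int M) k x)) p \<partial>lborel) (1 / p)"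
      using assms(1) A2(1) by (simp add: enn_powr_mult enn_powr_ennreal)
    also have "\<dots> \<le> ennreal (A2 powr (1 / p)) * (ennreal K3 * NT)"
      unfolding NT_def
    proof (intro mult_left_mono enn_powr_nn_integral_le_cmult assms(1) K3 coeff_meas)
      fix x
      show "lq q (\<lambda>k. dy_coeff \<gamma> r g (int M) k x) \<le> ennreal K3 * \<Phi> x"
        unfolding K3_def \<Phi>_def using wm[OF f g fg]
        by (intro lq_dy_coeff_le_Lp_qnorm_dt assms c0 g M) blast
    qed simp
    finally have BT: "NB \<le> ennreal (A2 powr (1 / p)) * (ennreal K3 * NT)" .

    have "ennreal c * NT \<le> ennreal c * (ennreal (A1 powr (1 / p)) * ND)"
      using order_trans[OF TB mult_left_mono[OF BD]] by (intro mult_left_mono) auto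
    also have "\<dots> = ND"
      using A1(1) by (simp add: c_def mult.assoc[symmetric] ennreal_mult'[symmetric])
    finally show "ennreal c * T_norm p q r \<beta> f \<le> dyadic_norm p q r \<beta> f"
      unfolding NT ND .
    have "ND \<le> ennreal Q * (ennreal (A2 powr (1 / p)) * (ennreal K3 * NT))"
      using order_trans[OF DB mult_left_mono[OF BT]] by simp
    also have "\<dots> = ennreal C * NT"
      by (simp add: C_def Q_def ennreal_mult' mult.assoc)
    finally show "dyadic_norm p q r \<beta> f \<le> ennreal C * T_norm p q r \<beta> f"
      unfolding NT ND .
  qed
qed

end
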